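(* Let $G$ be a Lie group with Lie algebra $\mathfrak{g}$, let $L:T^{(2)}G\to\mathbb{R}$ be a left-invariant Lagrangian with reduced Lagrangian $\ell:2\mathfrak{g}\to\mathbb{R}$, let $h>0$ be the time step, $N\ge1$, let $(a_{ij})_{i,j=1}^s$, $(b_i)_{i=1}^s$ be the coefficients of an $s$-stage Runge--Kutta method, and let $\tau:\mathfrak{g}\to G$ be an approximation of the exponential map. Assume that $\ell$ allows the internal variables $G_k^i,\Xi_k^i,V_k^i,\mu_k^i,\nu_k^i$ to be eliminated from the discrete HOHP equations (the stationarity equations of the discrete HOHP principle), and that these equations subsequently induce a discrete flow map $F:T^*(TG)\to T^*(TG)$; that is, every solution $\gamma\in\mathcal{C}_d$ of the discrete HOHP principle satisfies $F^k(g_0,\xi_0,\mu_0,\nu_0)=(g_k,\xi_k,\mu_k,\nu_k)$. Let $\Phi:H\times G\to G$ be a left action of a Lie group $H$ on $G$ that is a symmetry of the discrete dynamics, in the following sense: (i) $L\big([\Phi_{\mathsf h}\circ g]^{(2)}_{\Phi_{\mathsf h}(g_0)}\big)=L\big([g]^{(2)}_{g_0}\big)$ for all $\mathsf h\in H$ and all $[g]^{(2)}_{g_0}\in T^{(2)}G$; (ii) the group-induced variations of $(G_k^i,\Xi_k^i,V_k^i)\in G\times2\mathfrak{g}\cong T^{(2)}G$ preserve the reconstruction relations $$\Xi_k^i=\xi_k+h\sum_{j=1}^sa_{ij}V_k^j,\quad G_k^i=g_k\tau\Big(h\sum_{j=1}^sa_{ij}\Xi_k^j\Big),\quad\xi_{k+1}=\xi_k+h\sum_{j=1}^sb_jV_k^j,\quad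 g_{k+1}=g_k\tau\Big(h\sum_{j=1}^sb_j\Xi_k^j\Big)$$ ($1\le i\le s$, $0\le k\le N-1$). That is, for every $\zeta\in\mathfrak{h}$, if $(G_k^i(\varepsilon),\Xi_k^i(\varepsilon),V_k^i(\varepsilon))$ denotes the variation of $(G_k^i,\Xi_k^i,V_k^i)$ induced by the action of $\exp_H(\varepsilon\zeta)$ on $T^{(2)}G$, then these varied variables still allow the reconstruction relations to hold for some $\{g_k(\varepsilon),\xi_k(\varepsilon)\}_{k=0}^N$. Then the cotangent-lift momentum map $\mathbf{J}:T^*(TG)\to\mathfrak{h}^*$ associated with the action $T\Phi:H\times TG\to TG$ is preserved by the discrete HOHP integration scheme: for every solution $\gamma\in\mathcal{C}_d$ of the discrete HOHP principle with initial condition $z_0=(g_0,\xi_0,\mu_0,\nu_0)$, and with $z_N:=F^N(z_0)$, one has $\mathbf{J}(z_N)=\mathbf{J}(z_0)$.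
   Context: $T^{(2)}G$ is the second-order tangent bundle: its elements are classes $[g]^{(2)}_{g_0}$ of curves with $g(0)=g_0$ agreeing up to second derivatives at $0$. Its left trivialisation $T^{(2)}G\cong G\times2\mathfrak{g}$ is $[g]^{(2)}_{g_0}\mapsto(g(0),\xi(0),\dot\xi(0))$ with $\xi=g^{-1}\dot g$, and $H$ acts on it by $[g]\mapsto[\Phi_{\mathsf h}\circ g]$. Here $2\mathfrak{g}=\mathfrak{g}\times\mathfrak{g}$ and $2\mathfrak{g}^*=\mathfrak{g}^*\times\mathfrak{g}^*$. $L$ is left-invariant if it does not depend on the $G$-entry in this trivialisation, and $\ell(\xi,u)$ is the induced function on $2\mathfrak{g}$. By left trivialisation $TG\cong G\times\mathfrak{g}$ and $T^*(TG)\cong G\times\mathfrak{g}\times2\mathfrak{g}^*\ni(g,\xi,\mu,\nu)$; the pairing of $(g,\xi,\mu,\nu)$ with a tangent vector $(\delta g,\delta\xi)$ at $(g,\xi)$ is $\langle\mu,g^{-1}\delta g\rangle+\langle\nu,\delta\xi\rangle$. The map $\tau$ is an analytic diffeomorphism in a neighbourhood of $0\in\mathfrak{g}$ (onto a neighbourhood of the identity $e\in G$), with $\tau(0)=e$ and $\tau(-\eta)\tau(\eta)=e$; arguments of $\tau$ and $\tau^{-1}$ are understood to lie in these neighbourhoods. Its right-trivialised differential is $d\tau_\xi(\eta)=(T_\xi\tau(\eta))\tau(\xi)^{-1}$, with inverse $d\tau_\xi^{-1}$. HOHP stands for higher-order Hamilton--Pontryagin. The discrete path space is $\mathcal{C}_d=(G\times\mathfrak{g})\times(G\times\mathfrak{g}\times2\mathfrak{g}^*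 )^N\times(G\times2\mathfrak{g}\times2\mathfrak{g}^* )^{Ns}$ with elements $$\gamma=\big\{(g_0,\xi_0),(g_k,\xi_k,\check\mu_k,\nu_k)_{k=1}^N,(G_k^i,\Xi_k^i,V_k^i,\mu_k^i,\nu_k^i)_{1\le i\le s,\,0\le k\le N-1}\big\},$$ and the discrete HOHP functional $S:\mathcal{C}_d\to\mathbb{R}$ is \begin{align*}S=h\sum_{k=0}^{N-1}\Big\{&\sum_{i=1}^s\Big[b_i\ell(\Xi_k^i,V_k^i)+\Big\langle\mu_k^i,\tfrac1h\tau^{-1}(g_k^{-1}G_k^i)-\sum_{j=1}^sa_{ij}\Xi_k^j\Big\rangle+\Big\langle\nu_k^i,\tfrac1h(\Xi_k^i-\xi_k)-\sum_{j=1}^sa_{ij}V_k^j\Big\rangle\Big]\\&+\Big\langle\check\mu_{k+1},\tfrac1h\tau^{-1}(g_k^{-1}g_{k+1})-\sum_{i=1}^sb_i\Xi_k^i\Big\rangle+\Big\langle\nu_{k+1},\tfrac1h(\xi_{k+1}-\xi_k)-\sum_{i=1}^sb_iV_k^i\Big\rangle\Big\}.\end{align*} $\gamma$ is a solution of the discrete HOHP principle if $dS(\delta\gamma)=0$ for all $\delta\gamma\in T_\gamma\mathcal{C}_d$ with $\delta g_0=\delta g_N=0$ and $\delta\xi_0=\delta\xi_N=0$. Notation: $\Xi_{k+1}=\sum_{j=1}^sb_j\Xi_k^j$, $\Theta_k^i=\sum_{j=1}^sa_{ij}\Xi_k^j$, $\mu_k=(d\tau^{-1}_{-h\Xi_k})^*\check\mu_k$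 for $k=1,\dots,N$, $\nu_0=\nu_1+\sum_{i=1}^s\nu_0^i$, $\mu_0=(d\tau^{-1}_{h\Xi_1})^*\check\mu_1+\sum_{i=1}^s(d\tau^{-1}_{h\Theta_0^i})^*\mu_0^i$. The initial condition of a solution $\gamma$ is $(g_0,\xi_0,\mu_0,\nu_0)\in T^*(TG)$. For an action $\Psi$ of $H$ on a manifold $Q$ and $\zeta\in\mathfrak{h}$ (the Lie algebra of $H$), $\zeta_Q(q)=\frac{d}{d\varepsilon}\big|_{\varepsilon=0}\Psi_{\exp_H(\varepsilon\zeta)}(q)$, and the cotangent-lift momentum map $\mathbf{J}:T^*Q\to\mathfrak{h}^*$ is given by $\langle\mathbf{J}(\alpha_q),\zeta\rangle=\langle\alpha_q,\zeta_Q(q)\rangle$; here $Q=TG$ and $\Psi=T\Phi$, the tangent lift of $\Phi$.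
   Formalization: In (ii) the end nodes (g_k(ε), ξ_k(ε)), k = 0, N, must be the images of (g_k, ξ_k) under the action TΦ of exp_H(εζ); with arbitrary end nodes the claim fails (N = s = 1, SO(3) acting by right translations, ℓ = |u|²/2, non-equivariant odd τ). *)

theory Defs
  imports "HOL-Analysis.Analysis" "HOL-Algebra.Group_Action"
begin

section \<open>Smooth and analytic maps between normed spaces\<close>

primrec Ck_on :: "nat \<Rightarrow> ('a::real_normed_vector \<Rightarrow> 'b::real_normed_vector) \<Rightarrow> 'a set \<Rightarrow> bool" where
  "Ck_on 0 f S \<longleftrightarrow> continuous_on S f"
| "Ck_on (Suc n) f S \<longleftrightarrow> (\<forall>x\<in>S. f differentiable (at x))
     \<and> (\<forall>v. Ck_on n (\<lambda>x. frechet_derivative f (at x) v) S)"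

text \<open>Only used for open sets in finite-dimensional spaces.\<close>

definition smooth_on :: "('a::real_normed_vector \<Rightarrow> 'b::real_normed_vector) \<Rightarrow> 'a set \<Rightarrow> bool" where
  "smooth_on f S \<longleftrightarrow> (\<forall>n. Ck_on n f S)"

definition dir_deriv ::
  "nat \<Rightarrow> ('a::real_normed_vector \<Rightarrow> 'b::real_normed_vector) \<Rightarrow> 'a \<Rightarrow> 'a \<Rightarrow> 'b" where
  "dir_deriv n f x v =
     ((\<lambda>c t. vector_derivative c (at t)) ^^ n) (\<lambda>t::real. f (x + t *\<^sub>R v)) 0"

text \<open>Real analytic: smooth, and equal near every point to the sum of its Taylor series
  \<open>\<Sum>\<^sub>n D\<^sup>n f(x)(v,\<dots>,v) / n!\<close>. In finite dimensions pointwise convergence of this series of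
  homogeneous polynomials on a ball already gives locally uniform absolute convergence.\<close>

definition real_analytic_on ::
  "('a::real_normed_vector \<Rightarrow> 'b::real_normed_vector) \<Rightarrow> 'a set \<Rightarrow> bool" where
  "real_analytic_on f S \<longleftrightarrow> smooth_on f S \<and>
     (\<forall>x\<in>S. \<exists>r>0. \<forall>v. norm v < r \<longrightarrow>
        (\<lambda>n. (1 / fact n) *\<^sub>R dir_deriv n f x v) sums f (x + v))"


section \<open>Manifolds\<close>

text \<open>The model space is a normed space that is finite-dimensional by \<open>manifold\<close> below. The class
  \<open>euclidean_space\<close> is avoided because it excludes dimension 0.\<close>

record ('p, 'v) mfd =
  mtop :: "'p topology"
  atlas :: "('p set \<times> ('p \<Rightarrow> 'v)) set"

definition manifold :: "('p, 'v::real_normed_vector) mfd \<Rightarrow> bool" where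
  "manifold M \<longleftrightarrow>
     (\<exists>B::'v set. finite B \<and> span B = UNIV) \<and>
     Hausdorff_space (mtop M) \<and>
     (\<exists>\<B>. countable \<B> \<and> (\<forall>V\<in>\<B>. openin (mtop M) V) \<and>
        (\<forall>W x. openin (mtop M) W \<and> x \<in> W \<longrightarrow> (\<exists>V\<in>\<B>. x \<in> V \<and> V \<subseteq> W))) \<and>
     (\<forall>(U, \<phi>)\<in>atlas M. openin (mtop M) U \<and> open (\<phi> ` U) \<and>
        homeomorphic_map (subtopology (mtop M) U) (top_of_set (\<phi> ` U)) \<phi>) \<and>
     (\<Union>(U, \<phi>)\<in>atlas M. U) = topspace (mtop M) \<and>
     (\<forall>(U, \<phi>)\<in>atlas M. \<forall>(V, \<psi>)\<in>atlas M.
        real_analytic_on (\<psi> \<circ> the_inv_into U \<phi>) (\<phi> ` (U \<inter> V)))"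

definition vec_mfd :: "('v::real_normed_vector, 'v) mfd" where
  "vec_mfd = \<lparr>mtop = euclidean, atlas = {(UNIV, \<lambda>x. x)}\<rparr>"

definition open_mfd :: "('p, 'v) mfd \<Rightarrow> 'p set \<Rightarrow> ('p, 'v) mfd" where
  "open_mfd M W = \<lparr>mtop = subtopology (mtop M) W, atlas = (\<lambda>(U, \<phi>). (U \<inter> W, \<phi>)) ` atlas M\<rparr>"

definition prod_mfd :: "('p, 'v) mfd \<Rightarrow> ('q, 'w) mfd \<Rightarrow> ('p \<times> 'q, 'v \<times> 'w) mfd" where
  "prod_mfd M N = \<lparr>mtop = prod_topology (mtop M) (mtop N),
     atlas = {(U \<times> V, map_prod \<phi> \<psi>) | U \<phi> V \<psi>. (U, \<phi>) \<in> atlas M \<and> (V, \<psi>) \<in> atlas N}\<rparr>"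

definition smooth_map ::
  "('p, 'v::real_normed_vector) mfd \<Rightarrow> ('q, 'w::real_normed_vector) mfd \<Rightarrow> ('p \<Rightarrow> 'q) \<Rightarrow> bool" where
  "smooth_map M N f \<longleftrightarrow> continuous_map (mtop M) (mtop N) f \<and>
     (\<forall>(U, \<phi>)\<in>atlas M. \<forall>(V, \<psi>)\<in>atlas N.
        smooth_on (\<psi> \<circ> f \<circ> the_inv_into U \<phi>) (\<phi> ` (U \<inter> f -` V)))"

definition analytic_map ::
  "('p, 'v::real_normed_vector) mfd \<Rightarrow> ('q, 'w::real_normed_vector) mfd \<Rightarrow> ('p \<Rightarrow> 'q) \<Rightarrow> bool" where
  "analytic_map M N f \<longleftrightarrow> continuous_map (mtop M) (mtop N) f \<and>
     (\<forall>(U, \<phi>)\<in>atlas M. \<forall>(V, \<psi>)\<in>atlas N.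
        real_analytic_on (\<psi> \<circ> f \<circ> the_inv_into U \<phi>) (\<phi> ` (U \<inter> f -` V)))"

definition analytic_diffeo ::
  "('p, 'v::real_normed_vector) mfd \<Rightarrow> ('q, 'w::real_normed_vector) mfd \<Rightarrow> ('p \<Rightarrow> 'q) \<Rightarrow> bool" where
  "analytic_diffeo M N f \<longleftrightarrow> bij_betw f (topspace (mtop M)) (topspace (mtop N)) \<and>
     analytic_map M N f \<and> analytic_map N M (the_inv_into (topspace (mtop M)) f)"

text \<open>Curves defined and smooth near the parameter value 0.\<close>

definition smooth_curve :: "('p, 'v::real_normed_vector) mfd \<Rightarrow> (real \<Rightarrow> 'p) \<Rightarrow> bool" where
  "smooth_curve M c \<longleftrightarrow> (\<exists>\<delta>>0. smooth_map (open_mfd vec_mfd {-\<delta><..<\<delta>}) M c)"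


section \<open>Lie groups, left trivialisations and jets\<close>

record ('g, 'v) lie = "'g monoid" +
  mfd :: "('g, 'v) mfd"

text \<open>A Lie group carries a unique compatible real analytic structure; it is taken as the given
  structure because analyticity of maps into the group refers to it.\<close>

definition lie_group :: "('g, 'v::real_normed_vector) lie \<Rightarrow> bool" where
  "lie_group G \<longleftrightarrow> group G \<and> manifold (mfd G) \<and> topspace (mtop (mfd G)) = carrier G \<and>
     analytic_map (prod_mfd (mfd G) (mfd G)) (mfd G) (\<lambda>(x, y). x \<otimes>\<^bsub>G\<^esub> y) \<and>
     analytic_map (mfd G) (mfd G) (\<lambda>x. inv\<^bsub>G\<^esub> x)"

text \<open>The Lie algebra \<open>T\<^sub>e G\<close> is represented by the model space, through the differential at the
  identity \<open>e\<close> of a fixed chart \<open>echart G\<close> around \<open>e\<close>.\<close>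

definition echart_at :: "('g, 'v) lie \<Rightarrow> 'g set \<times> ('g \<Rightarrow> 'v)" where
  "echart_at G = (SOME c. c \<in> atlas (mfd G) \<and> \<one>\<^bsub>G\<^esub> \<in> fst c)"

definition echart :: "('g, 'v) lie \<Rightarrow> 'g \<Rightarrow> 'v" where
  "echart G = snd (echart_at G)"

definition echart_inv :: "('g, 'v) lie \<Rightarrow> 'v \<Rightarrow> 'g" where
  "echart_inv G = the_inv_into (fst (echart_at G)) (echart G)"

text \<open>The left-trivialised velocity \<open>c(t)\<^sup>-\<^sup>1 c'(t)\<close>.\<close>

definition lvel :: "('g, 'v::real_normed_vector) lie \<Rightarrow> (real \<Rightarrow> 'g) \<Rightarrow> real \<Rightarrow> 'v" where
  "lvel G c t = vector_derivative (\<lambda>s. echart G (inv\<^bsub>G\<^esub> (c t) \<otimes>\<^bsub>G\<^esub> c s)) (at t)"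

text \<open>The class of a curve in the second-order tangent bundle, and its left trivialisation.\<close>

definition jet2 :: "('p, 'v::real_normed_vector) mfd \<Rightarrow> (real \<Rightarrow> 'p) \<Rightarrow> (real \<Rightarrow> 'p) set" where
  "jet2 M c = {d. smooth_curve M d \<and> d 0 = c 0 \<and> (\<forall>(U, \<phi>)\<in>atlas M. c 0 \<in> U \<longrightarrow>
     vector_derivative (\<phi> \<circ> d) (at 0) = vector_derivative (\<phi> \<circ> c) (at 0) \<and>
     vector_derivative (\<lambda>t. vector_derivative (\<phi> \<circ> d) (at t)) (at 0) =
     vector_derivative (\<lambda>t. vector_derivative (\<phi> \<circ> c) (at t)) (at 0))}"

definition ltriv2 :: "('g, 'v::real_normed_vector) lie \<Rightarrow> (real \<Rightarrow> 'g) \<Rightarrow> 'g \<times> 'v \<times> 'v" where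
  "ltriv2 G c = (c 0, lvel G c 0, vector_derivative (lvel G c) (at 0))"

text \<open>\<open>L\<close> is left-invariant with reduced Lagrangian \<open>l\<close>: on the class of \<open>c\<close> it depends only on the
  two Lie algebra entries of the left trivialisation, through \<open>l\<close>.\<close>

definition reduced_lagrangian ::
  "('g, 'v::real_normed_vector) lie \<Rightarrow> ((real \<Rightarrow> 'g) set \<Rightarrow> real) \<Rightarrow> ('v \<times> 'v \<Rightarrow> real) \<Rightarrow> bool" where
  "reduced_lagrangian G L l \<longleftrightarrow>
     (\<forall>c. smooth_curve (mfd G) c \<longrightarrow> L (jet2 (mfd G) c) = l (snd (ltriv2 G c)))"

text \<open>The map \<open>[c] \<mapsto> [f \<circ> c]\<close> of second-order tangent vectors, in the left trivialisation.\<close>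

definition T2map ::
  "('g, 'v::real_normed_vector) lie \<Rightarrow> ('g \<Rightarrow> 'g) \<Rightarrow> 'g \<times> 'v \<times> 'v \<Rightarrow> 'g \<times> 'v \<times> 'v" where
  "T2map G f p = ltriv2 G (f \<circ> (SOME c. smooth_curve (mfd G) c \<and> ltriv2 G c = p))"

text \<open>The tangent map \<open>Tf\<close> in the left trivialisation of \<open>TG\<close>.\<close>

definition Tmap :: "('g, 'v::real_normed_vector) lie \<Rightarrow> ('g \<Rightarrow> 'g) \<Rightarrow> 'g \<times> 'v \<Rightarrow> 'g \<times> 'v" where
  "Tmap G f = (\<lambda>(g, \<xi>). (f g,
     frechet_derivative (\<lambda>x. echart G (inv\<^bsub>G\<^esub> (f g) \<otimes>\<^bsub>G\<^esub> f (g \<otimes>\<^bsub>G\<^esub> echart_inv G x)))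
       (at (echart G \<one>\<^bsub>G\<^esub>)) \<xi>))"

text \<open>The exponential map, characterised by \<open>t \<mapsto> expH (t \<zeta>)\<close> being the one-parameter subgroup with
  initial velocity \<open>\<zeta>\<close>.\<close>

definition exponential_map :: "('h, 'w::real_normed_vector) lie \<Rightarrow> ('w \<Rightarrow> 'h) \<Rightarrow> bool" where
  "exponential_map H expH \<longleftrightarrow> (\<forall>\<zeta>.
     smooth_map vec_mfd (mfd H) (\<lambda>t::real. expH (t *\<^sub>R \<zeta>)) \<and>
     (\<forall>s t. expH ((s + t) *\<^sub>R \<zeta>) = expH (s *\<^sub>R \<zeta>) \<otimes>\<^bsub>H\<^esub> expH (t *\<^sub>R \<zeta>)) \<and>
     lvel H (\<lambda>t. expH (t *\<^sub>R \<zeta>)) 0 = \<zeta>)"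

definition smooth_action ::
  "('h, 'w::real_normed_vector) lie \<Rightarrow> ('g, 'v::real_normed_vector) lie \<Rightarrow> ('h \<Rightarrow> 'g \<Rightarrow> 'g) \<Rightarrow> bool" where
  "smooth_action H G \<Phi> \<longleftrightarrow> group_action H (carrier G) \<Phi> \<and>
     smooth_map (prod_mfd (mfd H) (mfd G)) (mfd G) (\<lambda>(k, g). \<Phi> k g)"


section \<open>The momentum map of the tangent-lifted action\<close>

type_synonym ('g, 'v) cotan = "'g \<times> 'v \<times> ('v \<Rightarrow>\<^sub>L real) \<times> ('v \<Rightarrow>\<^sub>L real)"

text \<open>The infinitesimal generator of \<open>T\<Phi>\<close> at \<open>(g, \<xi>)\<close>, as the pair \<open>(g\<^sup>-\<^sup>1 \<delta>g, \<delta>\<xi>)\<close>.\<close>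

definition TG_generator ::
  "('g, 'v::real_normed_vector) lie \<Rightarrow> ('w::real_normed_vector \<Rightarrow> 'h) \<Rightarrow> ('h \<Rightarrow> 'g \<Rightarrow> 'g) \<Rightarrow> 'w \<Rightarrow>
   'g \<times> 'v \<Rightarrow> 'v \<times> 'v" where
  "TG_generator G expH \<Phi> \<zeta> q =
     (lvel G (\<lambda>\<epsilon>. fst (Tmap G (\<Phi> (expH (\<epsilon> *\<^sub>R \<zeta>))) q)) 0,
      vector_derivative (\<lambda>\<epsilon>. snd (Tmap G (\<Phi> (expH (\<epsilon> *\<^sub>R \<zeta>))) q)) (at 0))"

text \<open>The value of the momentum map is given as the functional \<open>\<zeta> \<mapsto> \<langle>J(z), \<zeta>\<rangle>\<close>.\<close>

definition momentum_map ::
  "('g, 'v::real_normed_vector) lie \<Rightarrow> ('w::real_normed_vector \<Rightarrow> 'h) \<Rightarrow> ('h \<Rightarrow> 'g \<Rightarrow> 'g) \<Rightarrow>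
   ('g, 'v) cotan \<Rightarrow> 'w \<Rightarrow> real" where
  "momentum_map G expH \<Phi> = (\<lambda>(g, \<xi>, \<mu>, \<nu>) \<zeta>.
     (let (\<eta>, \<delta>) = TG_generator G expH \<Phi> \<zeta> (g, \<xi>)
      in blinfun_apply \<mu> \<eta> + blinfun_apply \<nu> \<delta>))"


section \<open>The discrete Hamilton--Pontryagin principle\<close>

record ('g, 'v) scheme =
  tau :: "'v \<Rightarrow> 'g"
  tdom :: "'v set"             \<comment> \<open>the neighbourhood of 0 on which \<open>tau\<close> is a diffeomorphism\<close>
  dt :: real
  nsteps :: nat
  nstages :: nat
  rkA :: "nat \<Rightarrow> nat \<Rightarrow> real"  \<comment> \<open>indices run through \<open>{1..nstages}\<close>\<close>
  rkB :: "nat \<Rightarrow> real"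

definition tau_inv :: "('g, 'v) scheme \<Rightarrow> 'g \<Rightarrow> 'v" where
  "tau_inv D = the_inv_into (tdom D) (tau D)"

definition local_diffeo_tau ::
  "('g, 'v::real_normed_vector) lie \<Rightarrow> ('v \<Rightarrow> 'g) \<Rightarrow> 'v set \<Rightarrow> bool" where
  "local_diffeo_tau G \<tau> U \<longleftrightarrow> open U \<and> 0 \<in> U \<and> openin (mtop (mfd G)) (\<tau> ` U) \<and>
     analytic_diffeo (open_mfd vec_mfd U) (open_mfd (mfd G) (\<tau> ` U)) \<tau> \<and>
     \<tau> 0 = \<one>\<^bsub>G\<^esub> \<and> (\<forall>\<eta>\<in>U. - \<eta> \<in> U \<and> \<tau> (- \<eta>) \<otimes>\<^bsub>G\<^esub> \<tau> \<eta> = \<one>\<^bsub>G\<^esub>)"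

definition dtau :: "('g, 'v::real_normed_vector) lie \<Rightarrow> ('v \<Rightarrow> 'g) \<Rightarrow> 'v \<Rightarrow> 'v \<Rightarrow> 'v" where
  "dtau G \<tau> \<xi> = frechet_derivative (\<lambda>x. echart G (\<tau> x \<otimes>\<^bsub>G\<^esub> inv\<^bsub>G\<^esub> (\<tau> \<xi>))) (at \<xi>)"

text \<open>The dual map \<open>(d\<tau>\<^sub>\<xi>\<^sup>-\<^sup>1)\<^sup>*\<close>.\<close>

definition dtau_inv_dual ::
  "('g, 'v::real_normed_vector) lie \<Rightarrow> ('v \<Rightarrow> 'g) \<Rightarrow> 'v \<Rightarrow> ('v \<Rightarrow>\<^sub>L real) \<Rightarrow> ('v \<Rightarrow>\<^sub>L real)" where
  "dtau_inv_dual G \<tau> \<xi> \<mu> = Blinfun (\<lambda>\<eta>. blinfun_apply \<mu> (the_inv_into UNIV (dtau G \<tau> \<xi>) \<eta>))"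

text \<open>Discrete paths. Entries outside the following index ranges are irrelevant: nodes
  \<open>k \<in> {0..N}\<close> for \<open>pg\<close>, \<open>p\<xi>\<close> and \<open>k \<in> {1..N}\<close> for \<open>p\<mu>c\<close>, \<open>p\<nu>\<close>; stage variables \<open>sX \<gamma> k i\<close> with
  \<open>k < N\<close>, \<open>i \<in> {1..s}\<close>.\<close>

record (overloaded) ('g, 'v::real_normed_vector) dpath =
  pg :: "nat \<Rightarrow> 'g"
  p\<xi> :: "nat \<Rightarrow> 'v"
  p\<mu>c :: "nat \<Rightarrow> 'v \<Rightarrow>\<^sub>L real"
  p\<nu> :: "nat \<Rightarrow> 'v \<Rightarrow>\<^sub>L real"
  sG :: "nat \<Rightarrow> nat \<Rightarrow> 'g"
  s\<Xi> :: "nat \<Rightarrow> nat \<Rightarrow> 'v"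
  sV :: "nat \<Rightarrow> nat \<Rightarrow> 'v"
  s\<mu> :: "nat \<Rightarrow> nat \<Rightarrow> 'v \<Rightarrow>\<^sub>L real"
  s\<nu> :: "nat \<Rightarrow> nat \<Rightarrow> 'v \<Rightarrow>\<^sub>L real"

text \<open>\<open>rk_inner D X i = \<Sum>\<^sub>j a\<^sub>i\<^sub>j X\<^sub>j\<close> and \<open>rk_outer D X = \<Sum>\<^sub>j b\<^sub>j X\<^sub>j\<close>.\<close>

definition rk_inner :: "('g, 'v::real_normed_vector) scheme \<Rightarrow> (nat \<Rightarrow> 'v) \<Rightarrow> nat \<Rightarrow> 'v" where
  "rk_inner D X i = (\<Sum>j=1..nstages D. rkA D i j *\<^sub>R X j)"

definition rk_outer :: "('g, 'v::real_normed_vector) scheme \<Rightarrow> (nat \<Rightarrow> 'v) \<Rightarrow> 'v" where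
  "rk_outer D X = (\<Sum>j=1..nstages D. rkB D j *\<^sub>R X j)"

definition hohp_functional ::
  "('g, 'v::real_normed_vector) lie \<Rightarrow> ('g, 'v) scheme \<Rightarrow> ('v \<times> 'v \<Rightarrow> real) \<Rightarrow> ('g, 'v) dpath \<Rightarrow> real"
  where
  "hohp_functional G D l \<gamma> = dt D * (\<Sum>k<nsteps D.
     (\<Sum>i=1..nstages D.
        rkB D i * l (s\<Xi> \<gamma> k i, sV \<gamma> k i)
        + blinfun_apply (s\<mu> \<gamma> k i)
            ((1 / dt D) *\<^sub>R tau_inv D (inv\<^bsub>G\<^esub> (pg \<gamma> k) \<otimes>\<^bsub>G\<^esub> sG \<gamma> k i) - rk_inner D (s\<Xi> \<gamma> k) i)
        + blinfun_apply (s\<nu> \<gamma> k i)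
            ((1 / dt D) *\<^sub>R (s\<Xi> \<gamma> k i - p\<xi> \<gamma> k) - rk_inner D (sV \<gamma> k) i))
     + blinfun_apply (p\<mu>c \<gamma> (k+1))
         ((1 / dt D) *\<^sub>R tau_inv D (inv\<^bsub>G\<^esub> (pg \<gamma> k) \<otimes>\<^bsub>G\<^esub> pg \<gamma> (k+1)) - rk_outer D (s\<Xi> \<gamma> k))
     + blinfun_apply (p\<nu> \<gamma> (k+1))
         ((1 / dt D) *\<^sub>R (p\<xi> \<gamma> (k+1) - p\<xi> \<gamma> k) - rk_outer D (sV \<gamma> k)))"

text \<open>Group elements lie in \<open>G\<close>, and the arguments of \<open>\<tau>\<^sup>-\<^sup>1\<close> in the functional lie in its domain.\<close>

definition discrete_path ::
  "('g, 'v::real_normed_vector) lie \<Rightarrow> ('g, 'v) scheme \<Rightarrow> ('g, 'v) dpath \<Rightarrow> bool" where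
  "discrete_path G D \<gamma> \<longleftrightarrow>
     (\<forall>k\<le>nsteps D. pg \<gamma> k \<in> carrier G) \<and>
     (\<forall>k<nsteps D. inv\<^bsub>G\<^esub> (pg \<gamma> k) \<otimes>\<^bsub>G\<^esub> pg \<gamma> (k+1) \<in> tau D ` tdom D) \<and>
     (\<forall>k<nsteps D. \<forall>i\<in>{1..nstages D}. sG \<gamma> k i \<in> carrier G \<and>
        inv\<^bsub>G\<^esub> (pg \<gamma> k) \<otimes>\<^bsub>G\<^esub> sG \<gamma> k i \<in> tau D ` tdom D)"

text \<open>Tangent vectors \<open>\<delta>\<gamma>\<close> with vanishing \<open>\<delta>g\<^sub>0, \<delta>g\<^sub>N, \<delta>\<xi>\<^sub>0, \<delta>\<xi>\<^sub>N\<close> are represented by smooth curves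
  through \<open>\<gamma>\<close>.\<close>

definition fixed_end_variation ::
  "('g, 'v::real_normed_vector) lie \<Rightarrow> ('g, 'v) scheme \<Rightarrow> ('g, 'v) dpath \<Rightarrow> (real \<Rightarrow> ('g, 'v) dpath) \<Rightarrow> bool"
  where
  "fixed_end_variation G D \<gamma> \<Gamma> \<longleftrightarrow> \<Gamma> 0 = \<gamma> \<and>
     (\<forall>k\<le>nsteps D. smooth_curve (mfd G) (\<lambda>\<epsilon>. pg (\<Gamma> \<epsilon>) k) \<and> smooth_curve vec_mfd (\<lambda>\<epsilon>. p\<xi> (\<Gamma> \<epsilon>) k)) \<and>
     (\<forall>k\<in>{1..nsteps D}. smooth_curve vec_mfd (\<lambda>\<epsilon>. p\<mu>c (\<Gamma> \<epsilon>) k) \<and> smooth_curve vec_mfd (\<lambda>\<epsilon>. p\<nu> (\<Gamma> \<epsilon>) k)) \<and>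
     (\<forall>k<nsteps D. \<forall>i\<in>{1..nstages D}.
        smooth_curve (mfd G) (\<lambda>\<epsilon>. sG (\<Gamma> \<epsilon>) k i) \<and>
        smooth_curve vec_mfd (\<lambda>\<epsilon>. s\<Xi> (\<Gamma> \<epsilon>) k i) \<and> smooth_curve vec_mfd (\<lambda>\<epsilon>. sV (\<Gamma> \<epsilon>) k i) \<and>
        smooth_curve vec_mfd (\<lambda>\<epsilon>. s\<mu> (\<Gamma> \<epsilon>) k i) \<and> smooth_curve vec_mfd (\<lambda>\<epsilon>. s\<nu> (\<Gamma> \<epsilon>) k i)) \<and>
     (\<forall>k\<in>{0, nsteps D}. lvel G (\<lambda>\<epsilon>. pg (\<Gamma> \<epsilon>) k) 0 = 0 \<and>
        vector_derivative (\<lambda>\<epsilon>. p\<xi> (\<Gamma> \<epsilon>) k) (at 0) = 0)"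

definition hohp_solution ::
  "('g, 'v::real_normed_vector) lie \<Rightarrow> ('g, 'v) scheme \<Rightarrow> ('v \<times> 'v \<Rightarrow> real) \<Rightarrow> ('g, 'v) dpath \<Rightarrow> bool"
  where
  "hohp_solution G D l \<gamma> \<longleftrightarrow> discrete_path G D \<gamma> \<and>
     (\<forall>\<Gamma>. fixed_end_variation G D \<gamma> \<Gamma> \<longrightarrow>
        ((\<lambda>\<epsilon>. hohp_functional G D l (\<Gamma> \<epsilon>)) has_real_derivative 0) (at 0))"

text \<open>The points \<open>(g\<^sub>k, \<xi>\<^sub>k, \<mu>\<^sub>k, \<nu>\<^sub>k)\<close>; for \<open>k > 0\<close> the argument of \<open>d\<tau>\<close> is \<open>-h \<Xi>\<^sub>k\<close> with
  \<open>\<Xi>\<^sub>k = \<Sum>\<^sub>j b\<^sub>j \<Xi>\<^sub>k\<^sub>-\<^sub>1\<^sup>j\<close>.\<close>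

definition hohp_state ::
  "('g, 'v::real_normed_vector) lie \<Rightarrow> ('g, 'v) scheme \<Rightarrow> ('g, 'v) dpath \<Rightarrow> nat \<Rightarrow> ('g, 'v) cotan" where
  "hohp_state G D \<gamma> k =
    (if k = 0 then
       (pg \<gamma> 0, p\<xi> \<gamma> 0,
        dtau_inv_dual G (tau D) (dt D *\<^sub>R rk_outer D (s\<Xi> \<gamma> 0)) (p\<mu>c \<gamma> 1)
          + (\<Sum>i=1..nstages D. dtau_inv_dual G (tau D) (dt D *\<^sub>R rk_inner D (s\<Xi> \<gamma> 0) i) (s\<mu> \<gamma> 0 i)),
        p\<nu> \<gamma> 1 + (\<Sum>i=1..nstages D. s\<nu> \<gamma> 0 i))
     else
       (pg \<gamma> k, p\<xi> \<gamma> k,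
        dtau_inv_dual G (tau D) (- (dt D *\<^sub>R rk_outer D (s\<Xi> \<gamma> (k-1)))) (p\<mu>c \<gamma> k),
        p\<nu> \<gamma> k))"

definition induces_flow ::
  "('g, 'v::real_normed_vector) lie \<Rightarrow> ('g, 'v) scheme \<Rightarrow> ('v \<times> 'v \<Rightarrow> real) \<Rightarrow>
   (('g, 'v) cotan \<Rightarrow> ('g, 'v) cotan) \<Rightarrow> bool" where
  "induces_flow G D l F \<longleftrightarrow> F \<in> carrier G \<times> UNIV \<rightarrow> carrier G \<times> UNIV \<and>
     (\<forall>\<gamma>. hohp_solution G D l \<gamma> \<longrightarrow>
        (\<forall>k\<le>nsteps D. (F ^^ k) (hohp_state G D \<gamma> 0) = hohp_state G D \<gamma> k))"


section \<open>Symmetries of the discrete dynamics\<close>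

definition lagrangian_invariant ::
  "('h, 'w) lie \<Rightarrow> ('g, 'v::real_normed_vector) lie \<Rightarrow> ((real \<Rightarrow> 'g) set \<Rightarrow> real) \<Rightarrow>
   ('h \<Rightarrow> 'g \<Rightarrow> 'g) \<Rightarrow> bool" where
  "lagrangian_invariant H G L \<Phi> \<longleftrightarrow> (\<forall>k\<in>carrier H. \<forall>c. smooth_curve (mfd G) c \<longrightarrow>
     L (jet2 (mfd G) (\<Phi> k \<circ> c)) = L (jet2 (mfd G) c))"

definition reconstruction ::
  "('g, 'v::real_normed_vector) lie \<Rightarrow> ('g, 'v) scheme \<Rightarrow> (nat \<Rightarrow> nat \<Rightarrow> 'g \<times> 'v \<times> 'v) \<Rightarrow>
   (nat \<Rightarrow> 'g \<times> 'v) \<Rightarrow> bool" where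
  "reconstruction G D w q \<longleftrightarrow>
     (let gs = (\<lambda>k i. fst (w k i)); \<Xi> = (\<lambda>k i. fst (snd (w k i))); V = (\<lambda>k i. snd (snd (w k i)));
          g = (\<lambda>k. fst (q k)); \<xi> = (\<lambda>k. snd (q k)); h = dt D
      in (\<forall>k\<le>nsteps D. g k \<in> carrier G) \<and>
         (\<forall>k<nsteps D.
            (\<forall>i\<in>{1..nstages D}.
               \<Xi> k i = \<xi> k + h *\<^sub>R rk_inner D (V k) i \<and>
               h *\<^sub>R rk_inner D (\<Xi> k) i \<in> tdom D \<and>
               gs k i = g k \<otimes>\<^bsub>G\<^esub> tau D (h *\<^sub>R rk_inner D (\<Xi> k) i)) \<and>
            \<xi> (k+1) = \<xi> k + h *\<^sub>R rk_outer D (V k) \<and>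
            h *\<^sub>R rk_outer D (\<Xi> k) \<in> tdom D \<and>
            g (k+1) = g k \<otimes>\<^bsub>G\<^esub> tau D (h *\<^sub>R rk_outer D (\<Xi> k))))"

text \<open>For small \<open>\<epsilon>\<close> the transformed stage variables satisfy the reconstruction relations with some
  nodes \<open>q k = (g\<^sub>k(\<epsilon>), \<xi>\<^sub>k(\<epsilon>))\<close>, the two end nodes being the ones induced by the group.
  The interior nodes are unrestricted. Without the condition on the end nodes the notion does not
  control \<open>T\<Phi>\<close> at the ends of the path and momentum conservation fails: for \<open>N = s = 1\<close>,
  \<open>a = b = 1\<close> some nodes always exist, whereas on \<open>SO(3)\<close> with
  \<open>\<ell>(\<xi>,u) = |u|\<^sup>2/2\<close> and \<open>H = SO(3)\<close> acting by right translations, conservation is equivalent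
  to infinitesimal equivariance of \<open>\<tau>\<close> under conjugation, which an odd \<open>\<tau>\<close> need not have.\<close>

definition reconstruction_preserved ::
  "('g, 'v::real_normed_vector) lie \<Rightarrow> ('g, 'v) scheme \<Rightarrow> ('w::real_normed_vector \<Rightarrow> 'h) \<Rightarrow>
   ('h \<Rightarrow> 'g \<Rightarrow> 'g) \<Rightarrow> ('g, 'v) dpath \<Rightarrow> bool" where
  "reconstruction_preserved G D expH \<Phi> \<gamma> \<longleftrightarrow> (\<forall>\<zeta>. \<forall>\<^sub>F \<epsilon> in nhds (0::real). \<exists>q.
     reconstruction G D
       (\<lambda>k i. T2map G (\<Phi> (expH (\<epsilon> *\<^sub>R \<zeta>))) (sG \<gamma> k i, s\<Xi> \<gamma> k i, sV \<gamma> k i)) q \<and>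
     (\<forall>k\<in>{0, nsteps D}. q k = Tmap G (\<Phi> (expH (\<epsilon> *\<^sub>R \<zeta>))) (pg \<gamma> k, p\<xi> \<gamma> k)))"

end

(* Noether's argument on the discrete path space. Let the stages of a solution be moved by the group and
   let the nodes be reconstructed from them, starting at the moved initial node. Along this curve of
   paths the pairings in the functional vanish and l is unchanged, so the functional is constant.
   Freezing the two end nodes gives an admissible variation, along which the derivative of the functional
   vanishes because the path is stationary. The two derivatives differ only by the terms carrying the
   velocities of the end nodes, and these terms are the momenta at the two ends. *)
theory Submission
  imports Defs
begin

section \<open>Smooth maps between finite-dimensional spaces\<close>

text \<open>The group is given only by charts, and its trivialisations only by one chart at the
  identity. Hence nothing is differentiated on the manifold itself: every velocity is a partial
  derivative of a chart expression such as \<open>echart G (inv a \<otimes> b)\<close>, in which the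
  base point counts as one more smooth parameter. Differentiating along a diagonal then gives the
  product rule for the inverse of \<tau> at \<open>inv a \<otimes> b\<close>: the velocity of the
  left node enters through \<open>- T \<theta>\<close>, that of the right node through
  \<open>T (- \<theta>)\<close>. This asymmetry is the sign of the argument in the momenta at the
  two ends. Two obstacles come from choices. The nodes allowed by the reconstruction hypothesis are
  unrelated for different parameter values, so smooth nodes are built by recursion and then
  identified with them. The second-order lift uses a chosen curve, which has to be shown to exist.
  Freezing the ends destroys the relations next to them, but the derivative at 0 uses the relations
  at 0 only. The stage contributions need not be computed, since both curves of paths share their
  stages.\<close>

definition finite_dim :: "'a::real_normed_vector itself \<Rightarrow> bool" where
  "finite_dim _ \<longleftrightarrow> (\<exists>B::'a set. finite B \<and> span B = UNIV)"

lemma finite_dim_euclidean: "finite_dim TYPE('a::euclidean_space)"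
  unfolding finite_dim_def using finite_Basis span_Basis by blast

lemma finite_dim_prod:
  assumes "finite_dim TYPE('a::real_normed_vector)" "finite_dim TYPE('b::real_normed_vector)"
  shows "finite_dim TYPE('a \<times> 'b)"
proof -
  obtain B :: "'a set" and C :: "'b set" where B: "finite B" "span B = UNIV" and C: "finite C" "span C = UNIV"
    using assms unfolding finite_dim_def by blast
  let ?S = "(\<lambda>x. (x, 0::'b)) ` B \<union> (\<lambda>y. (0::'a, y)) ` C"
  have l1: "linear (\<lambda>x. (x, 0::'b))" and l2: "linear (\<lambda>y. (0::'a, y))"
    by (auto intro!: linearI)
  have "(x, y) \<in> span ?S" for x y
  proof -
    have "(x, 0) \<in> span ?S"
      using span_mono[of "(\<lambda>x. (x, 0::'b)) ` B" ?S] linear_span_image[OF l1, of B] B(2) by auto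
    moreover have "(0, y) \<in> span ?S"
      using span_mono[of "(\<lambda>y. (0::'a, y)) ` C" ?S] linear_span_image[OF l2, of C] C(2) by auto
    ultimately have "(x, 0) + (0, y) \<in> span ?S" by (rule span_add)
    then show ?thesis by simp
  qed
  then have "span ?S = UNIV" by auto
  moreover have "finite ?S" using B C by auto
  ultimately show ?thesis unfolding finite_dim_def by blast
qed

text \<open>This is equivalence of norms in the form needed for coordinates. Induction works because
  the bound for \<open>B\<close> makes \<open>span B\<close> closed, so a further independent vector
  \<open>a\<close> keeps a positive distance from it.\<close>

lemma independent_coefficients_bound:
  fixes B :: "'a::real_normed_vector set"
  assumes "finite B" "independent B"
  shows "\<exists>C>0. \<forall>u. (\<Sum>b\<in>B. \<bar>u b\<bar>) \<le> C * norm (\<Sum>b\<in>B. u b *\<^sub>R b)"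
  using assms
proof (induction B rule: finite_induct)
  case empty
  then show ?case by (intro exI[of _ 1]) auto
next
  case (insert a B)
  have indB: "independent B" and nin: "a \<notin> span B"
    using insert.prems insert.hyps by (auto simp: independent_insert)
  then obtain C where C: "C > 0" "\<And>u. (\<Sum>b\<in>B. \<bar>u b\<bar>) \<le> C * norm (\<Sum>b\<in>B. u b *\<^sub>R b)"
    using insert.IH by blast
  have "closed (span B)"
    unfolding closed_sequential_limits
  proof (intro allI impI, elim conjE)
    fix x l assume x: "\<forall>n. x n \<in> span B" and lim: "x \<longlonglongrightarrow> l"
    have "\<forall>n. \<exists>u. x n = (\<Sum>b\<in>B. u b *\<^sub>R b)"
      using x by (auto simp: span_finite[OF insert.hyps(1)])
    then obtain u where u: "\<And>n. x n = (\<Sum>b\<in>B. u n b *\<^sub>R b)" by metis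
    \<comment> \<open>The bound for \<open>B\<close> passes the Cauchy property from
      \<open>x\<close> to each coefficient; completeness of the reals then puts the limit into the
      span, without completeness of the space.\<close>
    have cau: "Cauchy (\<lambda>n. u n b)" if "b \<in> B" for b
    proof (rule CauchyI)
      fix e :: real assume "e > 0"
      then have "e / C > 0" using C by simp
      then obtain M where M: "\<And>m n. m \<ge> M \<Longrightarrow> n \<ge> M \<Longrightarrow> norm (x m - x n) < e / C"
        using LIMSEQ_imp_Cauchy[OF lim] CauchyD by metis
      show "\<exists>M. \<forall>m\<ge>M. \<forall>n\<ge>M. norm (u m b - u n b) < e"
      proof (intro exI[of _ M] allI impI)
        fix m n assume "m \<ge> M" "n \<ge> M"
        have "norm (u m b - u n b) \<le> (\<Sum>b\<in>B. \<bar>u m b - u n b\<bar>)"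
          using member_le_sum[OF that, of "\<lambda>b. \<bar>u m b - u n b\<bar>"] insert.hyps(1) by simp
        also have "\<dots> \<le> C * norm (x m - x n)"
          using C(2)[of "\<lambda>b. u m b - u n b"] by (simp add: u scaleR_diff_left sum_subtractf)
        also have "\<dots> < e"
          using M[OF \<open>m \<ge> M\<close> \<open>n \<ge> M\<close>] C(1) by (simp add: field_simps)
        finally show "norm (u m b - u n b) < e" .
      qed
    qed
    have "x \<longlonglongrightarrow> (\<Sum>b\<in>B. lim (\<lambda>n. u n b) *\<^sub>R b)"
      unfolding u using cau
      by (intro tendsto_sum tendsto_scaleR tendsto_const)
        (auto simp: convergent_LIMSEQ_iff[symmetric] real_Cauchy_convergent)
    then have "l = (\<Sum>b\<in>B. lim (\<lambda>n. u n b) *\<^sub>R b)" using lim LIMSEQ_unique by blast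
    then show "l \<in> span B" by (auto intro: span_sum span_scale span_base)
  qed
  then obtain d where d: "d > 0" "ball a d \<subseteq> - span B"
    using nin open_contains_ball[of "- span B"] by (auto simp: open_Compl)
  \<comment> \<open>Divided by \<open>u a\<close>, the sum is \<open>a\<close> minus a point of
    \<open>span B\<close>, hence of norm at least \<open>d\<close>.\<close>
  have key: "\<bar>u a\<bar> * d \<le> norm (\<Sum>b\<in>insert a B. u b *\<^sub>R b)" for u
  proof (cases "u a = 0")
    case False
    let ?s = "\<Sum>b\<in>B. u b *\<^sub>R b"
    have "- (1 / u a) *\<^sub>R ?s \<in> span B"
      by (intro span_scale span_sum) (auto intro: span_scale span_base)
    then have "- (1 / u a) *\<^sub>R ?s \<notin> ball a d" using d by auto
    then have "d \<le> norm (a + (1 / u a) *\<^sub>R ?s)" by (simp add: dist_norm)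
    then have "\<bar>u a\<bar> * d \<le> norm (u a *\<^sub>R (a + (1 / u a) *\<^sub>R ?s))"
      by (simp add: mult_left_mono del: scaleR_add_right)
    also have "u a *\<^sub>R (a + (1 / u a) *\<^sub>R ?s) = (\<Sum>b\<in>insert a B. u b *\<^sub>R b)"
      using insert.hyps False by (simp add: scaleR_add_right)
    finally show ?thesis .
  qed simp
  \<comment> \<open>The constant \<open>1 / d\<close> pays for \<open>u a\<close>; removing the
    multiple of \<open>a\<close> from the sum enlarges its norm by at most the factor
    \<open>1 + norm a / d\<close>.\<close>
  have "(\<Sum>b\<in>insert a B. \<bar>u b\<bar>) \<le> (1 / d + C * (1 + norm a / d)) * norm (\<Sum>b\<in>insert a B. u b *\<^sub>R b)" for u
  proof -
    let ?n = "norm (\<Sum>b\<in>insert a B. u b *\<^sub>R b)"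
    have 1: "\<bar>u a\<bar> \<le> ?n / d" using key[of u] d(1) by (simp add: field_simps)
    have "norm (\<Sum>b\<in>B. u b *\<^sub>R b) = norm ((\<Sum>b\<in>insert a B. u b *\<^sub>R b) - u a *\<^sub>R a)"
      using insert.hyps by simp
    also have "\<dots> \<le> ?n + \<bar>u a\<bar> * norm a"
      using norm_triangle_ineq4[of "\<Sum>b\<in>insert a B. u b *\<^sub>R b" "u a *\<^sub>R a"] by simp
    also have "\<dots> \<le> ?n + ?n / d * norm a"
      using 1 by (intro add_left_mono mult_right_mono) auto
    finally have 2: "norm (\<Sum>b\<in>B. u b *\<^sub>R b) \<le> ?n + ?n / d * norm a" .
    have "(\<Sum>b\<in>insert a B. \<bar>u b\<bar>) = \<bar>u a\<bar> + (\<Sum>b\<in>B. \<bar>u b\<bar>)" using insert.hyps by simp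
    also have "\<dots> \<le> ?n / d + C * (?n + ?n / d * norm a)"
      using 1 2 C(2)[of u] mult_left_mono[OF 2, of C] C(1) by linarith
    finally show ?thesis by (simp add: algebra_simps)
  qed
  moreover have "1 / d + C * (1 + norm a / d) > 0"
    using C(1) d(1) by (intro add_pos_nonneg) auto
  ultimately show ?case by blast
qed

lemma finite_dim_coordinates:
  assumes "finite_dim TYPE('a::real_normed_vector)"
  obtains B :: "'a::real_normed_vector set" and c :: "'a::real_normed_vector \<Rightarrow> 'a \<Rightarrow> real" where
    "finite B" "\<And>b. bounded_linear (c b)" "\<And>x. x = (\<Sum>b\<in>B. c b x *\<^sub>R b)"
proof -
  obtain B0 :: "'a set" where B0: "finite B0" "span B0 = UNIV"
    using assms unfolding finite_dim_def by blast
  obtain B where B: "B \<subseteq> B0" "independent B" "B0 \<subseteq> span B"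
    using maximal_independent_subset[of B0] by metis
  have fB: "finite B" using B B0 finite_subset by blast
  have spB: "span B = UNIV"
    using span_mono[OF B(3)] B0(2) by (simp add: span_span top.extremum_unique)
  obtain C where C: "C > 0" "\<And>u. (\<Sum>b\<in>B. \<bar>u b\<bar>) \<le> C * norm (\<Sum>b\<in>B. u b *\<^sub>R b)"
    using independent_coefficients_bound[OF fB B(2)] by blast
  have rep: "(\<Sum>b\<in>B. representation B x b *\<^sub>R b) = x" for x
    by (rule real_vector.sum_representation_eq) (use B fB spB in auto)
  have "bounded_linear (\<lambda>x. representation B x b)" for b
  proof (rule bounded_linear_intro[where K=C])
    show "representation B (x + y) b = representation B x b + representation B y b" for x y
      by (subst representation_add) (use B(2) spB in auto)
    show "representation B (r *\<^sub>R x) b = r *\<^sub>R representation B x b" for r x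
      by (subst representation_scale) (use B(2) spB in auto)
    show "norm (representation B x b) \<le> norm x * C" for x
    proof (cases "b \<in> B")
      case True
      have "norm (representation B x b) \<le> (\<Sum>b\<in>B. \<bar>representation B x b\<bar>)"
        using member_le_sum[OF True, of "\<lambda>b. \<bar>representation B x b\<bar>"] fB by simp
      also have "\<dots> \<le> C * norm x" using C(2)[of "representation B x"] rep by simp
      finally show ?thesis by (simp add: mult.commute)
    next
      case False
      then have "representation B x b = 0" using representation_ne_zero by metis
      then show ?thesis using C(1) by simp
    qed
  qed
  then show thesis using that[of B "\<lambda>b x. representation B x b"] fB rep by simp
qed

text \<open>Stationarity in a multiplier gives one scalar equation for each functional; this turns
  them back into a vector equation.\<close>

lemma finite_dim_dual_separates:
  fixes x :: "'a::real_normed_vector"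
  assumes "finite_dim TYPE('a)" "\<And>f :: 'a \<Rightarrow>\<^sub>L real. f x = 0"
  shows "x = 0"
proof -
  obtain B and c :: "'a \<Rightarrow> 'a \<Rightarrow> real" where
    c: "\<And>b. bounded_linear (c b)" "\<And>x. x = (\<Sum>b\<in>B. c b x *\<^sub>R b)"
    using finite_dim_coordinates[OF assms(1)] by metis
  have "c b x = 0" for b
    using assms(2)[of "Blinfun (c b)"] by (simp add: bounded_linear_Blinfun_apply[OF c(1)])
  then have "(\<Sum>b\<in>B. c b x *\<^sub>R b) = 0" by simp
  with c(2)[of x] show ?thesis by metis
qed

section \<open>Calculus of finitely often differentiable maps\<close>

lemma Ck_on_cong:
  assumes "open S" "\<And>x. x \<in> S \<Longrightarrow> f x = g x" "Ck_on n f S"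
  shows "Ck_on n g S"
  using assms
proof (induction n arbitrary: f g)
  case 0
  then show ?case using continuous_on_cong[of S S f g] by simp
next
  case (Suc n)
  have d: "g differentiable (at x)" if x: "x \<in> S" for x
  proof -
    obtain f' where "(f has_derivative f') (at x)"
      using Suc.prems(3) x by (auto simp: differentiable_def)
    then have "(g has_derivative f') (at x)"
      using has_derivative_transform_within_open[OF _ Suc.prems(1) x] Suc.prems(2) by blast
    then show ?thesis by (auto simp: differentiable_def)
  qed
  have "frechet_derivative f (at x) = frechet_derivative g (at x)" if "x \<in> S" for x
    using Suc.prems that by (intro frechet_derivative_transform_within_open[of _ _ S]) auto
  then have "Ck_on n (\<lambda>x. frechet_derivative g (at x) v) S" for v
    using Suc.IH[of "\<lambda>x. frechet_derivative f (at x) v" "\<lambda>x. frechet_derivative g (at x) v"] Suc.prems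
    by simp
  with d show ?case by simp
qed

lemma Ck_on_subset: "Ck_on n f S \<Longrightarrow> T \<subseteq> S \<Longrightarrow> Ck_on n f T"
  by (induction n arbitrary: f) (auto intro: continuous_on_subset)

lemma Ck_on_local:
  assumes "\<And>x. x \<in> S \<Longrightarrow> \<exists>T. open T \<and> x \<in> T \<and> Ck_on n f T"
  shows "Ck_on n f S"
  using assms
proof (induction n arbitrary: f)
  case 0
  have "isCont f x" if x: "x \<in> S" for x
  proof -
    obtain T where "open T" "x \<in> T" "continuous_on T f" using 0[OF x] by auto
    then show ?thesis by (simp add: continuous_on_eq_continuous_at)
  qed
  then show ?case by (simp add: continuous_at_imp_continuous_on)
next
  case (Suc n)
  have "f differentiable (at x)" if "x \<in> S" for x
    using Suc.prems[OF that] by auto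
  moreover have "Ck_on n (\<lambda>x. frechet_derivative f (at x) v) S" for v
    by (rule Suc.IH) (use Suc.prems in fastforce)
  ultimately show ?case by simp
qed

lemma Ck_on_Suc_D: "Ck_on (Suc n) f S \<Longrightarrow> Ck_on n f S"
proof (induction n arbitrary: f)
  case 0
  then have "isCont f x" if "x \<in> S" for x
    using that differentiable_imp_continuous_within by (simp del: Ck_on.simps(1)) blast
  then show ?case by (simp add: continuous_at_imp_continuous_on)
next
  case (Suc n)
  then show ?case by (metis Ck_on.simps(2))
qed

lemma Ck_on_Suc_has_derivative:
  "Ck_on (Suc n) f S \<Longrightarrow> x \<in> S \<Longrightarrow> (f has_derivative frechet_derivative f (at x)) (at x)"
  using frechet_derivative_works by auto

text \<open>\<open>Ck_on\<close> is phrased with the choice \<open>frechet_derivative\<close>; on an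
  open set uniqueness of the derivative lets any explicit family take its place.\<close>

lemma Ck_on_SucI:
  assumes "open S" "\<And>x. x \<in> S \<Longrightarrow> (f has_derivative f' x) (at x)" "\<And>v. Ck_on n (\<lambda>x. f' x v) S"
  shows "Ck_on (Suc n) f S"
proof -
  have "Ck_on n (\<lambda>x. frechet_derivative f (at x) v) S" for v
  proof (rule Ck_on_cong[OF assms(1) _ assms(3)[of v]])
    show "f' x v = frechet_derivative f (at x) v" if "x \<in> S" for x
      using frechet_derivative_at[OF assms(2)[OF that]] by simp
  qed
  moreover have "f differentiable (at x)" if "x \<in> S" for x
    using assms(2)[OF that] by (rule differentiableI)
  ultimately show ?thesis by simp
qed

lemma Ck_on_const: "Ck_on n (\<lambda>x. c) S"
  by (induction n arbitrary: c) auto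

lemma Ck_on_linear:
  assumes "bounded_linear L" "open S" shows "Ck_on n L S"
proof (cases n)
  case 0
  then show ?thesis using assms by (auto intro: linear_continuous_on)
next
  case (Suc m)
  then show ?thesis
    using assms by (auto intro!: Ck_on_SucI[where f'="\<lambda>_. L"] bounded_linear_imp_has_derivative Ck_on_const
       simp del: Ck_on.simps(2))
qed

lemma Ck_on_linear_compose:
  assumes "bounded_linear L" "open S" "Ck_on n f S"
  shows "Ck_on n (\<lambda>x. L (f x)) S"
  using assms(3)
proof (induction n arbitrary: f)
  case 0
  then show ?case using bounded_linear.continuous_on[OF assms(1)] by auto
next
  case (Suc n)
  show ?case
  proof (rule Ck_on_SucI[OF assms(2)])
    show "((\<lambda>x. L (f x)) has_derivative (\<lambda>v. L (frechet_derivative f (at x) v))) (at x)" if "x \<in> S" for x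
      by (rule bounded_linear.has_derivative[OF assms(1) Ck_on_Suc_has_derivative[OF Suc.prems that]])
    show "Ck_on n (\<lambda>x. L (frechet_derivative f (at x) v)) S" for v
      using Suc by simp
  qed
qed

lemma Ck_on_add:
  assumes "open S" "Ck_on n f S" "Ck_on n g S"
  shows "Ck_on n (\<lambda>x. f x + g x) S"
  using assms(2,3)
proof (induction n arbitrary: f g)
  case 0
  then show ?case by (simp add: continuous_on_add)
next
  case (Suc n)
  show ?case
  proof (rule Ck_on_SucI[OF assms(1)])
    show "((\<lambda>x. f x + g x) has_derivative
        (\<lambda>v. frechet_derivative f (at x) v + frechet_derivative g (at x) v)) (at x)" if "x \<in> S" for x
      by (intro has_derivative_add Ck_on_Suc_has_derivative[OF Suc.prems(1) that] Ck_on_Suc_has_derivative[OF Suc.prems(2) that])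
    show "Ck_on n (\<lambda>x. frechet_derivative f (at x) v + frechet_derivative g (at x) v) S" for v
      using Suc by simp
  qed
qed

lemma Ck_on_sum:
  assumes "open S" "\<And>i. i \<in> I \<Longrightarrow> Ck_on n (f i) S"
  shows "Ck_on n (\<lambda>x. \<Sum>i\<in>I. f i x) S"
  using assms(2) by (induction I rule: infinite_finite_induct) (auto intro: Ck_on_const Ck_on_add[OF assms(1)])

lemma Ck_on_bilinear:
  assumes "bounded_bilinear P" "open S" "Ck_on n f S" "Ck_on n g S"
  shows "Ck_on n (\<lambda>x. P (f x) (g x)) S"
  using assms(3,4)
proof (induction n arbitrary: f g)
  case 0
  then show ?case using bounded_bilinear.continuous_on[OF assms(1)] by auto
next
  case (Suc n)
  show ?case
  proof (rule Ck_on_SucI[OF assms(2)])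
    show "((\<lambda>x. P (f x) (g x)) has_derivative
       (\<lambda>v. P (f x) (frechet_derivative g (at x) v) + P (frechet_derivative f (at x) v) (g x))) (at x)"
      if "x \<in> S" for x
      by (intro bounded_bilinear.FDERIV[OF assms(1)] Ck_on_Suc_has_derivative[OF Suc.prems(1) that]
          Ck_on_Suc_has_derivative[OF Suc.prems(2) that])
    show "Ck_on n (\<lambda>x. P (f x) (frechet_derivative g (at x) v) + P (frechet_derivative f (at x) v) (g x)) S" for v
    proof (intro Ck_on_add[OF assms(2)] Suc.IH)
      show "Ck_on n f S" "Ck_on n g S" using Suc.prems Ck_on_Suc_D by blast+
    qed (use Suc.prems in auto)
  qed
qed

lemma Ck_on_Pair:
  assumes "open S" "Ck_on n f S" "Ck_on n g S"
  shows "Ck_on n (\<lambda>x. (f x, g x)) S"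
proof -
  have "bounded_linear (\<lambda>x. (x, 0))" "bounded_linear (\<lambda>y. (0, y))"
    by (auto intro: bounded_linear_Pair bounded_linear_ident bounded_linear_zero)
  from Ck_on_add[OF assms(1) Ck_on_linear_compose[OF this(1) assms(1,2)] Ck_on_linear_compose[OF this(2) assms(1,3)]]
  show ?thesis by simp
qed

text \<open>Finite dimension of the middle space enters because \<open>Ck_on\<close> only records the directional
  derivatives: the chain rule is expanded in coordinates of the inner derivative.\<close>

lemma Ck_on_compose:
  fixes f :: "'a::real_normed_vector \<Rightarrow> 'b::real_normed_vector" and g :: "'b \<Rightarrow> 'c::real_normed_vector"
  assumes "finite_dim TYPE('b)" "open S" "Ck_on n f S" "Ck_on n g T" "f ` S \<subseteq> T"
  shows "Ck_on n (\<lambda>x. g (f x)) S"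
proof -
  obtain B :: "'b set" and c where c: "\<And>b. bounded_linear (c b)" "\<And>x. x = (\<Sum>b\<in>B. c b x *\<^sub>R b)"
    using finite_dim_coordinates[OF assms(1)] by metis
  show ?thesis
    using assms(3,4)
  proof (induction n arbitrary: g)
    case 0
    then show ?case using continuous_on_compose2 assms(5) by auto
  next
    case (Suc n)
    show ?case
    proof (rule Ck_on_SucI[OF assms(2)])
      show "((\<lambda>x. g (f x)) has_derivative
        (\<lambda>v. \<Sum>b\<in>B. c b (frechet_derivative f (at x) v) *\<^sub>R frechet_derivative g (at (f x)) b)) (at x)"
        if x: "x \<in> S" for x
      proof -
        have hf: "(f has_derivative frechet_derivative f (at x)) (at x)"
          by (rule Ck_on_Suc_has_derivative[OF Suc.prems(1) x])
        have hg: "(g has_derivative frechet_derivative g (at (f x))) (at (f x))"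
          by (rule Ck_on_Suc_has_derivative[OF Suc.prems(2)]) (use assms(5) x in auto)
        have lin: "linear (frechet_derivative g (at (f x)))"
          using has_derivative_linear[OF hg] .
        have "frechet_derivative g (at (f x)) y = (\<Sum>b\<in>B. c b y *\<^sub>R frechet_derivative g (at (f x)) b)" for y
        proof -
          have "frechet_derivative g (at (f x)) y = frechet_derivative g (at (f x)) (\<Sum>b\<in>B. c b y *\<^sub>R b)"
            by (rule arg_cong[OF c(2)])
          also have "\<dots> = (\<Sum>b\<in>B. c b y *\<^sub>R frechet_derivative g (at (f x)) b)"
            by (simp add: linear_sum[OF lin] linear_scale[OF lin])
          finally show ?thesis .
        qed
        moreover have "((\<lambda>x. g (f x)) has_derivative
            (\<lambda>v. frechet_derivative g (at (f x)) (frechet_derivative f (at x) v))) (at x)"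
          using diff_chain_at[OF hf hg] by (simp add: o_def)
        ultimately show ?thesis by (elim has_derivative_eq_rhs) (rule ext)
      qed
      show "Ck_on n (\<lambda>x. \<Sum>b\<in>B. c b (frechet_derivative f (at x) v) *\<^sub>R frechet_derivative g (at (f x)) b) S" for v
      proof (intro Ck_on_sum[OF assms(2)] Ck_on_bilinear[OF bounded_bilinear_scaleR assms(2)])
        show "Ck_on n (\<lambda>x. c b (frechet_derivative f (at x) v)) S" for b
          using Suc.prems by (intro Ck_on_linear_compose[OF c(1) assms(2)]) auto
        \<comment> \<open>The induction keeps \<open>f\<close> and replaces \<open>g\<close> by one
          of its directional derivatives, one order lower.\<close>
        show "Ck_on n (\<lambda>x. frechet_derivative g (at (f x)) b) S" for b
          using Suc.IH[OF Ck_on_Suc_D[OF Suc.prems(1)], of "\<lambda>y. frechet_derivative g (at y) b"] Suc.prems(2) by simp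
      qed
    qed
  qed
qed

section \<open>Germs of smooth maps\<close>

lemma smooth_on_subset: "smooth_on f S \<Longrightarrow> T \<subseteq> S \<Longrightarrow> smooth_on f T"
  unfolding smooth_on_def using Ck_on_subset by blast

text \<open>Smoothness of the germ: domains may shrink at each composition without being
  named.\<close>

definition smooth_at :: "('a::real_normed_vector \<Rightarrow> 'b::real_normed_vector) \<Rightarrow> 'a \<Rightarrow> bool" where
  "smooth_at f x \<longleftrightarrow> (\<exists>A. open A \<and> x \<in> A \<and> smooth_on f A)"

lemma smooth_atI: "open A \<Longrightarrow> x \<in> A \<Longrightarrow> smooth_on f A \<Longrightarrow> smooth_at f x"
  unfolding smooth_at_def by blast

lemma smooth_at_cong:
  assumes "\<forall>\<^sub>F y in nhds x. f y = g y" "smooth_at f x"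
  shows "smooth_at g x"
proof -
  obtain A where A: "open A" "x \<in> A" "smooth_on f A" using assms(2) unfolding smooth_at_def by blast
  obtain B where B: "open B" "x \<in> B" "\<And>y. y \<in> B \<Longrightarrow> f y = g y"
    using assms(1) unfolding eventually_nhds by blast
  have "smooth_on g (A \<inter> B)"
    unfolding smooth_on_def
  proof
    fix n
    have "Ck_on n f (A \<inter> B)" using A(3) Ck_on_subset unfolding smooth_on_def by blast
    then show "Ck_on n g (A \<inter> B)"
      by (rule Ck_on_cong[rotated 2]) (use A B in auto)
  qed
  then show ?thesis using A B by (intro smooth_atI[of "A \<inter> B"]) auto
qed

lemma smooth_at_eventually: "smooth_at f x \<Longrightarrow> \<forall>\<^sub>F y in nhds x. smooth_at f y"
  unfolding smooth_at_def eventually_nhds by blast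

lemma smooth_on_differentiable: "smooth_on f A \<Longrightarrow> x \<in> A \<Longrightarrow> f differentiable (at x)"
  unfolding smooth_on_def using Ck_on.simps(2) by blast

lemma smooth_at_differentiable: "smooth_at f x \<Longrightarrow> f differentiable (at x)"
  unfolding smooth_at_def using smooth_on_differentiable by blast

lemma smooth_at_has_derivative: "smooth_at f x \<Longrightarrow> (f has_derivative frechet_derivative f (at x)) (at x)"
  using smooth_at_differentiable frechet_derivative_works by blast

lemma smooth_at_has_vector_derivative:
  "smooth_at f x \<Longrightarrow> (f has_vector_derivative vector_derivative f (at x)) (at x)"
  using smooth_at_differentiable vector_derivative_works by blast

lemma smooth_at_isCont: "smooth_at f x \<Longrightarrow> isCont f x"
  using smooth_at_differentiable differentiable_imp_continuous_within by blast

lemma smooth_at_eventually_open: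
  assumes "smooth_at f x" "open S" "f x \<in> S" shows "\<forall>\<^sub>F y in nhds x. f y \<in> S"
proof -
  have "filterlim f (nhds (f x)) (nhds x)"
    using smooth_at_isCont[OF assms(1)] by (simp add: isCont_def tendsto_at_iff_tendsto_nhds)
  then show ?thesis using topological_tendstoD assms(2,3) by blast
qed

lemma smooth_at_const: "smooth_at (\<lambda>x. c) x"
  by (rule smooth_atI[of UNIV]) (auto simp: smooth_on_def Ck_on_const)

lemma smooth_at_linear: "bounded_linear L \<Longrightarrow> smooth_at L x"
  by (rule smooth_atI[of UNIV]) (auto simp: smooth_on_def Ck_on_linear)

lemma smooth_at_ident: "smooth_at (\<lambda>x. x) x"
  by (rule smooth_at_linear) (rule bounded_linear_ident)

lemma smooth_at_compose:
  fixes f :: "'a::real_normed_vector \<Rightarrow> 'b::real_normed_vector" and g :: "'b \<Rightarrow> 'c::real_normed_vector"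
  assumes fin: "finite_dim TYPE('b)" and g: "smooth_at g (f x)" and f: "smooth_at f x"
  shows "smooth_at (\<lambda>y. g (f y)) x"
proof -
  obtain A where A: "open A" "x \<in> A" "smooth_on f A" using f unfolding smooth_at_def by blast
  obtain B where B: "open B" "f x \<in> B" "smooth_on g B" using g unfolding smooth_at_def by blast
  obtain C where C: "open C" "x \<in> C" "\<And>y. y \<in> C \<Longrightarrow> f y \<in> B"
    using smooth_at_eventually_open[OF f B(1,2)] unfolding eventually_nhds by blast
  have "smooth_on (\<lambda>y. g (f y)) (A \<inter> C)"
    unfolding smooth_on_def
  proof
    fix n
    have "Ck_on n f (A \<inter> C)" using A(3) Ck_on_subset unfolding smooth_on_def by blast
    then show "Ck_on n (\<lambda>y. g (f y)) (A \<inter> C)"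
      by (rule Ck_on_compose[OF fin, rotated]) (use A B C in \<open>auto simp: smooth_on_def\<close>)
  qed
  then show ?thesis using A C by (intro smooth_atI[of "A \<inter> C"]) auto
qed

lemma smooth_at_linear_compose:
  assumes L: "bounded_linear L" and f: "smooth_at f x"
  shows "smooth_at (\<lambda>y. L (f y)) x"
proof -
  obtain A where A: "open A" "x \<in> A" "smooth_on f A" using f unfolding smooth_at_def by blast
  then have "smooth_on (\<lambda>y. L (f y)) A"
    unfolding smooth_on_def using Ck_on_linear_compose[OF L] by blast
  then show ?thesis using A by (intro smooth_atI[of A]) auto
qed

text \<open>The passage to a common domain is made once for all operations with two
  arguments.\<close>

lemma smooth_at_binary:
  assumes "\<And>n S. open S \<Longrightarrow> Ck_on n f S \<Longrightarrow> Ck_on n g S \<Longrightarrow> Ck_on n h S"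
    and "smooth_at f x" "smooth_at g x"
  shows "smooth_at h x"
proof -
  obtain A where A: "open A" "x \<in> A" "smooth_on f A" using assms(2) unfolding smooth_at_def by blast
  obtain B where B: "open B" "x \<in> B" "smooth_on g B" using assms(3) unfolding smooth_at_def by blast
  have "smooth_on h (A \<inter> B)"
    unfolding smooth_on_def
  proof
    fix n
    have "Ck_on n f (A \<inter> B)" "Ck_on n g (A \<inter> B)"
      using A(3) B(3) Ck_on_subset unfolding smooth_on_def by blast+
    then show "Ck_on n h (A \<inter> B)" using assms(1)[of "A \<inter> B" n] A B by auto
  qed
  then show ?thesis using A B by (intro smooth_atI[of "A \<inter> B"]) auto
qed

lemma smooth_at_Pair: "smooth_at f x \<Longrightarrow> smooth_at g x \<Longrightarrow> smooth_at (\<lambda>y. (f y, g y)) x"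
  by (rule smooth_at_binary[of f g]) (auto intro: Ck_on_Pair)

lemma smooth_at_add: "smooth_at f x \<Longrightarrow> smooth_at g x \<Longrightarrow> smooth_at (\<lambda>y. f y + g y) x"
  by (rule smooth_at_binary[of f g]) (auto intro: Ck_on_add)

lemma smooth_at_scaleR: "smooth_at f x \<Longrightarrow> smooth_at g x \<Longrightarrow> smooth_at (\<lambda>y. f y *\<^sub>R g y) x"
  by (rule smooth_at_binary[of f g]) (auto intro: Ck_on_bilinear[OF bounded_bilinear_scaleR])

lemma smooth_at_sum:
  "(\<And>i. i \<in> I \<Longrightarrow> smooth_at (f i) x) \<Longrightarrow> smooth_at (\<lambda>y. \<Sum>i\<in>I. f i y) x"
  by (induction I rule: infinite_finite_induct) (auto intro: smooth_at_const smooth_at_add)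

lemma smooth_at_fst: "smooth_at f x \<Longrightarrow> smooth_at (\<lambda>y. fst (f y)) x"
  by (rule smooth_at_linear_compose[OF bounded_linear_fst])

lemma smooth_at_snd: "smooth_at f x \<Longrightarrow> smooth_at (\<lambda>y. snd (f y)) x"
  by (rule smooth_at_linear_compose[OF bounded_linear_snd])

lemmas smooth_at_intros = smooth_at_const smooth_at_ident smooth_at_Pair smooth_at_add smooth_at_scaleR
  smooth_at_sum smooth_at_fst smooth_at_snd

section \<open>Derivatives that depend on parameters\<close>

lemma smooth_at_frechet_derivative:
  assumes "smooth_at f x" shows "smooth_at (\<lambda>y. frechet_derivative f (at y) v) x"
proof -
  obtain A where A: "open A" "x \<in> A" "smooth_on f A" using assms unfolding smooth_at_def by blast
  have "smooth_on (\<lambda>y. frechet_derivative f (at y) v) A"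
    unfolding smooth_on_def using A(3) Ck_on.simps(2) unfolding smooth_on_def by blast
  then show ?thesis using A smooth_atI by blast
qed

lemma smooth_at_section_has_derivative:
  assumes "smooth_at W z"
  shows "((\<lambda>y. W (fst z, y)) has_derivative (\<lambda>v. frechet_derivative W (at z) (0, v))) (at (snd z))"
proof -
  have "((\<lambda>y. (fst z, y)) has_derivative (\<lambda>v. (0, v))) (at (snd z))"
    by (intro has_derivative_Pair has_derivative_const has_derivative_ident)
  from diff_chain_at[OF this, of W] smooth_at_has_derivative[OF assms] show ?thesis
    by (simp add: o_def)
qed

text \<open>\<open>lvel\<close> and \<open>Tmap\<close> differentiate in one variable with the
  others held fixed. Near the point such a derivative is the full derivative in direction
  \<open>(0, v)\<close>, whence its joint smoothness in parameter and base point.\<close>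

lemma smooth_at_partial_derivative:
  assumes "smooth_at W (p, y)"
  shows "smooth_at (\<lambda>z. frechet_derivative (\<lambda>y. W (fst z, y)) (at (snd z)) v) (p, y)"
proof (rule smooth_at_cong[OF _ smooth_at_frechet_derivative[OF assms, of "(0, v)"]])
  show "\<forall>\<^sub>F z in nhds (p, y). frechet_derivative W (at z) (0, v) =
      frechet_derivative (\<lambda>y. W (fst z, y)) (at (snd z)) v"
    using smooth_at_eventually[OF assms]
  proof eventually_elim
    case (elim z)
    show ?case using frechet_derivative_at[OF smooth_at_section_has_derivative[OF elim]] by metis
  qed
qed

lemma smooth_at_partial_vector_derivative:
  assumes "smooth_at W (p, t)"
  shows "smooth_at (\<lambda>z. vector_derivative (\<lambda>s. W (fst z, s)) (at (snd z))) (p, t)"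
proof (rule smooth_at_cong[OF _ smooth_at_partial_derivative[OF assms, of 1]])
  show "\<forall>\<^sub>F z in nhds (p, t). frechet_derivative (\<lambda>s. W (fst z, s)) (at (snd z)) 1 =
      vector_derivative (\<lambda>s. W (fst z, s)) (at (snd z))"
    using smooth_at_eventually[OF assms]
  proof eventually_elim
    case (elim z)
    show ?case
      using frechet_derivative_eq_vector_derivative[OF differentiableI[OF smooth_at_section_has_derivative[OF elim]]]
      by simp
  qed
qed

text \<open>This is the product rule used on the group: the two occurrences of the parameter are
  separated and differentiated one at a time.\<close>

lemma vector_derivative_diagonal:
  fixes Z :: "real \<times> real \<Rightarrow> 'c::real_normed_vector"
  assumes "smooth_at Z (t, t)"
  shows "((\<lambda>e. Z (e, e)) has_vector_derivative
    vector_derivative (\<lambda>e. Z (e, t)) (at t) + vector_derivative (\<lambda>e. Z (t, e)) (at t)) (at t)"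
proof -
  let ?D = "frechet_derivative Z (at (t, t))"
  note D = smooth_at_has_derivative[OF assms]
  have lin: "linear ?D" by (rule has_derivative_linear[OF D])
  have "((\<lambda>e. Z (a e, b e)) has_vector_derivative ?D (a', b')) (at t)"
    if "(a has_vector_derivative a') (at t)" "(b has_vector_derivative b') (at t)" "a t = t" "b t = t" for a b a' b'
  proof -
    have "((\<lambda>e. (a e, b e)) has_derivative (\<lambda>r. r *\<^sub>R (a', b'))) (at t)"
      using has_vector_derivative_Pair[OF that(1,2)] by (simp add: has_vector_derivative_def)
    from diff_chain_at[OF this, of Z ?D] D that(3,4) show ?thesis
      using linear_scale[OF lin, of _ "(a', b')"] by (simp add: o_def has_vector_derivative_def)
  qed
  from this[of "\<lambda>e. e" 1 "\<lambda>e. e" 1] this[of "\<lambda>e. e" 1 "\<lambda>e. t" 0] this[of "\<lambda>e. t" 0 "\<lambda>e. e" 1]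
  have "((\<lambda>e. Z (e, e)) has_vector_derivative ?D (1, 1)) (at t)"
    and "vector_derivative (\<lambda>e. Z (e, t)) (at t) = ?D (1, 0)"
    and "vector_derivative (\<lambda>e. Z (t, e)) (at t) = ?D (0, 1)"
    by (auto intro: vector_derivative_at)
  moreover have "?D (1, 1) = ?D (1, 0) + ?D (0, 1)"
    using linear_add[OF lin, of "(1, 0)" "(0, 1)"] by simp
  ultimately show ?thesis by simp
qed

section \<open>Plots into manifolds\<close>

text \<open>\<open>manifold\<close> without the Hausdorff property, countability and compatibility
  of charts. The rest passes easily to products and open subsets, and it suffices for transporting
  plots along smooth maps.\<close>

definition charted :: "('p, 'v::real_normed_vector) mfd \<Rightarrow> bool" where
  "charted M \<longleftrightarrow> finite_dim TYPE('v) \<and>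
     (\<forall>p\<in>topspace (mtop M). \<exists>(U, \<phi>)\<in>atlas M. p \<in> U) \<and>
     (\<forall>(U, \<phi>)\<in>atlas M. openin (mtop M) U \<and> inj_on \<phi> U \<and>
        (\<forall>W. openin (mtop M) W \<longrightarrow> open (\<phi> ` (U \<inter> W))))"

lemma chartedD:
  assumes "charted M" "(U, \<phi>) \<in> atlas M"
  shows "openin (mtop M) U" "inj_on \<phi> U" "openin (mtop M) W \<Longrightarrow> open (\<phi> ` (U \<inter> W))" "open (\<phi> ` U)"
proof -
  show *: "openin (mtop M) U" "inj_on \<phi> U" "openin (mtop M) W \<Longrightarrow> open (\<phi> ` (U \<inter> W))" for W
    using assms unfolding charted_def by fast+
  show "open (\<phi> ` U)" using *(3)[OF *(1)] by simp
qed

lemma charted_cover: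
  assumes "charted M" "p \<in> topspace (mtop M)"
  obtains U \<phi> where "(U, \<phi>) \<in> atlas M" "p \<in> U"
  using assms unfolding charted_def by fast

lemma charted_finite_dim: "charted (M :: ('p, 'v::real_normed_vector) mfd) \<Longrightarrow> finite_dim TYPE('v)"
  unfolding charted_def by blast

lemma manifold_charted:
  assumes "manifold M" shows "charted M"
  unfolding charted_def
proof (intro conjI ballI)
  show "finite_dim TYPE('b)" using assms unfolding manifold_def finite_dim_def by blast
  show "\<exists>(U, \<phi>)\<in>atlas M. p \<in> U" if "p \<in> topspace (mtop M)" for p
  proof -
    have "p \<in> (\<Union>(U, \<phi>)\<in>atlas M. U)" using assms that unfolding manifold_def by simp
    then show ?thesis by blast
  qed
  fix c assume c: "c \<in> atlas M"
  show "case c of (U, \<phi>) \<Rightarrow> openin (mtop M) U \<and> inj_on \<phi> U \<and> (\<forall>W. openin (mtop M) W \<longrightarrow> open (\<phi> ` (U \<inter> W)))"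
  proof (cases c)
    case (Pair U \<phi>)
    have *: "openin (mtop M) U" "open (\<phi> ` U)" "homeomorphic_map (subtopology (mtop M) U) (top_of_set (\<phi> ` U)) \<phi>"
      using assms c Pair unfolding manifold_def by fast+
    have "inj_on \<phi> U"
      using homeomorphic_imp_injective_map[OF *(3)] openin_subset[OF *(1)] by (simp add: Int_absorb1)
    moreover have "open (\<phi> ` (U \<inter> W))" if "openin (mtop M) W" for W
    proof -
      have "openin (subtopology (mtop M) U) (U \<inter> W)"
        using that by (simp add: openin_subtopology_Int2)
      then have "openin (top_of_set (\<phi> ` U)) (\<phi> ` (U \<inter> W))"
        using homeomorphic_imp_open_map[OF *(3)] unfolding open_map_def by blast
      then show ?thesis using *(2) openin_open_eq by blast
    qed
    ultimately show ?thesis using * Pair by simp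
  qed
qed

lemma charted_vec:
  "finite_dim TYPE('v::real_normed_vector) \<Longrightarrow> charted (vec_mfd :: ('v, 'v) mfd)"
  unfolding charted_def vec_mfd_def by simp

lemma charted_open_mfd:
  assumes "charted M" "openin (mtop M) W" shows "charted (open_mfd M W)"
  unfolding charted_def
proof (intro conjI ballI)
  show "finite_dim TYPE('b)" using assms(1) by (rule charted_finite_dim)
  show "\<exists>(U, \<phi>)\<in>atlas (open_mfd M W). p \<in> U" if "p \<in> topspace (mtop (open_mfd M W))" for p
  proof -
    have "p \<in> topspace (mtop M)" "p \<in> W" using that by (auto simp: open_mfd_def)
    obtain U \<phi> where U: "(U, \<phi>) \<in> atlas M" "p \<in> U"
      by (rule charted_cover[OF assms(1) \<open>p \<in> topspace (mtop M)\<close>])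
    have "(U \<inter> W, \<phi>) \<in> atlas (open_mfd M W)"
      using imageI[OF U(1), of "\<lambda>(U, \<phi>). (U \<inter> W, \<phi>)"] by (simp add: open_mfd_def)
    with U(2) \<open>p \<in> W\<close> show ?thesis by blast
  qed
  fix c assume "c \<in> atlas (open_mfd M W)"
  then obtain U \<phi> where c: "c = (U \<inter> W, \<phi>)" and U: "(U, \<phi>) \<in> atlas M" by (auto simp: open_mfd_def)
  note D = chartedD[OF assms(1) U]
  have "open (\<phi> ` (U \<inter> W \<inter> X))" if "openin (subtopology (mtop M) W) X" for X
    using D(3)[of "W \<inter> X"] openin_trans_full[OF that assms(2)] assms(2)
    by (simp add: openin_Int Int_assoc)
  moreover have "openin (subtopology (mtop M) W) (U \<inter> W)"
    using D(1) openin_subtopology_Int by blast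
  moreover have "mtop (open_mfd M W) = subtopology (mtop M) W" by (simp add: open_mfd_def)
  ultimately have "openin (mtop (open_mfd M W)) (U \<inter> W) \<and> inj_on \<phi> (U \<inter> W) \<and>
      (\<forall>X. openin (mtop (open_mfd M W)) X \<longrightarrow> open (\<phi> ` (U \<inter> W \<inter> X)))"
    using inj_on_subset[OF D(2), of "U \<inter> W"] by auto
  then show "case c of (U, \<phi>) \<Rightarrow> openin (mtop (open_mfd M W)) U \<and> inj_on \<phi> U \<and>
      (\<forall>X. openin (mtop (open_mfd M W)) X \<longrightarrow> open (\<phi> ` (U \<inter> X)))"
    unfolding c by simp
qed

lemma charted_prod:
  fixes M :: "('p, 'v::real_normed_vector) mfd" and N :: "('q, 'w::real_normed_vector) mfd"
  assumes "charted M" "charted N" shows "charted (prod_mfd M N)"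
  unfolding charted_def
proof (intro conjI ballI)
  show "finite_dim TYPE('v \<times> 'w)"
    by (rule finite_dim_prod[OF charted_finite_dim[OF assms(1)] charted_finite_dim[OF assms(2)]])
  show "\<exists>(U, \<phi>)\<in>atlas (prod_mfd M N). p \<in> U" if p: "p \<in> topspace (mtop (prod_mfd M N))" for p
  proof -
    have "fst p \<in> topspace (mtop M)" "snd p \<in> topspace (mtop N)" using p by (auto simp: prod_mfd_def)
    obtain U \<phi> where "(U, \<phi>) \<in> atlas M" "fst p \<in> U"
      by (rule charted_cover[OF assms(1) \<open>fst p \<in> topspace (mtop M)\<close>])
    moreover obtain V \<psi> where "(V, \<psi>) \<in> atlas N" "snd p \<in> V"
      by (rule charted_cover[OF assms(2) \<open>snd p \<in> topspace (mtop N)\<close>])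
    ultimately have "(U \<times> V, map_prod \<phi> \<psi>) \<in> atlas (prod_mfd M N)" "p \<in> U \<times> V"
      unfolding prod_mfd_def mfd.simps mem_Collect_eq mem_Times_iff by blast+
    then show ?thesis by (intro bexI[of _ "(U \<times> V, map_prod \<phi> \<psi>)"]) simp_all
  qed
  fix c assume "c \<in> atlas (prod_mfd M N)"
  then obtain U \<phi> V \<psi> where c: "c = (U \<times> V, map_prod \<phi> \<psi>)" and U: "(U, \<phi>) \<in> atlas M" and V: "(V, \<psi>) \<in> atlas N"
    by (auto simp: prod_mfd_def)
  note D = chartedD[OF assms(1) U] and E = chartedD[OF assms(2) V]
  have "open (map_prod \<phi> \<psi> ` (U \<times> V \<inter> W))" if W: "openin (prod_topology (mtop M) (mtop N)) W" for W
  proof (subst open_subopen, intro ballI)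
    fix y assume "y \<in> map_prod \<phi> \<psi> ` (U \<times> V \<inter> W)"
    then obtain a b where ab: "y = (\<phi> a, \<psi> b)" "a \<in> U" "b \<in> V" "(a, b) \<in> W" by auto
    have "\<exists>A B. openin (mtop M) A \<and> openin (mtop N) B \<and> a \<in> A \<and> b \<in> B \<and> A \<times> B \<subseteq> W"
      using W[unfolded openin_prod_topology_alt, rule_format, OF ab(4)] by simp
    then obtain A B where AB: "openin (mtop M) A" "openin (mtop N) B" "a \<in> A" "b \<in> B" "A \<times> B \<subseteq> W"
      by (elim exE conjE)
    have "open (\<phi> ` (U \<inter> A) \<times> \<psi> ` (V \<inter> B))"
      using D(3)[OF AB(1)] E(3)[OF AB(2)] by (rule open_Times)
    moreover have "y \<in> \<phi> ` (U \<inter> A) \<times> \<psi> ` (V \<inter> B)" using ab AB by auto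
    moreover have "\<phi> ` (U \<inter> A) \<times> \<psi> ` (V \<inter> B) \<subseteq> map_prod \<phi> \<psi> ` (U \<times> V \<inter> W)"
    proof
      fix z assume "z \<in> \<phi> ` (U \<inter> A) \<times> \<psi> ` (V \<inter> B)"
      then obtain a b where "a \<in> U \<inter> A" "b \<in> V \<inter> B" "z = map_prod \<phi> \<psi> (a, b)" by auto
      then show "z \<in> map_prod \<phi> \<psi> ` (U \<times> V \<inter> W)" using AB(5) by (intro image_eqI[of _ _ "(a, b)"]) auto
    qed
    ultimately show "\<exists>T. open T \<and> y \<in> T \<and> T \<subseteq> map_prod \<phi> \<psi> ` (U \<times> V \<inter> W)" by blast
  qed
  moreover have "inj_on (map_prod \<phi> \<psi>) (U \<times> V)" using D(2) E(2) by (rule map_prod_inj_on)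
  moreover have "openin (prod_topology (mtop M) (mtop N)) (U \<times> V)"
    using D(1) E(1) by (simp add: openin_prod_Times_iff)
  moreover have "mtop (prod_mfd M N) = prod_topology (mtop M) (mtop N)" by (simp add: prod_mfd_def)
  ultimately have "openin (mtop (prod_mfd M N)) (U \<times> V) \<and> inj_on (map_prod \<phi> \<psi>) (U \<times> V) \<and>
      (\<forall>X. openin (mtop (prod_mfd M N)) X \<longrightarrow> open (map_prod \<phi> \<psi> ` (U \<times> V \<inter> X)))"
    by auto
  then show "case c of (U, \<phi>) \<Rightarrow> openin (mtop (prod_mfd M N)) U \<and> inj_on \<phi> U \<and>
      (\<forall>X. openin (mtop (prod_mfd M N)) X \<longrightarrow> open (\<phi> ` (U \<inter> X)))"
    unfolding c by simp
qed

text \<open>All smoothness is transported through plots, so that the calculus takes place between normed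
  spaces and only one chart at a time is involved.\<close>

definition plot :: "('p, 'v::real_normed_vector) mfd \<Rightarrow> ('a::real_normed_vector \<Rightarrow> 'p) \<Rightarrow> 'a \<Rightarrow> bool" where
  "plot M f x \<longleftrightarrow> (\<exists>(U, \<phi>)\<in>atlas M. (\<forall>\<^sub>F y in nhds x. f y \<in> U) \<and> smooth_at (\<lambda>y. \<phi> (f y)) x)"

lemma plotI:
  "(U, \<phi>) \<in> atlas M \<Longrightarrow> \<forall>\<^sub>F y in nhds x. f y \<in> U \<Longrightarrow> smooth_at (\<lambda>y. \<phi> (f y)) x \<Longrightarrow> plot M f x"
  unfolding plot_def by blast

lemma plotE:
  assumes "plot M f x"
  obtains U \<phi> where "(U, \<phi>) \<in> atlas M" "\<forall>\<^sub>F y in nhds x. f y \<in> U" "smooth_at (\<lambda>y. \<phi> (f y)) x" "f x \<in> U"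
  using assms eventually_nhds_x_imp_x unfolding plot_def by fast

lemma plot_eventually: "plot M f x \<Longrightarrow> \<forall>\<^sub>F y in nhds x. plot M f y"
proof (erule plotE)
  fix U \<phi> assume *: "(U, \<phi>) \<in> atlas M" "\<forall>\<^sub>F y in nhds x. f y \<in> U" "smooth_at (\<lambda>y. \<phi> (f y)) x"
  have "\<forall>\<^sub>F y in nhds x. \<forall>\<^sub>F z in nhds y. f z \<in> U" using *(2) by (simp add: eventually_eventually)
  with smooth_at_eventually[OF *(3)] show ?thesis
    by eventually_elim (use plotI[OF *(1)] in blast)
qed

lemma plot_topspace: "charted M \<Longrightarrow> plot M f x \<Longrightarrow> f x \<in> topspace (mtop M)"
  by (erule plotE) (use chartedD(1) openin_subset in blast)

lemma plot_eventually_open: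
  assumes M: "charted M" and f: "plot M f x" and W: "openin (mtop M) W" "f x \<in> W"
  shows "\<forall>\<^sub>F y in nhds x. f y \<in> W"
proof -
  obtain U \<phi> where U: "(U, \<phi>) \<in> atlas M" "\<forall>\<^sub>F y in nhds x. f y \<in> U" "smooth_at (\<lambda>y. \<phi> (f y)) x" "f x \<in> U"
    using f by (rule plotE)
  have "\<forall>\<^sub>F y in nhds x. \<phi> (f y) \<in> \<phi> ` (U \<inter> W)"
    using W U by (intro smooth_at_eventually_open[OF U(3)] chartedD(3)[OF M U(1)]) auto
  then show ?thesis using U(2)
    by eventually_elim (use chartedD(2)[OF M U(1)] in \<open>auto dest: inj_onD\<close>)
qed

text \<open>Continuity of \<open>F\<close> provides a neighbourhood that is mapped into
  \<open>V\<close>. As \<open>F\<close> is smooth in every pair of charts, the one chart that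
  witnesses the plot is enough.\<close>

lemma plot_smooth_map_chart:
  assumes M: "charted M" and f: "plot M f x" and F: "smooth_map M N F"
    and V: "(V, \<psi>) \<in> atlas N" "openin (mtop N) V" "F (f x) \<in> V"
  shows "\<forall>\<^sub>F y in nhds x. F (f y) \<in> V" "smooth_at (\<lambda>y. \<psi> (F (f y))) x"
proof -
  let ?W = "{p \<in> topspace (mtop M). F p \<in> V}"
  have W: "openin (mtop M) ?W" "f x \<in> ?W"
    using F V plot_topspace[OF M f] unfolding smooth_map_def continuous_map_def by blast+
  then have ev: "\<forall>\<^sub>F y in nhds x. f y \<in> ?W" by (rule plot_eventually_open[OF M f])
  then show "\<forall>\<^sub>F y in nhds x. F (f y) \<in> V" by eventually_elim simp
  obtain U \<phi> where U: "(U, \<phi>) \<in> atlas M" "\<forall>\<^sub>F y in nhds x. f y \<in> U" "smooth_at (\<lambda>y. \<phi> (f y)) x" "f x \<in> U"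
    using f by (rule plotE)
  note D = chartedD[OF M U(1)]
  have "smooth_on (\<psi> \<circ> F \<circ> the_inv_into U \<phi>) (\<phi> ` (U \<inter> F -` V))"
    using F U(1) V(1) unfolding smooth_map_def by fast
  \<comment> \<open>The preimage of \<open>V\<close> under the total function \<open>F\<close> may
    contain points outside the manifold; within \<open>U\<close> it is the open set
    \<open>?W\<close>.\<close>
  moreover have "U \<inter> F -` V = U \<inter> ?W" using openin_subset[OF D(1)] by auto
  ultimately have "smooth_at (\<psi> \<circ> F \<circ> the_inv_into U \<phi>) (\<phi> (f x))"
    using D(3)[OF W(1)] W(2) U(4) by (intro smooth_atI[of "\<phi> ` (U \<inter> ?W)"]) auto
  from smooth_at_compose[OF charted_finite_dim[OF M] this U(3)]
  show "smooth_at (\<lambda>y. \<psi> (F (f y))) x"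
  proof (rule smooth_at_cong[rotated])
    show "\<forall>\<^sub>F y in nhds x. (\<psi> \<circ> F \<circ> the_inv_into U \<phi>) (\<phi> (f y)) = \<psi> (F (f y))"
      using U(2) by eventually_elim (simp add: the_inv_into_f_f[OF D(2)])
  qed
qed

lemma plot_smooth_map:
  assumes "charted M" "charted N" "plot M f x" "smooth_map M N F"
  shows "plot N (\<lambda>y. F (f y)) x"
proof -
  have "F (f x) \<in> topspace (mtop N)"
    using assms(4) plot_topspace[OF assms(1,3)] unfolding smooth_map_def continuous_map_def by blast
  then obtain V \<psi> where V: "(V, \<psi>) \<in> atlas N" "F (f x) \<in> V" by (rule charted_cover[OF assms(2)])
  note * = plot_smooth_map_chart[OF assms(1,3,4) V(1) chartedD(1)[OF assms(2) V(1)] V(2)]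
  show ?thesis by (rule plotI[OF V(1) *])
qed

lemma analytic_map_smooth: "analytic_map M N f \<Longrightarrow> smooth_map M N f"
  unfolding analytic_map_def smooth_map_def real_analytic_on_def by fast

text \<open>Compatibility of charts says that the identity is smooth, so a change of chart becomes
  transport along a smooth map.\<close>

lemma manifold_smooth_map_ident:
  assumes "manifold M" shows "smooth_map M M (\<lambda>x. x)"
  unfolding smooth_map_def
proof (intro conjI ballI)
  show "continuous_map (mtop M) (mtop M) (\<lambda>x. x)" by simp
  have "\<forall>(U, \<phi>)\<in>atlas M. \<forall>(V, \<psi>)\<in>atlas M. real_analytic_on (\<psi> \<circ> the_inv_into U \<phi>) (\<phi> ` (U \<inter> V))"
    using assms unfolding manifold_def by (elim conjE)
  then have "smooth_on (\<psi> \<circ> (\<lambda>x. x) \<circ> the_inv_into U \<phi>) (\<phi> ` (U \<inter> (\<lambda>x. x) -` V))"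
    if "(U, \<phi>) \<in> atlas M" "(V, \<psi>) \<in> atlas M" for U \<phi> V \<psi>
    using that unfolding real_analytic_on_def by (simp add: o_def split_def Ball_def)
  then show "case c of (U, \<phi>) \<Rightarrow> \<forall>(V, \<psi>)\<in>atlas M. smooth_on (\<psi> \<circ> (\<lambda>x. x) \<circ> the_inv_into U \<phi>) (\<phi> ` (U \<inter> (\<lambda>x. x) -` V))"
    if "c \<in> atlas M" for c
    using that by auto
qed

lemma plot_chart:
  assumes "manifold M" "plot M f x" "(V, \<psi>) \<in> atlas M" "f x \<in> V"
  shows "\<forall>\<^sub>F y in nhds x. f y \<in> V" "smooth_at (\<lambda>y. \<psi> (f y)) x"
  using plot_smooth_map_chart[OF manifold_charted[OF assms(1)] assms(2) manifold_smooth_map_ident[OF assms(1)] assms(3)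
     chartedD(1)[OF manifold_charted[OF assms(1)] assms(3)]] assms(4) by auto

lemma plot_vec: "plot vec_mfd f x \<longleftrightarrow> smooth_at f x"
  unfolding plot_def vec_mfd_def by simp

lemma plot_compose:
  fixes g :: "'a::real_normed_vector \<Rightarrow> 'b::real_normed_vector"
  assumes "finite_dim TYPE('b)" "plot M f (g x)" "smooth_at g x"
  shows "plot M (\<lambda>y. f (g y)) x"
proof -
  obtain U \<phi> where U: "(U, \<phi>) \<in> atlas M" "\<forall>\<^sub>F y in nhds (g x). f y \<in> U" "smooth_at (\<lambda>y. \<phi> (f y)) (g x)"
    using assms(2) by (rule plotE)
  obtain B where B: "open B" "g x \<in> B" "\<And>y. y \<in> B \<Longrightarrow> f y \<in> U" using U(2) unfolding eventually_nhds by blast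
  show ?thesis
  proof (rule plotI[OF U(1)])
    show "\<forall>\<^sub>F y in nhds x. f (g y) \<in> U"
      using smooth_at_eventually_open[OF assms(3) B(1,2)] by eventually_elim (rule B(3))
  qed (rule smooth_at_compose[OF assms(1) U(3) assms(3)])
qed

lemma plot_Pair:
  assumes "plot M f x" "plot N g x" shows "plot (prod_mfd M N) (\<lambda>y. (f y, g y)) x"
proof -
  obtain U \<phi> where U: "(U, \<phi>) \<in> atlas M" "\<forall>\<^sub>F y in nhds x. f y \<in> U" "smooth_at (\<lambda>y. \<phi> (f y)) x"
    using assms(1) by (rule plotE)
  obtain V \<psi> where V: "(V, \<psi>) \<in> atlas N" "\<forall>\<^sub>F y in nhds x. g y \<in> V" "smooth_at (\<lambda>y. \<psi> (g y)) x"
    using assms(2) by (rule plotE)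
  show ?thesis
  proof (rule plotI[of "U \<times> V" "map_prod \<phi> \<psi>"])
    show "(U \<times> V, map_prod \<phi> \<psi>) \<in> atlas (prod_mfd M N)"
      using U(1) V(1) unfolding prod_mfd_def mfd.simps mem_Collect_eq by blast
    show "\<forall>\<^sub>F y in nhds x. (f y, g y) \<in> U \<times> V" using U(2) V(2) by eventually_elim simp
    show "smooth_at (\<lambda>y. map_prod \<phi> \<psi> (f y, g y)) x" using smooth_at_Pair[OF U(3) V(3)] by simp
  qed
qed

lemma plot_const:
  assumes "charted M" "p \<in> topspace (mtop M)" shows "plot M (\<lambda>y. p) x"
proof -
  obtain U \<phi> where "(U, \<phi>) \<in> atlas M" "p \<in> U" by (rule charted_cover[OF assms])
  then show ?thesis by (intro plotI[of U \<phi>]) (simp_all add: smooth_at_const)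
qed

lemma plot_open_mfd:
  assumes "charted M" "openin (mtop M) W" "plot M f x" "f x \<in> W"
  shows "plot (open_mfd M W) f x"
proof -
  obtain U \<phi> where U: "(U, \<phi>) \<in> atlas M" "\<forall>\<^sub>F y in nhds x. f y \<in> U" "smooth_at (\<lambda>y. \<phi> (f y)) x"
    using assms(3) by (rule plotE)
  show ?thesis
  proof (rule plotI[of "U \<inter> W" \<phi>])
    show "(U \<inter> W, \<phi>) \<in> atlas (open_mfd M W)"
      using imageI[OF U(1), of "\<lambda>(U, \<phi>). (U \<inter> W, \<phi>)"] by (simp add: open_mfd_def)
    show "\<forall>\<^sub>F y in nhds x. f y \<in> U \<inter> W"
      using U(2) plot_eventually_open[OF assms(1,3,2,4)] by eventually_elim simp
  qed (rule U(3))
qed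

lemma plot_open_mfdD: "plot (open_mfd M W) f x \<Longrightarrow> plot M f x"
proof (erule plotE)
  fix U \<phi> assume *: "(U, \<phi>) \<in> atlas (open_mfd M W)" "\<forall>\<^sub>F y in nhds x. f y \<in> U" "smooth_at (\<lambda>y. \<phi> (f y)) x"
  then obtain V where V: "U = V \<inter> W" "(V, \<phi>) \<in> atlas M" by (auto simp: open_mfd_def)
  from *(2) have "\<forall>\<^sub>F y in nhds x. f y \<in> V" by eventually_elim (simp add: V(1))
  then show "plot M f x" by (rule plotI[OF V(2) _ *(3)])
qed

lemma smooth_curve_plot:
  assumes "charted M" "smooth_curve M c" shows "plot M c 0"
proof -
  obtain d where d: "d > 0" "smooth_map (open_mfd vec_mfd {-d<..<d}) M c"
    using assms(2) unfolding smooth_curve_def by blast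
  have 1: "charted (vec_mfd :: (real, real) mfd)" by (rule charted_vec[OF finite_dim_euclidean])
  have 2: "openin (mtop (vec_mfd :: (real, real) mfd)) {-d<..<d}" by (simp add: vec_mfd_def)
  have "plot (open_mfd vec_mfd {-d<..<d}) (\<lambda>t. t) 0"
    by (rule plot_open_mfd[OF 1 2]) (use d in \<open>auto simp: plot_vec smooth_at_ident\<close>)
  from plot_smooth_map[OF charted_open_mfd[OF 1 2] assms(1) this d(2)] show ?thesis .
qed

text \<open>\<open>smooth_curve\<close> asks for an interval and all charts, a plot for a germ in
  one chart. The germ spreads to an interval, on which \<open>plot_chart\<close> changes the chart
  at each instant.\<close>

lemma plot_smooth_curve:
  assumes M: "manifold M" and c: "plot M c 0" shows "smooth_curve M c"
proof -
  have ch: "charted M" using M by (rule manifold_charted)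
  obtain d where d: "d > 0" "\<And>t. \<bar>t\<bar> < d \<Longrightarrow> plot M c t"
    using plot_eventually[OF c] by (auto simp: eventually_nhds_metric dist_real_def)
  let ?W = "{-d<..<d}"
  have pl: "plot M c t" if "t \<in> ?W" for t using that d(2)[of t] by (auto simp: abs_less_iff)
  have op: "open {t \<in> ?W. c t \<in> V}" if V: "openin (mtop M) V" for V
  proof (subst open_subopen, intro ballI)
    fix t assume t: "t \<in> {t \<in> ?W. c t \<in> V}"
    then have "\<forall>\<^sub>F s in nhds t. c s \<in> V" by (intro plot_eventually_open[OF ch pl V]) auto
    moreover have "\<forall>\<^sub>F s in nhds t. s \<in> ?W" using t by (intro eventually_nhds_in_open) auto
    ultimately have "\<forall>\<^sub>F s in nhds t. s \<in> {t \<in> ?W. c t \<in> V}" by eventually_elim simp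
    then show "\<exists>T. open T \<and> t \<in> T \<and> T \<subseteq> {t \<in> ?W. c t \<in> V}" unfolding eventually_nhds by blast
  qed
  have "smooth_map (open_mfd vec_mfd ?W) M c"
    unfolding smooth_map_def
  proof (intro conjI ballI)
    have "openin (top_of_set ?W) {t \<in> ?W. c t \<in> V}" if "openin (mtop M) V" for V
      using op[OF that] by (auto simp: openin_open_eq)
    then show "continuous_map (mtop (open_mfd vec_mfd ?W)) (mtop M) c"
      using plot_topspace[OF ch pl] by (auto simp: open_mfd_def vec_mfd_def continuous_map_def)
    show "case a of (U, \<phi>) \<Rightarrow> \<forall>(V, \<psi>)\<in>atlas M. smooth_on (\<psi> \<circ> c \<circ> the_inv_into U \<phi>) (\<phi> ` (U \<inter> c -` V))"
      if a: "a \<in> atlas (open_mfd vec_mfd ?W)" for a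
    proof -
      have a: "a = (?W, \<lambda>x. x)" using a by (auto simp: open_mfd_def vec_mfd_def)
      have inv: "the_inv_into ?W (\<lambda>x. x) t = t" if "t \<in> ?W" for t
        using the_inv_into_f_f[of "\<lambda>x. x" ?W t] that by simp
      have "smooth_on (\<psi> \<circ> c \<circ> the_inv_into ?W (\<lambda>x. x)) (?W \<inter> c -` V)" if V: "(V, \<psi>) \<in> atlas M" for V \<psi>
        unfolding smooth_on_def
      proof (intro allI Ck_on_local)
        fix n t assume t: "t \<in> ?W \<inter> c -` V"
        have "smooth_at (\<lambda>s. \<psi> (c s)) t" using t by (intro plot_chart(2)[OF M pl V]) auto
        then have "smooth_at (\<psi> \<circ> c \<circ> the_inv_into ?W (\<lambda>x. x)) t"
        proof (rule smooth_at_cong[rotated])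
          have "\<forall>\<^sub>F s in nhds t. s \<in> ?W" using t by (intro eventually_nhds_in_open) auto
          then show "\<forall>\<^sub>F s in nhds t. \<psi> (c s) = (\<psi> \<circ> c \<circ> the_inv_into ?W (\<lambda>x. x)) s"
            by eventually_elim (simp only: o_apply inv)
        qed
        then show "\<exists>T. open T \<and> t \<in> T \<and> Ck_on n (\<psi> \<circ> c \<circ> the_inv_into ?W (\<lambda>x. x)) T"
          unfolding smooth_at_def smooth_on_def by blast
      qed
      then show ?thesis unfolding a by auto
    qed
  qed
  then show ?thesis using d(1) unfolding smooth_curve_def by blast
qed

section \<open>Calculus on a Lie group\<close>

locale lie_grp =
  fixes G :: "('g, 'v::real_normed_vector) lie" (structure)
  assumes lie: "lie_group G"
begin

sublocale group G
  using lie unfolding lie_group_def by (elim conjE)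

lemma manifold_G: "manifold (mfd G)" and topspace_G: "topspace (mtop (mfd G)) = carrier G"
  and mult_analytic: "analytic_map (prod_mfd (mfd G) (mfd G)) (mfd G) (\<lambda>(x, y). x \<otimes> y)"
  and inv_analytic: "analytic_map (mfd G) (mfd G) (\<lambda>x. inv x)"
  using lie unfolding lie_group_def by simp_all

lemma charted_G: "charted (mfd G)"
  using manifold_G by (rule manifold_charted)

lemma finite_dim_G: "finite_dim TYPE('v)"
  using charted_G by (rule charted_finite_dim)

abbreviation "E \<equiv> fst (echart_at G)"
abbreviation "e \<equiv> echart G"
abbreviation "e0 \<equiv> e \<one>"
abbreviation "ei \<equiv> echart_inv G"

lemma echart_atlas: "(E, e) \<in> atlas (mfd G)" and one_in_E: "\<one> \<in> E"
proof -
  obtain U \<phi> where "(U, \<phi>) \<in> atlas (mfd G)" "\<one> \<in> U"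
    by (rule charted_cover[OF charted_G, of \<one>]) (simp add: topspace_G)
  then have "echart_at G \<in> atlas (mfd G) \<and> \<one> \<in> fst (echart_at G)"
    unfolding echart_at_def by (intro someI[of "\<lambda>c. c \<in> atlas (mfd G) \<and> \<one> \<in> fst c" "(U, \<phi>)"]) simp
  then show "(E, e) \<in> atlas (mfd G)" "\<one> \<in> E" by (simp_all add: echart_def)
qed

lemma E_carrier: "E \<subseteq> carrier G"
  using openin_subset[OF chartedD(1)[OF charted_G echart_atlas]] by (simp add: topspace_G)

lemma ei_e: "g \<in> E \<Longrightarrow> ei (e g) = g"
  unfolding echart_inv_def by (rule the_inv_into_f_f[OF chartedD(2)[OF charted_G echart_atlas]])

lemma e_ei: "z \<in> e ` E \<Longrightarrow> e (ei z) = z"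
  using ei_e by auto

lemma ei_e0 [simp]: "ei e0 = \<one>"
  by (rule ei_e[OF one_in_E])

lemma eventually_e_image: "z \<in> e ` E \<Longrightarrow> \<forall>\<^sub>F y in nhds z. y \<in> e ` E"
  by (rule eventually_nhds_in_open[OF chartedD(4)[OF charted_G echart_atlas]])

lemma plot_ei:
  assumes "z \<in> e ` E" shows "plot (mfd G) ei z"
proof (rule plotI[OF echart_atlas])
  show "\<forall>\<^sub>F y in nhds z. ei y \<in> E"
    using eventually_e_image[OF assms] by eventually_elim (auto simp: ei_e)
  show "smooth_at (\<lambda>y. e (ei y)) z"
    by (rule smooth_at_cong[OF _ smooth_at_ident])
      (use eventually_e_image[OF assms] in eventually_elim, simp add: e_ei)
qed

lemma plot_ei_compose: "smooth_at f x \<Longrightarrow> f x = e0 \<Longrightarrow> plot (mfd G) (\<lambda>y. ei (f y)) x"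
  by (rule plot_compose[OF finite_dim_G plot_ei]) (use one_in_E in auto)

lemma smooth_at_e: "plot (mfd G) f x \<Longrightarrow> f x \<in> E \<Longrightarrow> smooth_at (\<lambda>y. e (f y)) x"
  by (rule plot_chart(2)[OF manifold_G _ echart_atlas])

lemma plot_carrier: "plot (mfd G) f x \<Longrightarrow> f x \<in> carrier G"
  using plot_topspace[OF charted_G] by (simp add: topspace_G)

lemma plot_eventually_carrier: "plot (mfd G) f x \<Longrightarrow> \<forall>\<^sub>F y in nhds x. f y \<in> carrier G"
  by (drule plot_eventually) (erule eventually_mono, rule plot_carrier)

lemma plot_mult: "plot (mfd G) a x \<Longrightarrow> plot (mfd G) b x \<Longrightarrow> plot (mfd G) (\<lambda>y. a y \<otimes> b y) x"
  using plot_smooth_map[OF charted_prod[OF charted_G charted_G] charted_G plot_Pair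
      analytic_map_smooth[OF mult_analytic]] by simp

lemma plot_inv: "plot (mfd G) a x \<Longrightarrow> plot (mfd G) (\<lambda>y. inv (a y)) x"
  by (rule plot_smooth_map[OF charted_G charted_G _ analytic_map_smooth[OF inv_analytic]])

lemma plot_group_const: "g \<in> carrier G \<Longrightarrow> plot (mfd G) (\<lambda>y. g) x"
  by (rule plot_const[OF charted_G]) (simp add: topspace_G)

text \<open>The base point \<open>u (p, t)\<close> and the moving point \<open>u (p, s)\<close> get
  independent variables; only after differentiating in \<open>s\<close> is \<open>s = t\<close>
  restored. Otherwise the derivative would see the base point move as well.\<close>

lemma smooth_at_lvel_family:
  fixes u :: "'p::real_normed_vector \<times> real \<Rightarrow> 'g"
  assumes "finite_dim TYPE('p)" "plot (mfd G) u (p, t)"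
  shows "smooth_at (\<lambda>z. lvel G (\<lambda>s. u (fst z, s)) (snd z)) (p, t)"
proof -
  have fd: "finite_dim TYPE('p \<times> real)"
    by (rule finite_dim_prod[OF assms(1) finite_dim_euclidean])
  let ?W = "\<lambda>y. e (inv (u (fst y)) \<otimes> u (fst (fst y), snd y))"
  have 1: "plot (mfd G) (\<lambda>y. u (fst y)) ((p, t), t)"
    by (rule plot_compose[OF fd]) (use assms(2) in \<open>simp_all add: smooth_at_intros\<close>)
  have 2: "plot (mfd G) (\<lambda>y. u (fst (fst y), snd y)) ((p, t), t)"
    by (rule plot_compose[OF fd, of _ u]) (use assms(2) in \<open>simp_all add: smooth_at_intros\<close>)
  have "plot (mfd G) (\<lambda>y. inv (u (fst y)) \<otimes> u (fst (fst y), snd y)) ((p, t), t)"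
    by (rule plot_mult[OF plot_inv[OF 1] 2])
  then have "smooth_at ?W ((p, t), t)"
    by (rule smooth_at_e) (use plot_carrier[OF assms(2)] one_in_E in simp)
  note D = smooth_at_partial_vector_derivative[OF this]
  have "smooth_at (\<lambda>z. (z, snd z)) (p, t)" by (intro smooth_at_intros)
  then have "smooth_at (\<lambda>z. (\<lambda>y. vector_derivative (\<lambda>s. ?W (fst y, s)) (at (snd y))) (z, snd z)) (p, t)"
    by (rule smooth_at_compose[OF finite_dim_prod[OF fd finite_dim_euclidean], rotated]) (use D in simp)
  then show ?thesis unfolding lvel_def by simp
qed

lemma smooth_at_ltriv2_family:
  fixes u :: "'p::real_normed_vector \<times> real \<Rightarrow> 'g"
  assumes "finite_dim TYPE('p)" "plot (mfd G) u (p, 0)"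
  shows "smooth_at (\<lambda>q. snd (ltriv2 G (\<lambda>s. u (q, s)))) p"
proof -
  note L = smooth_at_lvel_family[OF assms]
  have fd: "finite_dim TYPE('p \<times> real)"
    by (rule finite_dim_prod[OF assms(1) finite_dim_euclidean])
  have pr: "smooth_at (\<lambda>q::'p. (q, 0::real)) p" by (intro smooth_at_intros)
  have "smooth_at (\<lambda>q. lvel G (\<lambda>s. u (q, s)) 0) p"
    using smooth_at_compose[OF fd L pr] by simp
  moreover have "smooth_at (\<lambda>q. vector_derivative (lvel G (\<lambda>s. u (q, s))) (at 0)) p"
    using smooth_at_compose[OF fd smooth_at_partial_vector_derivative[OF L] pr] by simp
  ultimately show ?thesis by (simp add: ltriv2_def smooth_at_Pair)
qed

text \<open>Agreement on a neighbourhood is used because the second-order entry differentiates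
  \<open>lvel\<close>, which reads the curve around each nearby time.\<close>

lemma ltriv2_cong:
  assumes "\<forall>\<^sub>F t in nhds 0. c t = d t" shows "ltriv2 G c = ltriv2 G d"
proof -
  have "\<forall>\<^sub>F t in nhds 0. \<forall>\<^sub>F s in nhds t. c s = d s"
    using assms by (simp add: eventually_eventually)
  then have *: "\<forall>\<^sub>F t in nhds 0. lvel G c t = lvel G d t"
  proof eventually_elim
    case (elim t)
    have "\<forall>\<^sub>F s in nhds t. e (inv (c t) \<otimes> c s) = e (inv (d t) \<otimes> d s)"
      using elim eventually_nhds_x_imp_x[OF elim] by (auto elim: eventually_mono)
    then show ?case unfolding lvel_def by (intro vector_derivative_cong_eq) auto
  qed
  then have "vector_derivative (lvel G c) (at 0) = vector_derivative (lvel G d) (at 0)"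
    by (intro vector_derivative_cong_eq) auto
  then show ?thesis
    using eventually_nhds_x_imp_x[OF *] eventually_nhds_x_imp_x[OF assms] by (simp add: ltriv2_def)
qed

text \<open>In the curve \<open>g e\<^sup>-\<^sup>1(e0 + t \<xi> + (t\<^sup>2 / 2) u)\<close> the second-order entry is \<open>Q + u\<close> with
  \<open>Q\<close> depending on \<open>\<xi>\<close> only, so \<open>u\<close> can be solved for.\<close>

lemma ltriv2_surj:
  assumes g: "g \<in> carrier G"
  shows "\<exists>c. smooth_curve (mfd G) c \<and> ltriv2 G c = (g, \<xi>, w)"
proof -
  have fd2: "finite_dim TYPE('v \<times> 'v)" by (rule finite_dim_prod[OF finite_dim_G finite_dim_G])
  define m where "m = (\<lambda>y. e (inv (ei (fst y)) \<otimes> ei (snd y)))"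
  \<comment> \<open>\<open>A z\<close> converts a chart velocity at \<open>z\<close> into the
    left-trivialised velocity at \<open>ei z\<close>. At \<open>e0\<close> it is the identity, since
    the Lie algebra is represented through this very chart.\<close>
  define A where "A = (\<lambda>z. frechet_derivative (\<lambda>y. m (z, y)) (at z))"
  have m: "smooth_at m (e0, e0)"
    unfolding m_def
    by (intro smooth_at_e plot_mult plot_inv plot_ei_compose smooth_at_fst smooth_at_snd smooth_at_ident)
      (use one_in_E in simp_all)
  have A_smooth: "smooth_at (\<lambda>z. A z v) e0" for v
  proof -
    have "smooth_at (\<lambda>z. (z, z)) e0" by (intro smooth_at_intros)
    then have "smooth_at (\<lambda>z. (\<lambda>z. frechet_derivative (\<lambda>y. m (fst z, y)) (at (snd z)) v) (z, z)) e0"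
      by (rule smooth_at_compose[OF fd2, rotated]) (rule smooth_at_partial_derivative[OF m])
    then show ?thesis by (simp add: A_def)
  qed
  have A_e0: "A e0 v = v" for v
  proof -
    have "\<forall>\<^sub>F y in nhds e0. m (e0, y) = y"
    proof (rule eventually_mono[OF eventually_e_image])
      fix y assume "y \<in> e ` E"
      then show "m (e0, y) = y" using E_carrier by (auto simp: m_def ei_e)
    qed (use one_in_E in blast)
    then obtain S where "open S" "e0 \<in> S" "\<And>y. y \<in> S \<Longrightarrow> m (e0, y) = y" unfolding eventually_nhds by blast
    then have "((\<lambda>y. m (e0, y)) has_derivative (\<lambda>v. v)) (at e0)"
      by (intro has_derivative_transform_within_open[OF has_derivative_ident, of S]) auto
    then show ?thesis unfolding A_def by (metis frechet_derivative_at)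
  qed
  \<comment> \<open>The second-order entry already present in the straight chart line
    \<open>e0 + t \<xi>\<close>.\<close>
  define Q where "Q = frechet_derivative (\<lambda>z. A z \<xi>) (at e0) \<xi>"
  define u where "u = w - Q"
  define x where "x = (\<lambda>t::real. e0 + t *\<^sub>R \<xi> + (t\<^sup>2 / 2) *\<^sub>R u)"
  have x0: "x 0 = e0" by (simp add: x_def)
  have dx: "(x has_vector_derivative \<xi> + t *\<^sub>R u) (at t)" for t
    unfolding x_def by (auto intro!: derivative_eq_intros simp: has_vector_derivative_def algebra_simps)
  have sq: "smooth_at (\<lambda>t::real. (t\<^sup>2 / 2) *\<^sub>R u) 0"
  proof -
    have "smooth_at (\<lambda>t::real. t *\<^sub>R (t *\<^sub>R ((1/2) *\<^sub>R u))) 0" by (intro smooth_at_scaleR smooth_at_const smooth_at_ident)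
    then show ?thesis by (simp add: power2_eq_square)
  qed
  have xs: "smooth_at x 0"
    unfolding x_def by (intro smooth_at_add smooth_at_scaleR smooth_at_const smooth_at_ident sq)
  have px: "plot (mfd G) (\<lambda>t. ei (x t)) 0" by (rule plot_ei_compose[OF xs x0])
  define c where "c = (\<lambda>t. g \<otimes> ei (x t))"
  have pc: "plot (mfd G) c 0" unfolding c_def by (intro plot_mult plot_group_const g px)
  have c0: "c 0 = g" using g by (simp add: c_def x0)
  \<comment> \<open>Left translation by \<open>g\<close> drops out of
    \<open>inv (c t) \<otimes> c s\<close>, so the chain rule takes place entirely in the
    chart.\<close>
  have lv: "\<forall>\<^sub>F t in nhds 0. lvel G c t = A (x t) \<xi> + t *\<^sub>R A (x t) u"
  proof -
    have "smooth_at (\<lambda>t. (x t, x t)) 0" by (rule smooth_at_Pair[OF xs xs])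
    moreover obtain S where S: "open S" "(e0, e0) \<in> S" "\<And>z. z \<in> S \<Longrightarrow> smooth_at m z"
      using smooth_at_eventually[OF m] unfolding eventually_nhds by blast
    ultimately have 1: "\<forall>\<^sub>F t in nhds 0. (x t, x t) \<in> S"
      by (intro smooth_at_eventually_open) (simp_all add: x0)
    have "\<forall>\<^sub>F t in nhds 0. ei (x t) \<in> carrier G" by (rule plot_eventually_carrier[OF px])
    then have "\<forall>\<^sub>F t in nhds 0. \<forall>\<^sub>F s in nhds t. ei (x s) \<in> carrier G" by (simp add: eventually_eventually)
    with 1 show ?thesis
    proof eventually_elim
      case (elim t)
      have ct: "ei (x t) \<in> carrier G" by (rule eventually_nhds_x_imp_x[OF elim(2)])
      have sec: "((\<lambda>y. m (x t, y)) has_derivative A (x t)) (at (x t))"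
        using smooth_at_section_has_derivative[OF S(3)[OF elim(1)]] frechet_derivative_works
        unfolding A_def by (metis differentiableI fst_conv snd_conv)
      then have "((\<lambda>s. m (x t, x s)) has_vector_derivative A (x t) (\<xi> + t *\<^sub>R u)) (at t)"
        using diff_chain_at[OF dx[unfolded has_vector_derivative_def] sec] linear_scale[OF has_derivative_linear[OF sec]]
        by (simp add: o_def has_vector_derivative_def)
      then have "vector_derivative (\<lambda>s. m (x t, x s)) (at t) = A (x t) (\<xi> + t *\<^sub>R u)"
        by (rule vector_derivative_at)
      moreover have "lvel G c t = vector_derivative (\<lambda>s. m (x t, x s)) (at t)"
        unfolding lvel_def
      proof (rule vector_derivative_cong_eq)
        show "\<forall>\<^sub>F s in nhds t. s \<in> UNIV \<longrightarrow> e (inv (c t) \<otimes> c s) = m (x t, x s)"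
          using elim(2)
        proof eventually_elim
          case (elim s)
          have "inv (c t) \<otimes> c s = inv (ei (x t)) \<otimes> ei (x s)"
            using g ct elim by (simp add: c_def inv_mult_group m_assoc) (simp add: m_assoc[symmetric])
          then show ?case by (simp add: m_def)
        qed
      qed simp_all
      ultimately show ?case
        using linear_add[OF has_derivative_linear[OF sec]] linear_scale[OF has_derivative_linear[OF sec]] by simp
    qed
  qed
  have A1: "((\<lambda>t. A (x t) \<xi>) has_vector_derivative Q) (at 0)"
  proof -
    have "((\<lambda>z. A z \<xi>) has_derivative frechet_derivative (\<lambda>z. A z \<xi>) (at e0)) (at (x 0))"
      using smooth_at_has_derivative[OF A_smooth] by (simp add: x0)
    from diff_chain_at[OF dx[of 0, unfolded has_vector_derivative_def] this] linear_scale[OF has_derivative_linear[OF this]]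
    show ?thesis by (simp add: o_def has_vector_derivative_def Q_def)
  qed
  \<comment> \<open>At \<open>t = 0\<close> only the derivative of the factor \<open>t\<close>
    survives, leaving \<open>A e0 u = u\<close>.\<close>
  have A2: "((\<lambda>t. t *\<^sub>R A (x t) u) has_vector_derivative u) (at 0)"
  proof -
    have "smooth_at (\<lambda>t. A (x t) u) 0"
      by (rule smooth_at_compose[OF finite_dim_G _ xs]) (simp add: x0 A_smooth)
    from has_vector_derivative_scaleR[OF DERIV_ident smooth_at_has_vector_derivative[OF this]]
    show ?thesis by (simp add: x0 A_e0)
  qed
  have "((\<lambda>t. A (x t) \<xi> + t *\<^sub>R A (x t) u) has_vector_derivative w) (at 0)"
    using has_vector_derivative_add[OF A1 A2] by (simp add: u_def)
  then have "vector_derivative (lvel G c) (at 0) = w"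
    using vector_derivative_cong_eq[of UNIV "lvel G c" "\<lambda>t. A (x t) \<xi> + t *\<^sub>R A (x t) u" 0] lv
    by (simp add: vector_derivative_at)
  moreover have "lvel G c 0 = \<xi>" using eventually_nhds_x_imp_x[OF lv] by (simp add: x0 A_e0)
  ultimately have "ltriv2 G c = (g, \<xi>, w)" by (simp add: ltriv2_def c0)
  then show ?thesis using plot_smooth_curve[OF manifold_G pc] by blast
qed

end

section \<open>The local diffeomorphism \<tau> and its right-trivialised differential\<close>

locale lie_grp_tau = lie_grp G for G :: "('g, 'v::real_normed_vector) lie" (structure) +
  fixes \<tau> :: "'v \<Rightarrow> 'g" and U :: "'v set"
  assumes tau: "local_diffeo_tau G \<tau> U"
begin

abbreviation "\<sigma> \<equiv> the_inv_into U \<tau>"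
abbreviation "T \<theta> \<equiv> the_inv_into UNIV (dtau G \<tau> \<theta>)"

lemma open_U: "open U" and openin_image: "openin (mtop (mfd G)) (\<tau> ` U)"
  and diffeo: "analytic_diffeo (open_mfd vec_mfd U) (open_mfd (mfd G) (\<tau> ` U)) \<tau>"
  using tau unfolding local_diffeo_tau_def by simp_all

lemma tau_carrier: "\<theta> \<in> U \<Longrightarrow> \<tau> \<theta> \<in> carrier G"
  using openin_subset[OF openin_image] by (auto simp: topspace_G)

lemma minus_U: "\<theta> \<in> U \<Longrightarrow> - \<theta> \<in> U" and tau_minus: "\<theta> \<in> U \<Longrightarrow> \<tau> (- \<theta>) = inv (\<tau> \<theta>)"
proof -
  assume \<theta>: "\<theta> \<in> U"
  have *: "- \<theta> \<in> U" "\<tau> (- \<theta>) \<otimes> \<tau> \<theta> = \<one>" using tau \<theta> unfolding local_diffeo_tau_def by simp_all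
  show "- \<theta> \<in> U" by (rule *)
  show "\<tau> (- \<theta>) = inv (\<tau> \<theta>)" using inv_equality[OF *(2) tau_carrier[OF \<theta>] tau_carrier[OF *(1)]] by simp
qed

lemma inj_tau: "inj_on \<tau> U"
proof -
  have "topspace (mtop (open_mfd vec_mfd U)) = U" by (simp add: open_mfd_def vec_mfd_def)
  then show ?thesis using diffeo unfolding analytic_diffeo_def bij_betw_def by simp
qed

lemma sigma_tau: "\<theta> \<in> U \<Longrightarrow> \<sigma> (\<tau> \<theta>) = \<theta>"
  by (rule the_inv_into_f_f[OF inj_tau])

lemma plot_tau:
  assumes z: "smooth_at z x" "z x \<in> U" shows "plot (mfd G) (\<lambda>y. \<tau> (z y)) x"
proof -
  have 1: "charted (vec_mfd :: ('v, 'v) mfd)" by (rule charted_vec[OF finite_dim_G])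
  have 2: "openin (mtop (vec_mfd :: ('v, 'v) mfd)) U" by (simp add: vec_mfd_def open_U)
  have "plot (open_mfd vec_mfd U) z x"
    by (rule plot_open_mfd[OF 1 2]) (simp_all add: plot_vec z)
  moreover have "smooth_map (open_mfd vec_mfd U) (open_mfd (mfd G) (\<tau> ` U)) \<tau>"
    using diffeo unfolding analytic_diffeo_def by (blast intro: analytic_map_smooth)
  ultimately have "plot (open_mfd (mfd G) (\<tau> ` U)) (\<lambda>y. \<tau> (z y)) x"
    by (rule plot_smooth_map[OF charted_open_mfd[OF 1 2] charted_open_mfd[OF charted_G openin_image]])
  then show ?thesis by (rule plot_open_mfdD)
qed

lemma smooth_at_sigma:
  assumes f: "plot (mfd G) f x" "f x \<in> \<tau> ` U" shows "smooth_at (\<lambda>y. \<sigma> (f y)) x"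
proof -
  have 1: "charted (vec_mfd :: ('v, 'v) mfd)" by (rule charted_vec[OF finite_dim_G])
  have 2: "openin (mtop (vec_mfd :: ('v, 'v) mfd)) U" by (simp add: vec_mfd_def open_U)
  have "plot (open_mfd (mfd G) (\<tau> ` U)) f x"
    by (rule plot_open_mfd[OF charted_G openin_image]) (simp_all add: f)
  moreover have "topspace (mtop (open_mfd vec_mfd U)) = U" by (simp add: open_mfd_def vec_mfd_def)
  then have "smooth_map (open_mfd (mfd G) (\<tau> ` U)) (open_mfd vec_mfd U) \<sigma>"
    using diffeo unfolding analytic_diffeo_def by (auto intro: analytic_map_smooth)
  ultimately have "plot (open_mfd vec_mfd U) (\<lambda>y. \<sigma> (f y)) x"
    by (rule plot_smooth_map[OF charted_open_mfd[OF charted_G openin_image] charted_open_mfd[OF 1 2]])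
  from plot_open_mfdD[OF this] show ?thesis by (simp add: plot_vec)
qed

lemma eventually_tau_image:
  "plot (mfd G) f x \<Longrightarrow> f x \<in> \<tau> ` U \<Longrightarrow> \<forall>\<^sub>F y in nhds x. f y \<in> \<tau> ` U"
  by (rule plot_eventually_open[OF charted_G _ openin_image])

text \<open>\<open>dtau\<close> is the derivative of \<open>?f\<close>, the map \<tau> translated to
  the identity and read in the chart. The corresponding expression \<open>?g\<close> of
  \<open>\<sigma>\<close> inverts it on both sides near the base points, so by the chain rule the
  derivatives are mutually inverse. Thus \<open>T \<theta>\<close>, defined as a mere set-theoretic
  inverse, is the derivative of \<open>?g\<close>.\<close>

lemma dtau_inverse:
  assumes \<theta>: "\<theta> \<in> U"
  shows dtau_has_derivative: "((\<lambda>x. e (\<tau> x \<otimes> inv (\<tau> \<theta>))) has_derivative dtau G \<tau> \<theta>) (at \<theta>)"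
    and T_dtau: "T \<theta> (dtau G \<tau> \<theta> v) = v"
    and bounded_linear_T: "bounded_linear (T \<theta>)"
proof -
  let ?f = "\<lambda>x. e (\<tau> x \<otimes> inv (\<tau> \<theta>))" and ?g = "\<lambda>y. \<sigma> (ei y \<otimes> \<tau> \<theta>)"
  have f\<theta>: "?f \<theta> = e0" using tau_carrier[OF \<theta>] by simp
  have gE: "?g e0 = \<theta>" using tau_carrier[OF \<theta>] by (simp add: sigma_tau[OF \<theta>])
  have pf: "plot (mfd G) (\<lambda>x. \<tau> x \<otimes> inv (\<tau> \<theta>)) \<theta>"
    by (intro plot_mult plot_tau plot_group_const inv_closed tau_carrier smooth_at_ident \<theta>)
  have sf: "smooth_at ?f \<theta>"
    by (rule smooth_at_e[OF pf]) (use tau_carrier[OF \<theta>] one_in_E in simp)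
  have pg: "plot (mfd G) (\<lambda>y. ei y \<otimes> \<tau> \<theta>) e0"
    by (intro plot_mult plot_ei plot_group_const tau_carrier \<theta> imageI one_in_E)
  have gim: "ei e0 \<otimes> \<tau> \<theta> \<in> \<tau> ` U" using tau_carrier[OF \<theta>] \<theta> by simp
  have sg: "smooth_at ?g e0" by (rule smooth_at_sigma[OF pg gim])
  let ?f' = "frechet_derivative ?f (at \<theta>)" and ?g' = "frechet_derivative ?g (at e0)"
  have df: "(?f has_derivative ?f') (at \<theta>)" by (rule smooth_at_has_derivative[OF sf])
  have dg: "(?g has_derivative ?g') (at e0)" by (rule smooth_at_has_derivative[OF sg])
  have "\<forall>\<^sub>F x in nhds \<theta>. \<tau> x \<otimes> inv (\<tau> \<theta>) \<in> E"
    by (rule plot_chart(1)[OF manifold_G pf echart_atlas]) (use tau_carrier[OF \<theta>] one_in_E in simp)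
  moreover have "\<forall>\<^sub>F x in nhds \<theta>. x \<in> U" by (rule eventually_nhds_in_open[OF open_U \<theta>])
  ultimately have "\<forall>\<^sub>F x in nhds \<theta>. ?g (?f x) = x"
    by eventually_elim (use tau_carrier \<theta> in \<open>simp add: ei_e sigma_tau m_assoc\<close>)
  then obtain S where S: "open S" "\<theta> \<in> S" "\<And>x. x \<in> S \<Longrightarrow> x = ?g (?f x)" unfolding eventually_nhds by metis
  have "((\<lambda>x. ?g (?f x)) has_derivative (\<lambda>v. ?g' (?f' v))) (at \<theta>)"
    using diff_chain_at[OF df, of ?g ?g'] dg f\<theta> by (simp add: o_def)
  from has_derivative_unique[OF this has_derivative_transform_within_open[OF has_derivative_ident S]]
  have gf: "?g' (?f' v) = v" for v by metis
  have "\<forall>\<^sub>F y in nhds e0. ei y \<otimes> \<tau> \<theta> \<in> \<tau> ` U" by (rule eventually_tau_image[OF pg gim])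
  moreover have "\<forall>\<^sub>F y in nhds e0. y \<in> e ` E" using one_in_E by (intro eventually_e_image imageI)
  ultimately have "\<forall>\<^sub>F y in nhds e0. y = ?f (?g y)"
  proof eventually_elim
    case (elim y)
    have "ei y \<in> carrier G" using elim(2) E_carrier by (auto simp: ei_e)
    moreover have "\<tau> (?g y) = ei y \<otimes> \<tau> \<theta>" by (rule f_the_inv_into_f[OF inj_tau elim(1)])
    ultimately show ?case using tau_carrier[OF \<theta>] e_ei[OF elim(2)] by (simp add: m_assoc)
  qed
  then obtain S where S: "open S" "e0 \<in> S" "\<And>x. x \<in> S \<Longrightarrow> x = ?f (?g x)" unfolding eventually_nhds by metis
  have "((\<lambda>x. ?f (?g x)) has_derivative (\<lambda>v. ?f' (?g' v))) (at e0)"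
    using diff_chain_at[OF dg, of ?f ?f'] df gE by (simp add: o_def)
  from has_derivative_unique[OF this has_derivative_transform_within_open[OF has_derivative_ident S]]
  have fg: "?f' (?g' v) = v" for v by metis
  have inj: "inj ?f'" by (rule inj_on_inverseI[of _ ?g']) (rule gf)
  have dt: "dtau G \<tau> \<theta> = ?f'" unfolding dtau_def ..
  have T: "T \<theta> = ?g'"
  proof
    fix v show "T \<theta> v = ?g' v"
      unfolding dt using the_inv_into_f_f[OF inj, of "?g' v"] by (simp add: fg)
  qed
  show "(?f has_derivative dtau G \<tau> \<theta>) (at \<theta>)" unfolding dt by (rule df)
  show "T \<theta> (dtau G \<tau> \<theta> v) = v" unfolding T unfolding dt by (rule gf)
  show "bounded_linear (T \<theta>)" unfolding T by (rule has_derivative_bounded_linear[OF dg])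
qed

text \<open>The velocity of \<open>a(\<epsilon>)\<^sup>-\<^sup>1 a(0)\<close> is minus that of \<open>a(0)\<^sup>-\<^sup>1 a(\<epsilon>)\<close>, because \<open>a(\<epsilon>)\<^sup>-\<^sup>1 a(\<epsilon>)\<close> is constant;
  this avoids differentiating the inversion of \<open>G\<close>.\<close>

lemma sigma_left_derivative:
  fixes a :: "real \<Rightarrow> 'g"
  assumes a: "plot (mfd G) a 0" and \<theta>: "\<theta> \<in> U" and b: "b = a 0 \<otimes> \<tau> \<theta>"
  shows "((\<lambda>\<epsilon>. \<sigma> (inv (a \<epsilon>) \<otimes> b)) has_vector_derivative - T \<theta> (lvel G a 0)) (at 0)"
proof -
  have fd: "finite_dim TYPE(real \<times> real)" by (rule finite_dim_euclidean)
  note a0 = plot_carrier[OF a] and t = tau_carrier[OF \<theta>]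
  have bc: "b \<in> carrier G" using a0 t b by simp
  have ab: "inv (a 0) \<otimes> b = \<tau> \<theta>" using a0 t by (simp add: b m_assoc[symmetric])
  have py: "plot (mfd G) (\<lambda>\<epsilon>. inv (a \<epsilon>) \<otimes> b) 0" by (intro plot_mult plot_inv plot_group_const a bc)
  let ?y = "\<lambda>\<epsilon>. \<sigma> (inv (a \<epsilon>) \<otimes> b)"
  have sy: "smooth_at ?y 0" by (rule smooth_at_sigma[OF py]) (simp add: ab \<theta>)
  have y0: "?y 0 = \<theta>" by (simp add: ab sigma_tau[OF \<theta>])
  note dy = smooth_at_has_vector_derivative[OF sy]
  let ?y' = "vector_derivative ?y (at 0)"
  have "((\<lambda>\<epsilon>. e (\<tau> (?y \<epsilon>) \<otimes> inv (\<tau> \<theta>))) has_vector_derivative dtau G \<tau> \<theta> ?y') (at 0)"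
    using diff_chain_at[OF dy[unfolded has_vector_derivative_def], of _ "dtau G \<tau> \<theta>"] dtau_has_derivative[OF \<theta>]
      linear_scale[OF has_derivative_linear[OF dtau_has_derivative[OF \<theta>]]]
    by (simp add: o_def y0 has_vector_derivative_def)
  \<comment> \<open>Right translation by the inverse of \<open>\<tau> \<theta>\<close> removes
    \<open>b\<close>, so the right-trivialised differential sees only the motion of
    \<open>a\<close>.\<close>
  moreover have "\<forall>\<^sub>F \<epsilon> in nhds 0. e (\<tau> (?y \<epsilon>) \<otimes> inv (\<tau> \<theta>)) = e (inv (a \<epsilon>) \<otimes> a 0)"
  proof -
    have "\<forall>\<^sub>F \<epsilon> in nhds 0. inv (a \<epsilon>) \<otimes> b \<in> \<tau> ` U" by (rule eventually_tau_image[OF py]) (simp add: ab \<theta>)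
    with plot_eventually_carrier[OF a] show ?thesis
    proof eventually_elim
      case (elim \<epsilon>)
      have "\<tau> (?y \<epsilon>) = inv (a \<epsilon>) \<otimes> b" by (rule f_the_inv_into_f[OF inj_tau elim(2)])
      then show ?case using elim(1) a0 t by (simp add: b m_assoc)
    qed
  qed
  ultimately have 1: "vector_derivative (\<lambda>\<epsilon>. e (inv (a \<epsilon>) \<otimes> a 0)) (at 0) = dtau G \<tau> \<theta> ?y'"
    using vector_derivative_cong_eq[of UNIV "\<lambda>\<epsilon>. e (\<tau> (?y \<epsilon>) \<otimes> inv (\<tau> \<theta>))" "\<lambda>\<epsilon>. e (inv (a \<epsilon>) \<otimes> a 0)" 0]
    by (simp add: vector_derivative_at)
  let ?Z = "\<lambda>z. e (inv (a (fst z)) \<otimes> a (snd z))"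
  have p1: "plot (mfd G) (\<lambda>z. a (fst z)) (0::real, 0::real)"
    by (rule plot_compose[OF finite_dim_euclidean]) (use a in \<open>simp_all add: smooth_at_fst smooth_at_ident\<close>)
  have p2: "plot (mfd G) (\<lambda>z. a (snd z)) (0::real, 0::real)"
    by (rule plot_compose[OF finite_dim_euclidean]) (use a in \<open>simp_all add: smooth_at_snd smooth_at_ident\<close>)
  have "smooth_at ?Z (0, 0)"
    by (rule smooth_at_e[OF plot_mult[OF plot_inv[OF p1] p2]]) (use a0 one_in_E in simp)
  from vector_derivative_diagonal[OF this]
  have "((\<lambda>\<epsilon>. e (inv (a \<epsilon>) \<otimes> a \<epsilon>)) has_vector_derivative
      vector_derivative (\<lambda>\<epsilon>. e (inv (a \<epsilon>) \<otimes> a 0)) (at 0) + lvel G a 0) (at 0)"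
    by (simp add: lvel_def)
  moreover have "((\<lambda>\<epsilon>. e (inv (a \<epsilon>) \<otimes> a \<epsilon>)) has_vector_derivative 0) (at 0)"
  proof (subst has_vector_derivative_cong_ev)
    show "\<forall>\<^sub>F \<epsilon> in nhds 0. \<epsilon> \<in> UNIV \<longrightarrow> e (inv (a \<epsilon>) \<otimes> a \<epsilon>) = e0"
      using plot_eventually_carrier[OF a] by eventually_elim simp
  qed (use a0 in simp_all)
  ultimately have "dtau G \<tau> \<theta> ?y' + lvel G a 0 = 0"
    unfolding 1 by (rule vector_derivative_unique_at)
  then have "dtau G \<tau> \<theta> ?y' = - lvel G a 0" by (simp add: eq_neg_iff_add_eq_0)
  then have "?y' = T \<theta> (- lvel G a 0)" using T_dtau[OF \<theta>, of ?y'] by simp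
  also have "\<dots> = - T \<theta> (lvel G a 0)"
    using linear_neg[OF bounded_linear.linear[OF bounded_linear_T[OF \<theta>]]] by blast
  finally show ?thesis using dy by simp
qed

text \<open>The part of \<open>b\<close> reduces to that of \<open>a\<close> because \<open>\<sigma>(g\<^sup>-\<^sup>1) = - \<sigma>(g)\<close>.\<close>

lemma sigma_derivative:
  fixes a b :: "real \<Rightarrow> 'g"
  assumes a: "plot (mfd G) a 0" and b: "plot (mfd G) b 0" and \<theta>: "\<theta> \<in> U" and ab: "b 0 = a 0 \<otimes> \<tau> \<theta>"
  shows "((\<lambda>\<epsilon>. \<sigma> (inv (a \<epsilon>) \<otimes> b \<epsilon>)) has_vector_derivative
    T (- \<theta>) (lvel G b 0) - T \<theta> (lvel G a 0)) (at 0)"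
proof -
  note a0 = plot_carrier[OF a] and b0 = plot_carrier[OF b] and t = tau_carrier[OF \<theta>]
  have ab': "inv (a 0) \<otimes> b 0 = \<tau> \<theta>" using a0 t by (simp add: ab m_assoc[symmetric])
  let ?Z = "\<lambda>z. \<sigma> (inv (a (fst z)) \<otimes> b (snd z))"
  have p1: "plot (mfd G) (\<lambda>z. a (fst z)) (0::real, 0::real)"
    by (rule plot_compose[OF finite_dim_euclidean]) (use a in \<open>simp_all add: smooth_at_fst smooth_at_ident\<close>)
  have p2: "plot (mfd G) (\<lambda>z. b (snd z)) (0::real, 0::real)"
    by (rule plot_compose[OF finite_dim_euclidean]) (use b in \<open>simp_all add: smooth_at_snd smooth_at_ident\<close>)
  have "smooth_at ?Z (0, 0)"
    by (rule smooth_at_sigma[OF plot_mult[OF plot_inv[OF p1] p2]]) (simp add: ab' \<theta>)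
  from vector_derivative_diagonal[OF this]
  have D: "((\<lambda>\<epsilon>. \<sigma> (inv (a \<epsilon>) \<otimes> b \<epsilon>)) has_vector_derivative
    vector_derivative (\<lambda>\<epsilon>. \<sigma> (inv (a \<epsilon>) \<otimes> b 0)) (at 0) + vector_derivative (\<lambda>\<epsilon>. \<sigma> (inv (a 0) \<otimes> b \<epsilon>)) (at 0)) (at 0)"
    by simp
  have 1: "vector_derivative (\<lambda>\<epsilon>. \<sigma> (inv (a \<epsilon>) \<otimes> b 0)) (at 0) = - T \<theta> (lvel G a 0)"
    by (rule vector_derivative_at[OF sigma_left_derivative[OF a \<theta> ab]])
  have pb: "plot (mfd G) (\<lambda>\<epsilon>. inv (a 0) \<otimes> b \<epsilon>) 0" by (intro plot_mult plot_group_const inv_closed a0 b)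
  \<comment> \<open>Exchanging the roles of \<open>a\<close> and \<open>b\<close> turns
    \<open>\<theta>\<close> into \<open>- \<theta>\<close>; this is the origin of the opposite
    argument in the momentum at the right node.\<close>
  have "a 0 = b 0 \<otimes> \<tau> (- \<theta>)" using a0 t by (simp add: ab tau_minus[OF \<theta>] m_assoc)
  note L = has_vector_derivative_minus[OF sigma_left_derivative[OF b minus_U[OF \<theta>] this]]
  have ev: "\<forall>\<^sub>F \<epsilon> in nhds 0. - \<sigma> (inv (b \<epsilon>) \<otimes> a 0) = \<sigma> (inv (a 0) \<otimes> b \<epsilon>)"
  proof -
    have "\<forall>\<^sub>F \<epsilon> in nhds 0. inv (a 0) \<otimes> b \<epsilon> \<in> \<tau> ` U" by (rule eventually_tau_image[OF pb]) (simp add: ab' \<theta>)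
    with plot_eventually_carrier[OF b] show ?thesis
    proof eventually_elim
      case (elim \<epsilon>)
      then obtain \<eta> where \<eta>: "\<eta> \<in> U" "inv (a 0) \<otimes> b \<epsilon> = \<tau> \<eta>" by auto
      have "inv (b \<epsilon>) \<otimes> a 0 = inv (inv (a 0) \<otimes> b \<epsilon>)" using elim(1) a0 by (simp add: inv_mult_group)
      then have "inv (b \<epsilon>) \<otimes> a 0 = \<tau> (- \<eta>)" by (simp add: \<eta> tau_minus)
      then show ?case by (simp add: \<eta> sigma_tau minus_U)
    qed
  qed
  have "((\<lambda>\<epsilon>. \<sigma> (inv (a 0) \<otimes> b \<epsilon>)) has_vector_derivative T (- \<theta>) (lvel G b 0)) (at 0)"
    using L has_vector_derivative_cong_ev[of UNIV "\<lambda>\<epsilon>. - \<sigma> (inv (b \<epsilon>) \<otimes> a 0)" "\<lambda>\<epsilon>. \<sigma> (inv (a 0) \<otimes> b \<epsilon>)" 0]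
      ev eventually_nhds_x_imp_x[OF ev] by simp
  from D[unfolded 1 vector_derivative_at[OF this]] show ?thesis by simp
qed

end

section \<open>The derivative of the discrete functional\<close>

text \<open>Proved directly for every normed space: it also serves curves of multipliers in the
  dual, where \<open>plot_smooth_curve\<close> would first require that the dual be
  finite-dimensional.\<close>

lemma smooth_at_smooth_curve_vec:
  assumes "smooth_at f 0" shows "smooth_curve vec_mfd f"
proof -
  obtain A where A: "open A" "0 \<in> A" "smooth_on f A" using assms unfolding smooth_at_def by blast
  obtain d where d: "d > 0" "ball 0 d \<subseteq> A" using A(1,2) open_contains_ball by blast
  let ?W = "{-d<..<d}"
  have sf: "smooth_on f ?W"
    by (rule smooth_on_subset[OF A(3)]) (use d(2) in \<open>auto simp: subset_iff dist_real_def\<close>)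
  have inv: "the_inv_into ?W (\<lambda>x. x) t = t" if "t \<in> ?W" for t
    using the_inv_into_f_f[of "\<lambda>x. x" ?W t] that by simp
  have "smooth_on ((\<lambda>x. x) \<circ> f \<circ> the_inv_into ?W (\<lambda>x. x)) ?W"
    unfolding smooth_on_def
  proof
    fix n
    have "Ck_on n f ?W" using sf unfolding smooth_on_def by blast
    then show "Ck_on n ((\<lambda>x. x) \<circ> f \<circ> the_inv_into ?W (\<lambda>x. x)) ?W"
      by (rule Ck_on_cong[rotated 2]) (simp_all only: o_apply inv open_greaterThanLessThan)
  qed
  moreover have "continuous_on ?W f" using sf Ck_on.simps(1) unfolding smooth_on_def by blast
  ultimately have "smooth_map (open_mfd vec_mfd ?W) vec_mfd f"
    by (simp add: smooth_map_def open_mfd_def vec_mfd_def)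
  then show ?thesis using d(1) unfolding smooth_curve_def by blast
qed

locale hohp = lie_grp_tau G "tau D" "tdom D" for G :: "('g, 'v::real_normed_vector) lie" (structure)
    and D :: "('g, 'v) scheme" +
  fixes l :: "'v \<times> 'v \<Rightarrow> real"
  assumes l_diff: "l differentiable_on UNIV" and dt_pos: "dt D > 0" and nsteps_pos: "nsteps D \<ge> 1"
begin

abbreviation "N \<equiv> nsteps D"
abbreviation "St \<equiv> {1..nstages D}"

lemma tau_inv_sigma: "tau_inv D = \<sigma>"
  by (simp add: tau_inv_def fun_eq_iff)

lemma rk_inner_cong: "(\<And>j. j \<in> St \<Longrightarrow> X j = Y j) \<Longrightarrow> rk_inner D X i = rk_inner D Y i"
  and rk_outer_cong: "(\<And>j. j \<in> St \<Longrightarrow> X j = Y j) \<Longrightarrow> rk_outer D X = rk_outer D Y"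
  unfolding rk_inner_def rk_outer_def by (auto intro: sum.cong)

lemma rk_inner_has_vector_derivative:
  "(\<And>j. j \<in> St \<Longrightarrow> (X j has_vector_derivative X' j) F) \<Longrightarrow>
    ((\<lambda>\<epsilon>. rk_inner D (\<lambda>j. X j \<epsilon>) i) has_vector_derivative rk_inner D X' i) F"
  and rk_outer_has_vector_derivative:
  "(\<And>j. j \<in> St \<Longrightarrow> (X j has_vector_derivative X' j) F) \<Longrightarrow>
    ((\<lambda>\<epsilon>. rk_outer D (\<lambda>j. X j \<epsilon>)) has_vector_derivative rk_outer D X') F"
  unfolding rk_inner_def rk_outer_def
  by (intro has_vector_derivative_sum bounded_linear.has_vector_derivative[OF bounded_linear_scaleR_right]; simp)+

lemma rk_outer_smooth_at:
  "(\<And>j. j \<in> St \<Longrightarrow> smooth_at (X j) x) \<Longrightarrow> smooth_at (\<lambda>\<epsilon>. rk_outer D (\<lambda>j. X j \<epsilon>)) x"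
  unfolding rk_outer_def by (intro smooth_at_sum smooth_at_scaleR smooth_at_const) simp

abbreviation "\<theta>o \<gamma> k \<equiv> dt D *\<^sub>R rk_outer D (s\<Xi> \<gamma> k)"
abbreviation "\<theta>i \<gamma> k i \<equiv> dt D *\<^sub>R rk_inner D (s\<Xi> \<gamma> k) i"

text \<open>Nodes and stages move while the multipliers stay: along reconstructed paths the terms
  paired with them vanish, whatever the multipliers are.\<close>

definition vary :: "('g, 'v) dpath \<Rightarrow> (nat \<Rightarrow> real \<Rightarrow> 'g) \<Rightarrow> (nat \<Rightarrow> real \<Rightarrow> 'v) \<Rightarrow>
    (nat \<Rightarrow> nat \<Rightarrow> real \<Rightarrow> 'g) \<Rightarrow> (nat \<Rightarrow> nat \<Rightarrow> real \<Rightarrow> 'v) \<Rightarrow> (nat \<Rightarrow> nat \<Rightarrow> real \<Rightarrow> 'v) \<Rightarrow> real \<Rightarrow> ('g, 'v) dpath" where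
  "vary \<gamma> g x Gs X V \<epsilon> = \<gamma>\<lparr>pg := \<lambda>k. g k \<epsilon>, p\<xi> := \<lambda>k. x k \<epsilon>, sG := \<lambda>k i. Gs k i \<epsilon>,
     s\<Xi> := \<lambda>k i. X k i \<epsilon>, sV := \<lambda>k i. V k i \<epsilon>\<rparr>"

text \<open>The coefficients of the velocities of the left and of the right node in the derivative of the
  \<open>k\<close>-th summand of the functional, up to sign.\<close>

definition out_momentum :: "('g, 'v) dpath \<Rightarrow> nat \<Rightarrow> 'v \<Rightarrow> 'v \<Rightarrow> real" where
  "out_momentum \<gamma> k \<eta> \<delta> = p\<mu>c \<gamma> (k+1) (T (\<theta>o \<gamma> k) \<eta>) + (\<Sum>i\<in>St. s\<mu> \<gamma> k i (T (\<theta>i \<gamma> k i) \<eta>))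
     + p\<nu> \<gamma> (k+1) \<delta> + (\<Sum>i\<in>St. s\<nu> \<gamma> k i \<delta>)"

definition in_momentum :: "('g, 'v) dpath \<Rightarrow> nat \<Rightarrow> 'v \<Rightarrow> 'v \<Rightarrow> real" where
  "in_momentum \<gamma> k \<eta> \<delta> = p\<mu>c \<gamma> (k+1) (T (- \<theta>o \<gamma> k) \<eta>) + p\<nu> \<gamma> (k+1) \<delta>"

definition stage_derivative where
  "stage_derivative \<gamma> Gs X V k = dt D * ((\<Sum>i\<in>St.
     rkB D i * vector_derivative (\<lambda>\<epsilon>. l (X k i \<epsilon>, V k i \<epsilon>)) (at 0)
     + (1 / dt D) * s\<mu> \<gamma> k i (T (- \<theta>i \<gamma> k i) (lvel G (Gs k i) 0))
     - s\<mu> \<gamma> k i (rk_inner D (\<lambda>j. vector_derivative (X k j) (at 0)) i)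
     + (1 / dt D) * s\<nu> \<gamma> k i (vector_derivative (X k i) (at 0))
     - s\<nu> \<gamma> k i (rk_inner D (\<lambda>j. vector_derivative (V k j) (at 0)) i))
   - p\<mu>c \<gamma> (k+1) (rk_outer D (\<lambda>j. vector_derivative (X k j) (at 0)))
   - p\<nu> \<gamma> (k+1) (rk_outer D (\<lambda>j. vector_derivative (V k j) (at 0))))"

text \<open>The relations are assumed at parameter 0 only, where they put the arguments of
  \<open>\<sigma>\<close> into the form required by \<open>sigma_derivative\<close>. The formula
  therefore also covers curves that leave the reconstructed paths.\<close>

lemma functional_derivative:
  assumes g: "\<And>k. k \<le> N \<Longrightarrow> plot (mfd G) (g k) 0" "\<And>k. k \<le> N \<Longrightarrow> smooth_at (x k) 0"
    and s: "\<And>k i. k < N \<Longrightarrow> i \<in> St \<Longrightarrow> plot (mfd G) (Gs k i) 0"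
      "\<And>k i. k < N \<Longrightarrow> i \<in> St \<Longrightarrow> smooth_at (X k i) 0" "\<And>k i. k < N \<Longrightarrow> i \<in> St \<Longrightarrow> smooth_at (V k i) 0"
    and U: "\<And>k. k < N \<Longrightarrow> \<theta>o \<gamma> k \<in> tdom D" "\<And>k i. k < N \<Longrightarrow> i \<in> St \<Longrightarrow> \<theta>i \<gamma> k i \<in> tdom D"
    and rec: "\<And>k. k < N \<Longrightarrow> g (k+1) 0 = g k 0 \<otimes> tau D (\<theta>o \<gamma> k)"
      "\<And>k i. k < N \<Longrightarrow> i \<in> St \<Longrightarrow> Gs k i 0 = g k 0 \<otimes> tau D (\<theta>i \<gamma> k i)"
  shows "((\<lambda>\<epsilon>. hohp_functional G D l (vary \<gamma> g x Gs X V \<epsilon>)) has_vector_derivative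
    (\<Sum>k<N. stage_derivative \<gamma> Gs X V k
       - out_momentum \<gamma> k (lvel G (g k) 0) (vector_derivative (x k) (at 0))
       + in_momentum \<gamma> k (lvel G (g (k+1)) 0) (vector_derivative (x (k+1)) (at 0)))) (at 0)"
proof -
  let ?h = "dt D" and ?d = "\<lambda>f. vector_derivative f (at (0::real))"
  have bl: "((\<lambda>\<epsilon>. blinfun_apply m (f \<epsilon>)) has_vector_derivative blinfun_apply m f') (at 0)"
    if "(f has_vector_derivative f') (at 0)" for m :: "'v \<Rightarrow>\<^sub>L real" and f f'
    by (rule bounded_linear.has_vector_derivative[OF blinfun.bounded_linear_right that])
  have sc: "((\<lambda>\<epsilon>. r *\<^sub>R f \<epsilon>) has_vector_derivative r *\<^sub>R f') (at 0)"
    if "(f has_vector_derivative f') (at 0)" for r and f :: "real \<Rightarrow> 'v" and f'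
    by (rule bounded_linear.has_vector_derivative[OF bounded_linear_scaleR_right that])
  \<comment> \<open>\<open>l\<close> is only differentiable, so its terms enter with an unevaluated
    derivative.\<close>
  have dl: "((\<lambda>\<epsilon>. l (X k i \<epsilon>, V k i \<epsilon>)) has_vector_derivative ?d (\<lambda>\<epsilon>. l (X k i \<epsilon>, V k i \<epsilon>))) (at 0)"
    if "k < N" "i \<in> St" for k i
  proof -
    have "(\<lambda>\<epsilon>. (X k i \<epsilon>, V k i \<epsilon>)) differentiable (at 0)"
      by (rule smooth_at_differentiable[OF smooth_at_Pair[OF s(2,3)[OF that]]])
    moreover have "l differentiable (at z)" for z
      using l_diff unfolding differentiable_on_def by blast
    ultimately have "(\<lambda>\<epsilon>. l (X k i \<epsilon>, V k i \<epsilon>)) differentiable (at 0)"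
      using differentiable_chain_at[of "\<lambda>\<epsilon>. (X k i \<epsilon>, V k i \<epsilon>)" 0 l] by (simp add: o_def)
    then show ?thesis using vector_derivative_works by blast
  qed
  define S' where "S' k = (\<Sum>i=1..nstages D. rkB D i * ?d (\<lambda>\<epsilon>. l (X k i \<epsilon>, V k i \<epsilon>))
        + s\<mu> \<gamma> k i ((1 / ?h) *\<^sub>R (T (- \<theta>i \<gamma> k i) (lvel G (Gs k i) 0) - T (\<theta>i \<gamma> k i) (lvel G (g k) 0))
             - rk_inner D (\<lambda>j. ?d (X k j)) i)
        + s\<nu> \<gamma> k i ((1 / ?h) *\<^sub>R (?d (X k i) - ?d (x k)) - rk_inner D (\<lambda>j. ?d (V k j)) i))
     + p\<mu>c \<gamma> (k+1) ((1 / ?h) *\<^sub>R (T (- \<theta>o \<gamma> k) (lvel G (g (k+1)) 0) - T (\<theta>o \<gamma> k) (lvel G (g k) 0))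
             - rk_outer D (\<lambda>j. ?d (X k j)))
     + p\<nu> \<gamma> (k+1) ((1 / ?h) *\<^sub>R (?d (x (k+1)) - ?d (x k)) - rk_outer D (\<lambda>j. ?d (V k j)))" for k
  have "((\<lambda>\<epsilon>. hohp_functional G D l (vary \<gamma> g x Gs X V \<epsilon>)) has_vector_derivative ?h * (\<Sum>k<N. S' k)) (at 0)"
  proof -
    have eq: "hohp_functional G D l (vary \<gamma> g x Gs X V \<epsilon>) = ?h * (\<Sum>k<N.
     (\<Sum>i=1..nstages D. rkB D i * l (X k i \<epsilon>, V k i \<epsilon>)
        + s\<mu> \<gamma> k i ((1 / ?h) *\<^sub>R \<sigma> (inv (g k \<epsilon>) \<otimes> Gs k i \<epsilon>) - rk_inner D (\<lambda>j. X k j \<epsilon>) i)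
        + s\<nu> \<gamma> k i ((1 / ?h) *\<^sub>R (X k i \<epsilon> - x k \<epsilon>) - rk_inner D (\<lambda>j. V k j \<epsilon>) i))
     + p\<mu>c \<gamma> (k+1) ((1 / ?h) *\<^sub>R \<sigma> (inv (g k \<epsilon>) \<otimes> g (k+1) \<epsilon>) - rk_outer D (\<lambda>j. X k j \<epsilon>))
     + p\<nu> \<gamma> (k+1) ((1 / ?h) *\<^sub>R (x (k+1) \<epsilon> - x k \<epsilon>) - rk_outer D (\<lambda>j. V k j \<epsilon>)))" for \<epsilon>
      by (simp add: hohp_functional_def vary_def tau_inv_sigma)
    note sv = smooth_at_has_vector_derivative
    show ?thesis
      unfolding eq S'_def
    proof (intro bounded_linear.has_vector_derivative[OF bounded_linear_mult_right] has_vector_derivative_sum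
        has_vector_derivative_add bl has_vector_derivative_diff sc, goal_cases)
      case (1 k i) then show ?case using dl by simp
    next
      case (2 k i) then show ?case by (intro sigma_derivative s g U rec) auto
    next
      case (3 k i) then show ?case by (intro rk_inner_has_vector_derivative sv s) auto
    next
      case (4 k i) then show ?case by (intro sv s) auto
    next
      case (5 k i) then show ?case by (intro sv g) auto
    next
      case (6 k i) then show ?case by (intro rk_inner_has_vector_derivative sv s) auto
    next
      case (7 k) then show ?case by (intro sigma_derivative g U rec) auto
    next
      case (8 k) then show ?case by (intro rk_outer_has_vector_derivative sv s) auto
    next
      case (9 k) then show ?case by (intro sv g) auto
    next
      case (10 k) then show ?case by (intro sv g) auto
    next
      case (11 k) then show ?case by (intro rk_outer_has_vector_derivative sv s) auto
    qed
  qed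
  moreover have "?h * (\<Sum>k<N. S' k) = (\<Sum>k<N. stage_derivative \<gamma> Gs X V k
       - out_momentum \<gamma> k (lvel G (g k) 0) (?d (x k)) + in_momentum \<gamma> k (lvel G (g (k+1)) 0) (?d (x (k+1))))"
    unfolding sum_distrib_left
  proof (intro sum.cong refl)
    fix k
    \<comment> \<open>Keeping the reciprocal of the time step atomic lets the terms be sorted by
      node velocity before the outer factor \<open>?h\<close> cancels it.\<close>
    define r where "r = 1 / ?h"
    have hr: "?h * (r * c) = c" for c using dt_pos by (simp add: r_def)
    have *: "(\<Sum>i\<in>St. P i - r * Q i - r * R i) = sum P St - r * (sum Q St + sum R St)" for P Q R
      by (simp add: sum_subtractf sum_distrib_left distrib_left)
    have "S' k = (\<Sum>i\<in>St. (rkB D i * ?d (\<lambda>\<epsilon>. l (X k i \<epsilon>, V k i \<epsilon>))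
         + r * s\<mu> \<gamma> k i (T (- \<theta>i \<gamma> k i) (lvel G (Gs k i) 0)) - s\<mu> \<gamma> k i (rk_inner D (\<lambda>j. ?d (X k j)) i)
         + r * s\<nu> \<gamma> k i (?d (X k i)) - s\<nu> \<gamma> k i (rk_inner D (\<lambda>j. ?d (V k j)) i))
         - r * s\<mu> \<gamma> k i (T (\<theta>i \<gamma> k i) (lvel G (g k) 0)) - r * s\<nu> \<gamma> k i (?d (x k)))
       + (r * p\<mu>c \<gamma> (k+1) (T (- \<theta>o \<gamma> k) (lvel G (g (k+1)) 0)) - r * p\<mu>c \<gamma> (k+1) (T (\<theta>o \<gamma> k) (lvel G (g k) 0))
          - p\<mu>c \<gamma> (k+1) (rk_outer D (\<lambda>j. ?d (X k j))))
       + (r * p\<nu> \<gamma> (k+1) (?d (x (k+1))) - r * p\<nu> \<gamma> (k+1) (?d (x k)) - p\<nu> \<gamma> (k+1) (rk_outer D (\<lambda>j. ?d (V k j))))"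
      unfolding S'_def r_def[symmetric]
      by (intro arg_cong2[where f="(+)"] sum.cong refl)
        (simp_all add: blinfun.diff_right blinfun.scaleR_right right_diff_distrib)
    then show "?h * S' k = stage_derivative \<gamma> Gs X V k
       - out_momentum \<gamma> k (lvel G (g k) 0) (?d (x k)) + in_momentum \<gamma> k (lvel G (g (k+1)) 0) (?d (x (k+1)))"
      unfolding * stage_derivative_def out_momentum_def in_momentum_def r_def[symmetric]
      by (simp add: distrib_left right_diff_distrib hr)
  qed
  ultimately show ?thesis by simp
qed

end

context lie_grp
begin

lemma lvel_const: "g \<in> carrier G \<Longrightarrow> lvel G (\<lambda>_. g) t = 0"
  by (simp add: lvel_def)

lemma lvel_cong:
  assumes "\<forall>\<^sub>F s in nhds t. c s = d s" shows "lvel G c t = lvel G d t"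
  unfolding lvel_def
  by (rule vector_derivative_cong_eq)
    (use assms eventually_nhds_x_imp_x[OF assms] in \<open>auto elim: eventually_mono\<close>)

end

section \<open>Boundary momenta and the outer equations of a solution\<close>

context hohp
begin

lemma dtau_inv_dual_apply:
  assumes "\<theta> \<in> tdom D" shows "dtau_inv_dual G (tau D) \<theta> \<mu> \<eta> = \<mu> (T \<theta> \<eta>)"
  unfolding dtau_inv_dual_def
  by (subst bounded_linear_Blinfun_apply)
    (auto intro: bounded_linear_compose[OF blinfun.bounded_linear_right bounded_linear_T[OF assms]])

text \<open>The first node occurs in the node terms and in every stage term of step 0. The sums that
  define \<mu>_0 and \<nu>_0 collect exactly these coefficients, dualised.\<close>

lemma momentum_map_initial_state:
  assumes "\<theta>o \<gamma> 0 \<in> tdom D" "\<And>i. i \<in> St \<Longrightarrow> \<theta>i \<gamma> 0 i \<in> tdom D"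
  shows "momentum_map G expH \<Phi> (hohp_state G D \<gamma> 0) \<zeta> =
    (case TG_generator G expH \<Phi> \<zeta> (pg \<gamma> 0, p\<xi> \<gamma> 0) of (\<eta>, \<delta>) \<Rightarrow> out_momentum \<gamma> 0 \<eta> \<delta>)"
  using assms
  by (simp add: momentum_map_def hohp_state_def out_momentum_def dtau_inv_dual_apply split_def Let_def
    blinfun.add_left blinfun.sum_left)

text \<open>The last node occurs only in the node terms of step \<open>N - 1\<close>, so no stage
  multipliers enter. The bound \<open>N \<ge> 1\<close> selects the second branch of
  \<open>hohp_state\<close>.\<close>

lemma momentum_map_final_state:
  assumes "\<theta>o \<gamma> (N - 1) \<in> tdom D"
  shows "momentum_map G expH \<Phi> (hohp_state G D \<gamma> N) \<zeta> =
    (case TG_generator G expH \<Phi> \<zeta> (pg \<gamma> N, p\<xi> \<gamma> N) of (\<eta>, \<delta>) \<Rightarrow> in_momentum \<gamma> (N - 1) \<eta> \<delta>)"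
  using dtau_inv_dual_apply[OF minus_U[OF assms]] nsteps_pos
  by (simp add: momentum_map_def hohp_state_def in_momentum_def split_def Let_def)

lemma solution_discrete_path:
  assumes "hohp_solution G D l \<gamma>"
  shows "\<And>k. k \<le> N \<Longrightarrow> pg \<gamma> k \<in> carrier G"
    "\<And>k. k < N \<Longrightarrow> inv (pg \<gamma> k) \<otimes> pg \<gamma> (k+1) \<in> tau D ` tdom D"
    "\<And>k i. k < N \<Longrightarrow> i \<in> St \<Longrightarrow> sG \<gamma> k i \<in> carrier G"
  using assms unfolding hohp_solution_def discrete_path_def by simp_all

lemma smooth_curve_const: "g \<in> carrier G \<Longrightarrow> smooth_curve (mfd G) (\<lambda>_. g)"
  by (rule plot_smooth_curve[OF manifold_G plot_group_const])

text \<open>Only the multipliers with index \<open>k + 1\<close> are moved, in the directions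
  \<open>\<phi>\<close> and \<open>\<psi>\<close>. The functional is affine along this curve, with
  slope \<open>dt D\<close> times the left-hand side. The case \<open>k + 1 = N\<close> is
  admissible, because fixed ends constrain nodes and not multipliers.\<close>

lemma solution_outer_residuals:
  fixes \<phi> \<psi> :: "'v \<Rightarrow>\<^sub>L real"
  assumes sol: "hohp_solution G D l \<gamma>" and k: "k < N"
  shows "\<phi> ((1 / dt D) *\<^sub>R \<sigma> (inv (pg \<gamma> k) \<otimes> pg \<gamma> (k+1)) - rk_outer D (s\<Xi> \<gamma> k))
     + \<psi> ((1 / dt D) *\<^sub>R (p\<xi> \<gamma> (k+1) - p\<xi> \<gamma> k) - rk_outer D (sV \<gamma> k)) = 0"
    (is "blinfun_apply \<phi> ?E + blinfun_apply \<psi> ?F = 0")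
proof -
  note dp = solution_discrete_path[OF sol]
  define \<Gamma> where "\<Gamma> \<epsilon> = \<gamma>\<lparr>p\<mu>c := \<lambda>j. p\<mu>c \<gamma> j + (if j = k + 1 then \<epsilon> *\<^sub>R \<phi> else 0),
     p\<nu> := \<lambda>j. p\<nu> \<gamma> j + (if j = k + 1 then \<epsilon> *\<^sub>R \<psi> else 0)\<rparr>" for \<epsilon>
  have sm: "smooth_curve vec_mfd (\<lambda>\<epsilon>. c + (if b then \<epsilon> *\<^sub>R d else 0))" for b and c d :: "'v \<Rightarrow>\<^sub>L real"
    by (rule smooth_at_smooth_curve_vec)
      (cases b; simp add: smooth_at_const smooth_at_add smooth_at_scaleR smooth_at_ident)
  have "\<Gamma> 0 = \<gamma>" by (cases \<gamma>) (simp add: \<Gamma>_def cong: if_cong)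
  have sel: "pg (\<Gamma> \<epsilon>) = pg \<gamma>" "p\<xi> (\<Gamma> \<epsilon>) = p\<xi> \<gamma>" "sG (\<Gamma> \<epsilon>) = sG \<gamma>" "s\<Xi> (\<Gamma> \<epsilon>) = s\<Xi> \<gamma>" "sV (\<Gamma> \<epsilon>) = sV \<gamma>"
    "s\<mu> (\<Gamma> \<epsilon>) = s\<mu> \<gamma>" "s\<nu> (\<Gamma> \<epsilon>) = s\<nu> \<gamma>" "p\<mu>c (\<Gamma> \<epsilon>) = (\<lambda>j. p\<mu>c \<gamma> j + (if j = k + 1 then \<epsilon> *\<^sub>R \<phi> else 0))"
    "p\<nu> (\<Gamma> \<epsilon>) = (\<lambda>j. p\<nu> \<gamma> j + (if j = k + 1 then \<epsilon> *\<^sub>R \<psi> else 0))" for \<epsilon>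
    by (simp_all add: \<Gamma>_def)
  from \<open>\<Gamma> 0 = \<gamma>\<close> have "fixed_end_variation G D \<gamma> \<Gamma>"
    unfolding fixed_end_variation_def
    using dp by (simp add: sel sm smooth_at_smooth_curve_vec smooth_at_const smooth_curve_const lvel_const)
  then have d0: "((\<lambda>\<epsilon>. hohp_functional G D l (\<Gamma> \<epsilon>)) has_real_derivative 0) (at 0)"
    using sol unfolding hohp_solution_def by blast
  \<comment> \<open>The multipliers with index \<open>k + 1\<close> stand in summand
    \<open>k\<close>, hence the test \<open>j = k\<close>.\<close>
  have *: "(\<Sum>j<N. A j + (a j + (if j = k then \<epsilon> * c j else 0)) + (b j + (if j = k then \<epsilon> * d j else 0)))
     = (\<Sum>j<N. A j + a j + b j) + \<epsilon> * (c k + d k)" for A a b c d :: "nat \<Rightarrow> real" and \<epsilon>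
    using k by (simp add: sum.distrib distrib_left)
  have ap: "blinfun_apply (m + (if b then \<epsilon> *\<^sub>R d else 0)) v = m v + (if b then \<epsilon> * d v else 0)"
    for m d :: "'v \<Rightarrow>\<^sub>L real" and b v \<epsilon>
    by (simp add: blinfun.add_left blinfun.scaleR_left)
  have "hohp_functional G D l (\<Gamma> \<epsilon>) = hohp_functional G D l \<gamma> + \<epsilon> * (dt D * (\<phi> ?E + \<psi> ?F))" for \<epsilon>
    unfolding hohp_functional_def tau_inv_sigma sel
    by (simp only: ap add_right_cancel *) (simp add: algebra_simps)
  then have "((\<lambda>\<epsilon>. hohp_functional G D l (\<Gamma> \<epsilon>)) has_real_derivative dt D * (\<phi> ?E + \<psi> ?F)) (at 0)"
    by (auto intro!: derivative_eq_intros)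
  from DERIV_unique[OF this d0] show ?thesis using dt_pos by simp
qed

text \<open>Setting one test functional to 0 isolates each residual. The group relation is then
  recovered by applying \<open>tau D\<close> to \<open>\<sigma>\<close>, legitimate since a discrete
  path keeps the argument of \<open>\<sigma>\<close> in its domain.\<close>

lemma solution_outer_reconstruction:
  assumes sol: "hohp_solution G D l \<gamma>" and k: "k < N"
  shows "\<theta>o \<gamma> k \<in> tdom D" "pg \<gamma> (k+1) = pg \<gamma> k \<otimes> tau D (\<theta>o \<gamma> k)"
    "p\<xi> \<gamma> (k+1) = p\<xi> \<gamma> k + dt D *\<^sub>R rk_outer D (sV \<gamma> k)"
proof -
  note dp = solution_discrete_path[OF sol]
  note R = solution_outer_residuals[OF sol k]
  have "(1 / dt D) *\<^sub>R \<sigma> (inv (pg \<gamma> k) \<otimes> pg \<gamma> (k+1)) - rk_outer D (s\<Xi> \<gamma> k) = 0"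
    by (rule finite_dim_dual_separates[OF finite_dim_G]) (use R[where \<psi>=0] in simp)
  then have "\<theta>o \<gamma> k = dt D *\<^sub>R (1 / dt D) *\<^sub>R \<sigma> (inv (pg \<gamma> k) \<otimes> pg \<gamma> (k+1))" by simp
  then have \<theta>: "\<theta>o \<gamma> k = \<sigma> (inv (pg \<gamma> k) \<otimes> pg \<gamma> (k+1))" using dt_pos by simp
  then show "\<theta>o \<gamma> k \<in> tdom D"
    using the_inv_into_into[OF inj_tau dp(2)[OF k] subset_refl] by simp
  have "tau D (\<theta>o \<gamma> k) = inv (pg \<gamma> k) \<otimes> pg \<gamma> (k+1)"
    unfolding \<theta> by (rule f_the_inv_into_f[OF inj_tau dp(2)[OF k]])
  then show "pg \<gamma> (k+1) = pg \<gamma> k \<otimes> tau D (\<theta>o \<gamma> k)"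
    using dp(1)[of k] dp(1)[of "k+1"] k by (simp add: m_assoc[symmetric])
  have "(1 / dt D) *\<^sub>R (p\<xi> \<gamma> (k+1) - p\<xi> \<gamma> k) - rk_outer D (sV \<gamma> k) = 0"
    by (rule finite_dim_dual_separates[OF finite_dim_G]) (use R[where \<phi>=0] in simp)
  then have "dt D *\<^sub>R rk_outer D (sV \<gamma> k) = dt D *\<^sub>R (1 / dt D) *\<^sub>R (p\<xi> \<gamma> (k+1) - p\<xi> \<gamma> k)" by simp
  then show "p\<xi> \<gamma> (k+1) = p\<xi> \<gamma> k + dt D *\<^sub>R rk_outer D (sV \<gamma> k)" using dt_pos by simp
qed

end

section \<open>The group action and its first- and second-order lifts\<close>

locale lie_action = lie_grp G for G :: "('g, 'v::real_normed_vector) lie" (structure) +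
  fixes H :: "('h, 'w::real_normed_vector) lie" and \<Phi> :: "'h \<Rightarrow> 'g \<Rightarrow> 'g" and expH :: "'w \<Rightarrow> 'h"
  assumes lie_H: "lie_group H" and exp: "exponential_map H expH" and act: "smooth_action H G \<Phi>"
begin

sublocale H: lie_grp H
  by unfold_locales (rule lie_H)

lemma plot_exp: "plot (mfd H) (\<lambda>t. expH (t *\<^sub>R \<zeta>)) t"
proof -
  have "smooth_map vec_mfd (mfd H) (\<lambda>t::real. expH (t *\<^sub>R \<zeta>))"
    using exp unfolding exponential_map_def by blast
  from plot_smooth_map[OF charted_vec[OF finite_dim_euclidean] H.charted_G _ this, of "\<lambda>t. t" t]
  show ?thesis by (simp add: plot_vec smooth_at_ident)
qed

lemma exp_carrier: "expH \<zeta> \<in> carrier H"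
  using H.plot_carrier[OF plot_exp[of \<zeta> 1]] by simp

lemma exp_zero: "expH 0 = \<one>\<^bsub>H\<^esub>"
proof -
  have "\<forall>\<zeta> s t. expH ((s + t) *\<^sub>R \<zeta>) = expH (s *\<^sub>R \<zeta>) \<otimes>\<^bsub>H\<^esub> expH (t *\<^sub>R \<zeta>)"
    using exp unfolding exponential_map_def by blast
  from this[rule_format, of 0 0 0] have "expH 0 \<otimes>\<^bsub>H\<^esub> expH 0 = expH 0" by simp
  then show ?thesis using exp_carrier[of 0] by (simp add: H.l_cancel_one)
qed

lemma action_one: "g \<in> carrier G \<Longrightarrow> \<Phi> \<one>\<^bsub>H\<^esub> g = g"
  using act group_action.id_eq_one[of H "carrier G" \<Phi>] unfolding smooth_action_def by (metis restrict_apply')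

lemma plot_action:
  "plot (mfd H) k x \<Longrightarrow> plot (mfd G) g x \<Longrightarrow> plot (mfd G) (\<lambda>y. \<Phi> (k y) (g y)) x"
  using plot_smooth_map[OF charted_prod[OF H.charted_G charted_G] charted_G plot_Pair, of k x g "\<lambda>(k, g). \<Phi> k g"]
    act unfolding smooth_action_def by simp

definition flow :: "'w \<Rightarrow> real \<Rightarrow> 'g \<Rightarrow> 'g" where "flow \<zeta> \<epsilon> = \<Phi> (expH (\<epsilon> *\<^sub>R \<zeta>))"

lemma flow_zero: "g \<in> carrier G \<Longrightarrow> flow \<zeta> 0 g = g"
  by (simp add: flow_def exp_zero action_one)

lemma plot_flow:
  assumes "smooth_at a x" "plot (mfd G) g x" shows "plot (mfd G) (\<lambda>y. flow \<zeta> (a y) (g y)) x"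
  unfolding flow_def by (rule plot_action[OF plot_compose[OF finite_dim_euclidean plot_exp assms(1)] assms(2)])

lemma Tmap_flow_zero:
  assumes g: "g \<in> carrier G" shows "Tmap G (flow \<zeta> 0) (g, \<xi>) = (g, \<xi>)"
proof -
  have "\<forall>\<^sub>F x in nhds e0. x = e (inv (flow \<zeta> 0 g) \<otimes> flow \<zeta> 0 (g \<otimes> ei x))"
  proof (rule eventually_mono[OF eventually_e_image])
    fix x assume x: "x \<in> e ` E"
    then have "ei x \<in> carrier G" using E_carrier by (auto simp: ei_e)
    then show "x = e (inv (flow \<zeta> 0 g) \<otimes> flow \<zeta> 0 (g \<otimes> ei x))"
      using g x by (simp add: flow_zero m_assoc[symmetric] e_ei)
  qed (use one_in_E in blast)
  then obtain S where "open S" "e0 \<in> S" "\<And>x. x \<in> S \<Longrightarrow> x = e (inv (flow \<zeta> 0 g) \<otimes> flow \<zeta> 0 (g \<otimes> ei x))"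
    unfolding eventually_nhds by blast
  from frechet_derivative_at[OF has_derivative_transform_within_open[OF has_derivative_ident this], symmetric]
  show ?thesis using g by (simp add: Tmap_def flow_zero)
qed

text \<open>The lift is the partial derivative at \<open>e0\<close> of a map that is jointly smooth
  in the group parameter and the chart variable.\<close>

lemma smooth_at_Tmap_flow:
  assumes g: "g \<in> carrier G" shows "smooth_at (\<lambda>\<epsilon>. snd (Tmap G (flow \<zeta> \<epsilon>) (g, \<xi>))) 0"
proof -
  let ?W = "\<lambda>z. e (inv (flow \<zeta> (fst z) g) \<otimes> flow \<zeta> (fst z) (g \<otimes> ei (snd z)))"
  have "plot (mfd G) (\<lambda>z. inv (flow \<zeta> (fst z) g) \<otimes> flow \<zeta> (fst z) (g \<otimes> ei (snd z))) (0, e0)"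
    by (intro plot_mult plot_inv plot_flow plot_group_const plot_ei_compose smooth_at_fst smooth_at_snd smooth_at_ident g)
      simp
  then have "smooth_at ?W (0, e0)"
    by (rule smooth_at_e) (use g one_in_E in \<open>simp add: flow_zero\<close>)
  note D = smooth_at_partial_derivative[OF this, of \<xi>]
  have "smooth_at (\<lambda>\<epsilon>. (\<epsilon>, e0)) (0::real)" by (intro smooth_at_intros)
  then have "smooth_at (\<lambda>\<epsilon>. (\<lambda>z. frechet_derivative (\<lambda>y. ?W (fst z, y)) (at (snd z)) \<xi>) (\<epsilon>, e0)) 0"
    by (rule smooth_at_compose[OF finite_dim_prod[OF finite_dim_euclidean finite_dim_G], rotated]) (rule D)
  then show ?thesis by (simp add: Tmap_def)
qed

text \<open>The curve chosen inside \<open>T2map\<close> depends on the triple only, not on the flow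
  parameter. With this curve \<open>c\<close> fixed, all four claims concern the jets of the single
  two-parameter map \<open>flow \<zeta> \<epsilon> (c t)\<close>.\<close>

lemma T2map_flow:
  assumes g: "g \<in> carrier G"
  shows fst_T2map_flow: "fst (T2map G (flow \<zeta> \<epsilon>) (g, z)) = flow \<zeta> \<epsilon> g"
    and smooth_at_T2map_flow: "smooth_at (\<lambda>\<epsilon>. snd (T2map G (flow \<zeta> \<epsilon>) (g, z))) 0"
    and T2map_flow_zero: "T2map G (flow \<zeta> 0) (g, z) = (g, z)"
    and reduced_lagrangian_T2map_flow: "reduced_lagrangian G L l \<Longrightarrow> lagrangian_invariant H G L \<Phi> \<Longrightarrow>
      l (snd (T2map G (flow \<zeta> \<epsilon>) (g, z))) = l z"
proof -
  define c where "c = (SOME c. smooth_curve (mfd G) c \<and> ltriv2 G c = (g, z))"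
  \<comment> \<open>Without a curve realising the triple the choice in \<open>T2map\<close> would be
    arbitrary.\<close>
  have "\<exists>c. smooth_curve (mfd G) c \<and> ltriv2 G c = (g, z)" using ltriv2_surj[OF g, of "fst z" "snd z"] by simp
  then have c: "smooth_curve (mfd G) c" "ltriv2 G c = (g, z)" unfolding c_def by (metis (mono_tags, lifting) someI_ex)+
  have c0: "c 0 = g" using c(2) by (simp add: ltriv2_def)
  have pc: "plot (mfd G) c 0" by (rule smooth_curve_plot[OF charted_G c(1)])
  have T: "T2map G (flow \<zeta> \<epsilon>) (g, z) = ltriv2 G (flow \<zeta> \<epsilon> \<circ> c)" for \<epsilon>
    unfolding T2map_def c_def ..
  show "fst (T2map G (flow \<zeta> \<epsilon>) (g, z)) = flow \<zeta> \<epsilon> g" by (simp add: T ltriv2_def c0)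
  have "plot (mfd G) (\<lambda>y. c (snd y)) (0::real, 0)"
    by (rule plot_compose[OF finite_dim_euclidean]) (use pc in \<open>simp_all add: smooth_at_snd smooth_at_ident\<close>)
  then have "plot (mfd G) (\<lambda>y. flow \<zeta> (fst y) (c (snd y))) (0, 0)"
    by (intro plot_flow smooth_at_fst smooth_at_ident)
  from smooth_at_ltriv2_family[OF finite_dim_euclidean this]
  show "smooth_at (\<lambda>\<epsilon>. snd (T2map G (flow \<zeta> \<epsilon>) (g, z))) 0" by (simp add: T o_def)
  have "ltriv2 G (flow \<zeta> 0 \<circ> c) = ltriv2 G c"
    by (rule ltriv2_cong) (use plot_eventually_carrier[OF pc] in eventually_elim, simp add: flow_zero)
  then show "T2map G (flow \<zeta> 0) (g, z) = (g, z)" by (simp add: T c(2))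
  assume L: "reduced_lagrangian G L l" "lagrangian_invariant H G L \<Phi>"
  have "plot (mfd G) (\<lambda>t. flow \<zeta> \<epsilon> (c t)) 0" by (rule plot_flow[OF smooth_at_const pc])
  then have s: "smooth_curve (mfd G) (flow \<zeta> \<epsilon> \<circ> c)" using plot_smooth_curve[OF manifold_G] by (simp add: o_def)
  \<comment> \<open>Invariance is stated for jets, hence the detour from \<open>l\<close> to
    \<open>L\<close> along the moved curve and back along \<open>c\<close>.\<close>
  have "l (snd (ltriv2 G (flow \<zeta> \<epsilon> \<circ> c))) = L (jet2 (mfd G) (flow \<zeta> \<epsilon> \<circ> c))"
    using L(1) s unfolding reduced_lagrangian_def by simp
  also have "\<dots> = L (jet2 (mfd G) c)"
    using L(2) exp_carrier c(1) unfolding lagrangian_invariant_def flow_def by blast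
  also have "\<dots> = l z" using L(1) c unfolding reduced_lagrangian_def by simp
  finally show "l (snd (T2map G (flow \<zeta> \<epsilon>) (g, z))) = l z" by (simp add: T)
qed

end

section \<open>Conservation of momentum\<close>

locale hohp_action = hohp G D l + lie_action G H \<Phi> expH
  for G :: "('g, 'v::real_normed_vector) lie" (structure) and D :: "('g, 'v) scheme" and l :: "'v \<times> 'v \<Rightarrow> real"
    and H :: "('h, 'w::real_normed_vector) lie" and \<Phi> :: "'h \<Rightarrow> 'g \<Rightarrow> 'g" and expH :: "'w \<Rightarrow> 'h"
begin

lemma momentum_conserved:
  assumes sol: "hohp_solution G D l \<gamma>" and L: "reduced_lagrangian G L l" "lagrangian_invariant H G L \<Phi>"
    and rp: "reconstruction_preserved G D expH \<Phi> \<gamma>"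
  shows "momentum_map G expH \<Phi> (hohp_state G D \<gamma> N) \<zeta> = momentum_map G expH \<Phi> (hohp_state G D \<gamma> 0) \<zeta>"
proof -
  let ?d = "\<lambda>f. vector_derivative f (at (0::real))"
  note dp = solution_discrete_path[OF sol] and outer = solution_outer_reconstruction[OF sol]
  define W where "W \<epsilon> k i = T2map G (flow \<zeta> \<epsilon>) (sG \<gamma> k i, s\<Xi> \<gamma> k i, sV \<gamma> k i)" for \<epsilon> k i
  \<comment> \<open>Outside the index ranges the original entries are kept: an admissible variation
    must pass through \<open>\<gamma>\<close> itself, as an equality of records.\<close>
  define Gs where "Gs k i \<epsilon> = (if k < N \<and> i \<in> St then fst (W \<epsilon> k i) else sG \<gamma> k i)" for k i \<epsilon>
  define X where "X k i \<epsilon> = (if k < N \<and> i \<in> St then fst (snd (W \<epsilon> k i)) else s\<Xi> \<gamma> k i)" for k i \<epsilon>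
  define V where "V k i \<epsilon> = (if k < N \<and> i \<in> St then snd (snd (W \<epsilon> k i)) else sV \<gamma> k i)" for k i \<epsilon>
  \<comment> \<open>The nodes supplied by the hypothesis are chosen separately for each parameter
    value and carry no smoothness. Reading the outer relations as a recursion from the moved initial
    node gives smooth ones.\<close>
  define g where "g = rec_nat (\<lambda>\<epsilon>. fst (Tmap G (flow \<zeta> \<epsilon>) (pg \<gamma> 0, p\<xi> \<gamma> 0)))
    (\<lambda>k f \<epsilon>. f \<epsilon> \<otimes> tau D (dt D *\<^sub>R rk_outer D (\<lambda>j. X k j \<epsilon>)))"
  define x where "x = rec_nat (\<lambda>\<epsilon>. snd (Tmap G (flow \<zeta> \<epsilon>) (pg \<gamma> 0, p\<xi> \<gamma> 0)))
    (\<lambda>k f \<epsilon>. f \<epsilon> + dt D *\<^sub>R rk_outer D (\<lambda>j. V k j \<epsilon>))"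
  have g_0: "g 0 = (\<lambda>\<epsilon>. fst (Tmap G (flow \<zeta> \<epsilon>) (pg \<gamma> 0, p\<xi> \<gamma> 0)))"
    and g_Suc: "g (Suc k) = (\<lambda>\<epsilon>. g k \<epsilon> \<otimes> tau D (dt D *\<^sub>R rk_outer D (\<lambda>j. X k j \<epsilon>)))"
    and x_0: "x 0 = (\<lambda>\<epsilon>. snd (Tmap G (flow \<zeta> \<epsilon>) (pg \<gamma> 0, p\<xi> \<gamma> 0)))"
    and x_Suc: "x (Suc k) = (\<lambda>\<epsilon>. x k \<epsilon> + dt D *\<^sub>R rk_outer D (\<lambda>j. V k j \<epsilon>))" for k
    by (simp_all add: g_def x_def)

  have at0: "Gs k i 0 = sG \<gamma> k i" "X k i 0 = s\<Xi> \<gamma> k i" "V k i 0 = sV \<gamma> k i" for k i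
    using T2map_flow_zero[OF dp(3)] by (simp_all add: Gs_def X_def V_def W_def)
  have Gs: "plot (mfd G) (Gs k i) 0" and X: "smooth_at (X k i) 0" and V: "smooth_at (V k i) 0"
    and lW: "l (X k i \<epsilon>, V k i \<epsilon>) = l (s\<Xi> \<gamma> k i, sV \<gamma> k i)"
    if ki: "k < N" "i \<in> St" for k i \<epsilon>
  proof -
    note c = dp(3)[OF ki]
    have "Gs k i = (\<lambda>\<epsilon>. flow \<zeta> \<epsilon> (sG \<gamma> k i))" using ki by (simp add: Gs_def W_def fst_T2map_flow[OF c] fun_eq_iff)
    then show "plot (mfd G) (Gs k i) 0" using plot_flow[OF smooth_at_ident plot_group_const[OF c]] by simp
    have XV: "X k i = (\<lambda>\<epsilon>. fst (snd (W \<epsilon> k i)))" "V k i = (\<lambda>\<epsilon>. snd (snd (W \<epsilon> k i)))"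
      using ki by (simp_all add: X_def V_def fun_eq_iff)
    have "smooth_at (\<lambda>\<epsilon>. snd (W \<epsilon> k i)) 0" unfolding W_def by (rule smooth_at_T2map_flow[OF c])
    then show "smooth_at (X k i) 0" "smooth_at (V k i) 0" unfolding XV by (simp_all add: smooth_at_fst smooth_at_snd)
    show "l (X k i \<epsilon>, V k i \<epsilon>) = l (s\<Xi> \<gamma> k i, sV \<gamma> k i)"
      unfolding XV W_def using reduced_lagrangian_T2map_flow[OF c L] by simp
  qed

  \<comment> \<open>At parameter 0 the recursion returns the nodes of \<open>\<gamma>\<close>,
    because stationarity in the node multipliers enforces the outer relations.\<close>
  have node0: "g k 0 = pg \<gamma> k" "x k 0 = p\<xi> \<gamma> k" if "k \<le> N" for k
    using that by (induction k) (use Tmap_flow_zero[OF dp(1)] outer in \<open>simp_all add: g_0 x_0 g_Suc x_Suc at0\<close>)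
  have smooth: "plot (mfd G) (g k) 0 \<and> smooth_at (x k) 0" if "k \<le> N" for k
    using that
  proof (induction k)
    case 0
    have "pg \<gamma> 0 \<in> carrier G" by (simp add: dp)
    then have "plot (mfd G) (\<lambda>\<epsilon>. flow \<zeta> \<epsilon> (pg \<gamma> 0)) 0" by (intro plot_flow smooth_at_ident plot_group_const)
    then show ?case using smooth_at_Tmap_flow[OF \<open>pg \<gamma> 0 \<in> carrier G\<close>] by (simp add: g_0 x_0 Tmap_def)
  next
    case (Suc k)
    then have k: "k < N" by simp
    have "smooth_at (\<lambda>\<epsilon>. dt D *\<^sub>R rk_outer D (\<lambda>j. X k j \<epsilon>)) 0" "smooth_at (\<lambda>\<epsilon>. dt D *\<^sub>R rk_outer D (\<lambda>j. V k j \<epsilon>)) 0"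
      by (intro smooth_at_scaleR smooth_at_const rk_outer_smooth_at X V k; assumption)+
    then show ?case
      using Suc k outer(1)[OF k] unfolding g_Suc x_Suc
      by (auto intro!: plot_mult plot_tau smooth_at_add simp: at0)
  qed

  define OK where "OK \<epsilon> \<longleftrightarrow> (\<forall>k\<le>N. g k \<epsilon> \<in> carrier G) \<and>
      (\<forall>k<N. \<forall>i\<in>St. X k i \<epsilon> = x k \<epsilon> + dt D *\<^sub>R rk_inner D (\<lambda>j. V k j \<epsilon>) i \<and>
         dt D *\<^sub>R rk_inner D (\<lambda>j. X k j \<epsilon>) i \<in> tdom D \<and>
         Gs k i \<epsilon> = g k \<epsilon> \<otimes> tau D (dt D *\<^sub>R rk_inner D (\<lambda>j. X k j \<epsilon>) i)) \<and>
      (\<forall>k<N. dt D *\<^sub>R rk_outer D (\<lambda>j. X k j \<epsilon>) \<in> tdom D) \<and>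
      (g N \<epsilon>, x N \<epsilon>) = Tmap G (flow \<zeta> \<epsilon>) (pg \<gamma> N, p\<xi> \<gamma> N)" for \<epsilon>
  have "\<forall>\<^sub>F \<epsilon> in nhds 0. \<exists>q. reconstruction G D (W \<epsilon>) q \<and>
      (\<forall>k\<in>{0, N}. q k = Tmap G (flow \<zeta> \<epsilon>) (pg \<gamma> k, p\<xi> \<gamma> k))"
    using rp unfolding reconstruction_preserved_def W_def flow_def by blast
  then have OK: "\<forall>\<^sub>F \<epsilon> in nhds 0. OK \<epsilon>"
  proof eventually_elim
    case (elim \<epsilon>)
    then obtain q where rec: "reconstruction G D (W \<epsilon>) q"
      and ends: "q 0 = Tmap G (flow \<zeta> \<epsilon>) (pg \<gamma> 0, p\<xi> \<gamma> 0)" "q N = Tmap G (flow \<zeta> \<epsilon>) (pg \<gamma> N, p\<xi> \<gamma> N)" by auto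
    have XV: "rk_inner D (\<lambda>i. fst (snd (W \<epsilon> k i))) = rk_inner D (\<lambda>j. X k j \<epsilon>)"
      "rk_outer D (\<lambda>i. fst (snd (W \<epsilon> k i))) = rk_outer D (\<lambda>j. X k j \<epsilon>)"
      "rk_inner D (\<lambda>i. snd (snd (W \<epsilon> k i))) = rk_inner D (\<lambda>j. V k j \<epsilon>)"
      "rk_outer D (\<lambda>i. snd (snd (W \<epsilon> k i))) = rk_outer D (\<lambda>j. V k j \<epsilon>)" if "k < N" for k
      by (intro ext rk_inner_cong rk_outer_cong; use that in \<open>simp add: X_def V_def\<close>)+
    have r1: "fst (q k) \<in> carrier G" if "k \<le> N" for k
      using rec that unfolding reconstruction_def Let_def by blast
    have r2: "fst (snd (W \<epsilon> k i)) = snd (q k) + dt D *\<^sub>R rk_inner D (\<lambda>j. V k j \<epsilon>) i \<and>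
        dt D *\<^sub>R rk_inner D (\<lambda>j. X k j \<epsilon>) i \<in> tdom D \<and>
        fst (W \<epsilon> k i) = fst (q k) \<otimes> tau D (dt D *\<^sub>R rk_inner D (\<lambda>j. X k j \<epsilon>) i)" if "k < N" "i \<in> St" for k i
      using rec that unfolding reconstruction_def Let_def XV[OF that(1), symmetric] by blast
    have r3: "snd (q (k+1)) = snd (q k) + dt D *\<^sub>R rk_outer D (\<lambda>j. V k j \<epsilon>)"
      "dt D *\<^sub>R rk_outer D (\<lambda>j. X k j \<epsilon>) \<in> tdom D"
      "fst (q (k+1)) = fst (q k) \<otimes> tau D (dt D *\<^sub>R rk_outer D (\<lambda>j. X k j \<epsilon>))" if "k < N" for k
      using rec that unfolding reconstruction_def Let_def XV[OF that, symmetric] by blast+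
    \<comment> \<open>The outer relations determine every node from the first, so the unspecified
      \<open>q\<close> coincides with the recursive nodes; in particular the recursion ends at the
      moved last node.\<close>
    have q: "q k = (g k \<epsilon>, x k \<epsilon>)" if "k \<le> N" for k
      using that
    proof (induction k)
      case 0
      show ?case by (simp add: ends g_0 x_0)
    next
      case (Suc k)
      then show ?case using r3[of k] by (simp add: g_Suc x_Suc prod_eq_iff)
    qed
    have st: "X k i \<epsilon> = fst (snd (W \<epsilon> k i))" "Gs k i \<epsilon> = fst (W \<epsilon> k i)" if "k < N" "i \<in> St" for k i
      using that by (simp_all add: X_def Gs_def)
    show ?case
      unfolding OK_def
    proof (intro conjI allI ballI impI)
      show "g k \<epsilon> \<in> carrier G" if "k \<le> N" for k using r1[OF that] q[OF that] by simp
      show "dt D *\<^sub>R rk_outer D (\<lambda>j. X k j \<epsilon>) \<in> tdom D" if "k < N" for k using r3(2)[OF that] .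
      show "(g N \<epsilon>, x N \<epsilon>) = Tmap G (flow \<zeta> \<epsilon>) (pg \<gamma> N, p\<xi> \<gamma> N)" using ends(2) q[of N] by simp
      fix k i assume ki: "k < N" "i \<in> St"
      note r = r2[OF ki] q[OF less_imp_le[OF ki(1)]]
      show "dt D *\<^sub>R rk_inner D (\<lambda>j. X k j \<epsilon>) i \<in> tdom D" using r by blast
      show "X k i \<epsilon> = x k \<epsilon> + dt D *\<^sub>R rk_inner D (\<lambda>j. V k j \<epsilon>) i" unfolding st[OF ki] using r by simp
      show "Gs k i \<epsilon> = g k \<epsilon> \<otimes> tau D (dt D *\<^sub>R rk_inner D (\<lambda>j. X k j \<epsilon>) i)"
        unfolding st(2)[OF ki] using r by simp
    qed
  qed
  \<comment> \<open>The filter \<open>nhds 0\<close> includes 0 itself, where the hypothesis gives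
    the inner relations of \<open>\<gamma>\<close>.\<close>
  note OK0 = eventually_nhds_x_imp_x[OF OK]
  have \<theta>i: "\<theta>i \<gamma> k i \<in> tdom D" and inner0: "sG \<gamma> k i = pg \<gamma> k \<otimes> tau D (\<theta>i \<gamma> k i)" if "k < N" "i \<in> St" for k i
    using OK0 that node0(1)[of k] unfolding OK_def by (simp_all add: at0)

  \<comment> \<open>Frozen from \<open>N\<close> onwards and not only at \<open>N\<close>, so that
    at parameter 0 the entries beyond the last node agree with \<open>\<gamma>\<close> too.\<close>
  define g' where "g' k = (if k = 0 \<or> k \<ge> N then (\<lambda>_. pg \<gamma> k) else g k)" for k
  define x' where "x' k = (if k = 0 \<or> k \<ge> N then (\<lambda>_. p\<xi> \<gamma> k) else x k)" for k
  have node0': "g' k 0 = pg \<gamma> k" "x' k 0 = p\<xi> \<gamma> k" for k using node0[of k] by (auto simp: g'_def x'_def)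
  have smooth': "plot (mfd G) (g' k) 0" "smooth_at (x' k) 0" if "k \<le> N" for k
    using smooth[OF that] dp(1)[OF that] by (simp_all add: g'_def x'_def plot_group_const smooth_at_const)

  let ?D = "\<lambda>g x. \<Sum>k<N. stage_derivative \<gamma> Gs X V k - out_momentum \<gamma> k (lvel G (g k) 0) (?d (x k))
    + in_momentum \<gamma> k (lvel G (g (k+1)) 0) (?d (x (k+1)))"
  have full: "((\<lambda>\<epsilon>. hohp_functional G D l (vary \<gamma> g x Gs X V \<epsilon>)) has_vector_derivative ?D g x) (at 0)"
    by (rule functional_derivative) (use smooth Gs X V \<theta>i inner0 outer node0 in \<open>simp_all add: at0\<close>)
  have frozen: "((\<lambda>\<epsilon>. hohp_functional G D l (vary \<gamma> g' x' Gs X V \<epsilon>)) has_vector_derivative ?D g' x') (at 0)"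
    by (rule functional_derivative) (use smooth' Gs X V \<theta>i inner0 outer node0' in \<open>simp_all add: at0\<close>)

  have "?D g x = 0"
  proof -
    let ?c = "dt D * (\<Sum>k<N. \<Sum>i\<in>St. rkB D i * l (s\<Xi> \<gamma> k i, sV \<gamma> k i))"
    have ev: "\<forall>\<^sub>F \<epsilon> in nhds 0. \<epsilon> \<in> UNIV \<longrightarrow> hohp_functional G D l (vary \<gamma> g x Gs X V \<epsilon>) = ?c"
      using OK
    proof eventually_elim
      case (elim \<epsilon>)
      have \<sigma>: "\<sigma> (inv (g k \<epsilon>) \<otimes> (g k \<epsilon> \<otimes> tau D \<theta>)) = \<theta>" if "k < N" "\<theta> \<in> tdom D" for k \<theta>
        using elim that tau_carrier[OF that(2)] unfolding OK_def by (simp add: m_assoc[symmetric] sigma_tau)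
      have h: "(1 / dt D) *\<^sub>R dt D *\<^sub>R v = v" for v :: 'v using dt_pos by simp
      have inner: "Gs k i \<epsilon> = g k \<epsilon> \<otimes> tau D (dt D *\<^sub>R rk_inner D (\<lambda>j. X k j \<epsilon>) i)"
        "X k i \<epsilon> - x k \<epsilon> = dt D *\<^sub>R rk_inner D (\<lambda>j. V k j \<epsilon>) i"
        "dt D *\<^sub>R rk_inner D (\<lambda>j. X k j \<epsilon>) i \<in> tdom D" if "k < N" "i \<in> St" for k i
        using elim that unfolding OK_def by (metis add_diff_cancel_left')+
      have outer: "dt D *\<^sub>R rk_outer D (\<lambda>j. X k j \<epsilon>) \<in> tdom D" if "k < N" for k
        using elim that unfolding OK_def by blast
      have "hohp_functional G D l (vary \<gamma> g x Gs X V \<epsilon>) = dt D * (\<Sum>k<N. (\<Sum>i\<in>St.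
         rkB D i * l (X k i \<epsilon>, V k i \<epsilon>)
        + s\<mu> \<gamma> k i ((1 / dt D) *\<^sub>R \<sigma> (inv (g k \<epsilon>) \<otimes> Gs k i \<epsilon>) - rk_inner D (\<lambda>j. X k j \<epsilon>) i)
        + s\<nu> \<gamma> k i ((1 / dt D) *\<^sub>R (X k i \<epsilon> - x k \<epsilon>) - rk_inner D (\<lambda>j. V k j \<epsilon>) i))
     + p\<mu>c \<gamma> (k+1) ((1 / dt D) *\<^sub>R \<sigma> (inv (g k \<epsilon>) \<otimes> g (k+1) \<epsilon>) - rk_outer D (\<lambda>j. X k j \<epsilon>))
     + p\<nu> \<gamma> (k+1) ((1 / dt D) *\<^sub>R (x (k+1) \<epsilon> - x k \<epsilon>) - rk_outer D (\<lambda>j. V k j \<epsilon>)))"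
        by (simp add: hohp_functional_def vary_def tau_inv_sigma)
      also have "\<dots> = ?c"
      proof (intro arg_cong[where f="(*) (dt D)"] sum.cong refl)
        fix k assume "k \<in> {..<N}"
        then have k: "k < N" by simp
        have "s\<mu> \<gamma> k i ((1 / dt D) *\<^sub>R \<sigma> (inv (g k \<epsilon>) \<otimes> Gs k i \<epsilon>) - rk_inner D (\<lambda>j. X k j \<epsilon>) i) = 0"
          "s\<nu> \<gamma> k i ((1 / dt D) *\<^sub>R (X k i \<epsilon> - x k \<epsilon>) - rk_inner D (\<lambda>j. V k j \<epsilon>) i) = 0" if "i \<in> St" for i
          unfolding inner(1,2)[OF k that] \<sigma>[OF k inner(3)[OF k that]] h by (simp_all add: blinfun.zero_right)
        moreover have "p\<mu>c \<gamma> (k+1) ((1 / dt D) *\<^sub>R \<sigma> (inv (g k \<epsilon>) \<otimes> g (k+1) \<epsilon>) - rk_outer D (\<lambda>j. X k j \<epsilon>)) = 0"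
          unfolding Suc_eq_plus1[symmetric] g_Suc \<sigma>[OF k outer[OF k]] h by (simp add: blinfun.zero_right)
        moreover have "p\<nu> \<gamma> (k+1) ((1 / dt D) *\<^sub>R (x (k+1) \<epsilon> - x k \<epsilon>) - rk_outer D (\<lambda>j. V k j \<epsilon>)) = 0"
          unfolding Suc_eq_plus1[symmetric] x_Suc add_diff_cancel_left' h by (simp add: blinfun.zero_right)
        ultimately show "(\<Sum>i\<in>St. rkB D i * l (X k i \<epsilon>, V k i \<epsilon>)
            + s\<mu> \<gamma> k i ((1 / dt D) *\<^sub>R \<sigma> (inv (g k \<epsilon>) \<otimes> Gs k i \<epsilon>) - rk_inner D (\<lambda>j. X k j \<epsilon>) i)
            + s\<nu> \<gamma> k i ((1 / dt D) *\<^sub>R (X k i \<epsilon> - x k \<epsilon>) - rk_inner D (\<lambda>j. V k j \<epsilon>) i))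
          + p\<mu>c \<gamma> (k+1) ((1 / dt D) *\<^sub>R \<sigma> (inv (g k \<epsilon>) \<otimes> g (k+1) \<epsilon>) - rk_outer D (\<lambda>j. X k j \<epsilon>))
          + p\<nu> \<gamma> (k+1) ((1 / dt D) *\<^sub>R (x (k+1) \<epsilon> - x k \<epsilon>) - rk_outer D (\<lambda>j. V k j \<epsilon>))
          = (\<Sum>i\<in>St. rkB D i * l (s\<Xi> \<gamma> k i, sV \<gamma> k i))"
          using lW[OF k] by simp
      qed
      finally show ?case by simp
    qed
    have "((\<lambda>\<epsilon>. hohp_functional G D l (vary \<gamma> g x Gs X V \<epsilon>)) has_vector_derivative 0) (at 0)"
      by (subst has_vector_derivative_cong_ev[OF ev]) (use eventually_nhds_x_imp_x[OF ev] in simp_all)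
    with full show ?thesis by (rule vector_derivative_unique_at)
  qed
  moreover have "?D g' x' = 0"
  proof -
    have "vary \<gamma> g' x' Gs X V 0 = \<gamma>" by (cases \<gamma>) (use node0' at0 in \<open>simp add: vary_def fun_eq_iff\<close>)
    moreover have "\<forall>k\<in>{0, N}. lvel G (g' k) 0 = 0 \<and> ?d (x' k) = 0"
      using dp(1) by (simp add: g'_def x'_def lvel_const)
    ultimately have "fixed_end_variation G D \<gamma> (vary \<gamma> g' x' Gs X V)"
      unfolding fixed_end_variation_def
      using plot_smooth_curve[OF manifold_G] smooth' Gs X V
      by (simp add: vary_def smooth_at_smooth_curve_vec smooth_at_const)
    then have "((\<lambda>\<epsilon>. hohp_functional G D l (vary \<gamma> g' x' Gs X V \<epsilon>)) has_vector_derivative 0) (at 0)"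
      using sol unfolding hohp_solution_def has_real_derivative_iff_has_vector_derivative by blast
    with frozen show ?thesis by (rule vector_derivative_unique_at)
  qed
  ultimately have "?D g x - ?D g' x' = 0" by simp
  \<comment> \<open>Stage terms and interior node velocities cancel. What remains sits at the first
    node in summand 0 and at the last node in summand \<open>N - 1\<close>; for \<open>N = 1\<close>
    these are the same summand.\<close>
  also have "?D g x - ?D g' x' = (\<Sum>k<N. (if k = 0 then - out_momentum \<gamma> 0 (lvel G (g 0) 0) (?d (x 0)) else 0)
     + (if k = N - 1 then in_momentum \<gamma> k (lvel G (g N) 0) (?d (x N)) else 0))"
    unfolding sum_subtractf[symmetric]
  proof (intro sum.cong refl)
    fix k assume k: "k \<in> {..<N}"
    have z: "out_momentum \<gamma> k 0 0 = 0" "in_momentum \<gamma> k 0 0 = 0" if "k < N" for k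
      unfolding out_momentum_def in_momentum_def
      using that by (simp_all add: linear_0[OF bounded_linear.linear[OF bounded_linear_T]] outer(1) \<theta>i minus_U blinfun.zero_right)
    have c: "lvel G (g' k) 0 = (if k = 0 \<or> k = N then 0 else lvel G (g k) 0)"
      "?d (x' k) = (if k = 0 \<or> k = N then 0 else ?d (x k))" if "k \<le> N" for k
      using that dp(1)[OF that] by (auto simp: g'_def x'_def lvel_const)
    show "stage_derivative \<gamma> Gs X V k - out_momentum \<gamma> k (lvel G (g k) 0) (?d (x k))
        + in_momentum \<gamma> k (lvel G (g (k+1)) 0) (?d (x (k+1)))
      - (stage_derivative \<gamma> Gs X V k - out_momentum \<gamma> k (lvel G (g' k) 0) (?d (x' k))
        + in_momentum \<gamma> k (lvel G (g' (k+1)) 0) (?d (x' (k+1))))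
      = (if k = 0 then - out_momentum \<gamma> 0 (lvel G (g 0) 0) (?d (x 0)) else 0)
        + (if k = N - 1 then in_momentum \<gamma> k (lvel G (g N) 0) (?d (x N)) else 0)"
      using k z[of k] by (auto simp: c)
  qed
  also have "\<dots> = in_momentum \<gamma> (N - 1) (lvel G (g N) 0) (?d (x N)) - out_momentum \<gamma> 0 (lvel G (g 0) 0) (?d (x 0))"
    using nsteps_pos by (simp add: sum.distrib)
  finally have bal: "in_momentum \<gamma> (N - 1) (lvel G (g N) 0) (?d (x N)) = out_momentum \<gamma> 0 (lvel G (g 0) 0) (?d (x 0))"
    by simp

  \<comment> \<open>Here the condition on the final node enters: the recursive node moves with the
    group near 0, so its velocity is the infinitesimal generator.\<close>
  have "\<forall>\<^sub>F \<epsilon> in nhds 0. g N \<epsilon> = fst (Tmap G (flow \<zeta> \<epsilon>) (pg \<gamma> N, p\<xi> \<gamma> N))"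
    using OK by eventually_elim (simp add: OK_def prod_eq_iff)
  moreover have "\<forall>\<^sub>F \<epsilon> in nhds 0. x N \<epsilon> = snd (Tmap G (flow \<zeta> \<epsilon>) (pg \<gamma> N, p\<xi> \<gamma> N))"
    using OK by eventually_elim (simp add: OK_def prod_eq_iff)
  ultimately have "TG_generator G expH \<Phi> \<zeta> (pg \<gamma> N, p\<xi> \<gamma> N) = (lvel G (g N) 0, ?d (x N))"
    unfolding TG_generator_def flow_def[symmetric]
    by (auto intro!: lvel_cong[symmetric] vector_derivative_cong_eq elim: eventually_mono)
  moreover have "TG_generator G expH \<Phi> \<zeta> (pg \<gamma> 0, p\<xi> \<gamma> 0) = (lvel G (g 0) 0, ?d (x 0))"
    unfolding TG_generator_def flow_def[symmetric] g_0 x_0 ..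
  ultimately show ?thesis
    using momentum_map_initial_state[of \<gamma> expH \<Phi> \<zeta>] momentum_map_final_state[of \<gamma> expH \<Phi> \<zeta>] outer(1) \<theta>i nsteps_pos bal by simp
qed

end

theorem mainTheorem6:
  fixes G :: "('g, 'v::real_normed_vector) lie"
    and H :: "('h, 'w::real_normed_vector) lie"
    and L :: "(real \<Rightarrow> 'g) set \<Rightarrow> real"
    and l :: "'v \<times> 'v \<Rightarrow> real"
    and D :: "('g, 'v) scheme"
    and F :: "('g, 'v) cotan \<Rightarrow> ('g, 'v) cotan"
    and \<Phi> :: "'h \<Rightarrow> 'g \<Rightarrow> 'g"
    and expH :: "'w \<Rightarrow> 'h"
  assumes "lie_group G"
    and "reduced_lagrangian G L l" and "l differentiable_on UNIV"
    and "dt D > 0" and "nsteps D \<ge> 1" and "nstages D \<ge> 1"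
    and "local_diffeo_tau G (tau D) (tdom D)"
    and "induces_flow G D l F"
    and "lie_group H" and "exponential_map H expH" and "smooth_action H G \<Phi>"
    and "lagrangian_invariant H G L \<Phi>"
    and "\<And>\<gamma>. hohp_solution G D l \<gamma> \<Longrightarrow> reconstruction_preserved G D expH \<Phi> \<gamma>"
  shows "\<forall>\<gamma>. hohp_solution G D l \<gamma> \<longrightarrow>
           momentum_map G expH \<Phi> ((F ^^ nsteps D) (hohp_state G D \<gamma> 0))
           = momentum_map G expH \<Phi> (hohp_state G D \<gamma> 0)"
proof (intro allI impI)
  fix \<gamma> assume sol: "hohp_solution G D l \<gamma>"
  interpret hohp_action G D l H \<Phi> expH
    by unfold_locales (rule assms)+
  \<comment> \<open>The induced flow identifies the iterate with the state at the last node; the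
    rest is a statement about one path.\<close>
  have "(F ^^ nsteps D) (hohp_state G D \<gamma> 0) = hohp_state G D \<gamma> (nsteps D)"
    using \<open>induces_flow G D l F\<close> sol unfolding induces_flow_def by blast
  moreover have "momentum_map G expH \<Phi> (hohp_state G D \<gamma> (nsteps D)) = momentum_map G expH \<Phi> (hohp_state G D \<gamma> 0)"
    by (rule ext) (rule momentum_conserved[OF sol assms(2,12) assms(13)[OF sol]])
  ultimately show "momentum_map G expH \<Phi> ((F ^^ nsteps D) (hohp_state G D \<gamma> 0))
      = momentum_map G expH \<Phi> (hohp_state G D \<gamma> 0)"
    by simp
qed

end
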